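(* Let $\mathbb{K}$ be a field. For every finite simple graph $G$ with edge ideal $I(G)$ and for every integer $s\geq 1$, we have $$\mathrm{reg}(I(G)^s)\leq 2s+\text{ord-match}(G)-1.$$
   Context: All graphs are finite and simple. For a graph $G$ with vertex set $V(G)=\{v_1,\ldots,v_n\}$, let $S=\mathbb{K}[x_1,\ldots,x_n]$ be the standard graded polynomial ring over $\mathbb{K}$; the edge ideal of $G$ is $I(G)=(x_ix_j : v_iv_j\in E(G))\subseteq S$. For a finitely generated graded $S$-module $M$ with graded Betti numbers $\beta_{i,j}(M)$ (so the $i$-th module in the minimal graded free resolution of $M$ is $\bigoplus_j S(-j)^{\beta_{i,j}(M)}$), the Castelnuovo--Mumford regularity is $\mathrm{reg}(M)=\max\{j-i : \beta_{i,j}(M)\neq 0\}$ (with $\mathrm{reg}(0)=-\infty$). A matching of $G$ is a set of pairwise disjoint edges of $G$. A nonempty matching $M=\{\{a_i,b_i\} : 1\leq i\leq r\}$ of $G$ is an ordered matching of $G$ if (for this labelling of its edges and endpoints) the following hold: (1) $\{a_1,\ldots,a_r\}$ is an independent set of vertices of $G$ (no two of them are adjacent); and (2) $\{a_i,b_j\}\in E(G)$ implies $i\leq j$. The ordered matching number is $\text{ord-match}(G)=\max\{|M| : M\subseteq E(G) \text{ is an ordered matching of } G\}$, with $\text{ord-match}(G)=0$ if $G$ has no edge. *)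

theory Defs
  imports
    "HOL-Algebra.Ideal_Product"
    "HOL-Library.Poly_Mapping"
    "HOL-Library.Extended_Real"
    "Jordan_Normal_Form.Matrix"
begin

section \<open>Graphs and ordered matchings\<close>

definition simple_graph :: "'v set \<Rightarrow> 'v set set \<Rightarrow> bool" where
  "simple_graph V E \<longleftrightarrow> finite V \<and> (\<forall>e\<in>E. e \<subseteq> V \<and> card e = 2)"

definition matching :: "'v set set \<Rightarrow> 'v set set \<Rightarrow> bool" where
  "matching E M \<longleftrightarrow> M \<subseteq> E \<and> (\<forall>e\<in>M. \<forall>f\<in>M. e \<noteq> f \<longrightarrow> e \<inter> f = {})"

text \<open>
  A set of edges is an ordered matching if \<^emph>\<open>some\<close> labelling of its edges and of their
  endpoints has the two required properties.
\<close>

definition ordered_matching :: "'v set set \<Rightarrow> 'v set set \<Rightarrow> bool" where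
  "ordered_matching E M \<longleftrightarrow> M \<noteq> {} \<and> matching E M \<and>
     (\<exists>(r::nat) a b. bij_betw (\<lambda>i. {a i, b i}) {1..r} M \<and>
        (\<forall>i\<in>{1..r}. \<forall>j\<in>{1..r}. {a i, a j} \<notin> E) \<and>
        (\<forall>i\<in>{1..r}. \<forall>j\<in>{1..r}. {a i, b j} \<in> E \<longrightarrow> i \<le> j))"

definition ord_match :: "'v set set \<Rightarrow> nat" where
  "ord_match E = (if E = {} then 0 else Max (card ` {M. ordered_matching E M}))"


section \<open>Polynomial rings and edge ideals\<close>

text \<open>
  A monomial is a finitely supported exponent function; a polynomial is a finitely supported
  function from monomials to coefficients. The product of the type class instance is the
  convolution product.
\<close>

type_synonym ('v, 'k) mpoly = "('v \<Rightarrow>\<^sub>0 nat) \<Rightarrow>\<^sub>0 'k"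

definition poly_ring :: "'v set \<Rightarrow> ('v, 'k::field) mpoly ring" where
  "poly_ring V =
     \<lparr>carrier = {p. \<forall>m\<in>Poly_Mapping.keys p. Poly_Mapping.keys m \<subseteq> V},
      monoid.mult = (*), one = 1, zero = 0, add = (+)\<rparr>"

lemma cring_poly_ring: "cring (poly_ring V :: ('v, 'k::field) mpoly ring)"
proof (rule cringI)
  show "abelian_group (poly_ring V :: ('v, 'k) mpoly ring)"
  proof (rule abelian_groupI)
    fix p q :: "('v, 'k) mpoly"
    assume "p \<in> carrier (poly_ring V)" "q \<in> carrier (poly_ring V)"
    then show "p \<oplus>\<^bsub>poly_ring V\<^esub> q \<in> carrier (poly_ring V)"
      using Poly_Mapping.keys_add[of p q] by (auto simp: poly_ring_def)
  next
    fix p :: "('v, 'k) mpoly"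
    assume "p \<in> carrier (poly_ring V)"
    then show "\<exists>q\<in>carrier (poly_ring V). q \<oplus>\<^bsub>poly_ring V\<^esub> p = \<zero>\<^bsub>poly_ring V\<^esub>"
      by (intro bexI[of _ "- p"]) (simp_all add: poly_ring_def in_keys_iff)
  qed (simp_all add: poly_ring_def ac_simps)
  show "comm_monoid (poly_ring V :: ('v, 'k) mpoly ring)"
  proof (rule comm_monoidI)
    fix p q :: "('v, 'k) mpoly"
    assume p: "p \<in> carrier (poly_ring V)" and q: "q \<in> carrier (poly_ring V)"
    have "Poly_Mapping.keys m \<subseteq> V" if m_in: "m \<in> Poly_Mapping.keys (p * q)" for m
    proof -
      obtain m1 m2 where m: "m = m1 + m2"
        and mem: "m1 \<in> Poly_Mapping.keys p" "m2 \<in> Poly_Mapping.keys q"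
        using Poly_Mapping.keys_mult[of p q] m_in by blast
      have "Poly_Mapping.keys m1 \<subseteq> V" "Poly_Mapping.keys m2 \<subseteq> V"
        using p q mem by (simp_all add: poly_ring_def)
      then show ?thesis
        using Poly_Mapping.keys_add[of m1 m2] unfolding m by blast
    qed
    then show "p \<otimes>\<^bsub>poly_ring V\<^esub> q \<in> carrier (poly_ring V)"
      by (simp add: poly_ring_def)
  qed (simp_all add: poly_ring_def ac_simps)
qed (simp add: poly_ring_def distrib_right)

definition var :: "'v \<Rightarrow> ('v, 'k::field) mpoly" where
  "var v = Poly_Mapping.single (Poly_Mapping.single v 1) 1"

definition edge_ideal :: "'v set \<Rightarrow> 'v set set \<Rightarrow> ('v, 'k::field) mpoly set" where
  "edge_ideal V E = Idl\<^bsub>poly_ring V\<^esub> {var u * var v |u v. {u, v} \<in> E}"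

definition monomial_degree :: "('v \<Rightarrow>\<^sub>0 nat) \<Rightarrow> nat" where
  "monomial_degree m = (\<Sum>v\<in>Poly_Mapping.keys m. Poly_Mapping.lookup m v)"


section \<open>Minimal graded free resolutions and regularity of homogeneous ideals\<close>

definition free_module :: "'v set \<Rightarrow> nat \<Rightarrow> ('v, 'k::field) mpoly vec set" where
  "free_module V r = {w \<in> carrier_vec r. \<forall>k<r. w $ k \<in> carrier (poly_ring V)}"

text \<open>
  A graded free resolution
  \<open>\<dots> \<rightarrow> F\<^sub>2 \<rightarrow> F\<^sub>1 \<rightarrow> F\<^sub>0 \<rightarrow> I \<rightarrow> 0\<close> of a homogeneous ideal \<open>I\<close> is encoded by the lists
  \<open>D i\<close> of the degrees of the basis elements, so that \<open>F\<^sub>i\<close> is the direct sum of the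
  \<open>S(-j)\<close> for \<open>j\<close> in \<open>D i\<close>, and by the matrices \<open>d i\<close> of the maps out of \<open>F\<^sub>i\<close>. The map
  \<open>d 0\<close> is the augmentation followed by the inclusion of \<open>I\<close> into \<open>S\<close>, a map of degree 0 into the
  free module with degree list \<open>[0]\<close>. Degrees are natural numbers: in a minimal resolution
  of an ideal no negative shift can occur.
\<close>

definition target_degrees :: "(nat \<Rightarrow> nat list) \<Rightarrow> nat \<Rightarrow> nat list" where
  "target_degrees D i = (case i of 0 \<Rightarrow> [0] | Suc i' \<Rightarrow> D i')"

text \<open>
  A map of degree 0 from the free module with degree list \<open>xs\<close> to the one with degree list
  \<open>ys\<close>: the entry \<open>(k, l)\<close> is homogeneous of degree \<open>xs ! l - ys ! k\<close>, and hence zero if this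
  difference is negative.
\<close>

definition graded_map :: "'v set \<Rightarrow> nat list \<Rightarrow> nat list \<Rightarrow> ('v, 'k::field) mpoly mat \<Rightarrow> bool" where
  "graded_map V xs ys A \<longleftrightarrow>
     A \<in> carrier_mat (length ys) (length xs) \<and>
     (\<forall>k<length ys. \<forall>l<length xs. A $$ (k, l) \<in> carrier (poly_ring V) \<and>
        (\<forall>m\<in>Poly_Mapping.keys (A $$ (k, l)). monomial_degree m + ys ! k = xs ! l))"

definition graded_free_resolution ::
  "'v set \<Rightarrow> ('v, 'k::field) mpoly set \<Rightarrow> (nat \<Rightarrow> nat list) \<Rightarrow> (nat \<Rightarrow> ('v, 'k) mpoly mat) \<Rightarrow> bool"
  where
  "graded_free_resolution V I D d \<longleftrightarrow>
     (\<forall>i. graded_map V (D i) (target_degrees D i) (d i)) \<and>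
     (\<lambda>w. (d 0 *\<^sub>v w) $ 0) ` free_module V (length (D 0)) = I \<and>
     (\<forall>i. {w \<in> free_module V (length (D i)). d i *\<^sub>v w = 0\<^sub>v (length (target_degrees D i))} =
          (\<lambda>w. d (Suc i) *\<^sub>v w) ` free_module V (length (D (Suc i))))"

text \<open>
  Minimality: the image of \<open>F\<^bsub>i+1\<^esub>\<close> lies in \<open>\<mm>F\<^sub>i\<close> where \<open>\<mm>\<close> is generated by
  the variables, i.e. the matrix entries have no constant term. This is not imposed on \<open>d 0\<close>.
\<close>

definition minimal_graded_free_resolution ::
  "'v set \<Rightarrow> ('v, 'k::field) mpoly set \<Rightarrow> (nat \<Rightarrow> nat list) \<Rightarrow> (nat \<Rightarrow> ('v, 'k) mpoly mat) \<Rightarrow> bool"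
  where
  "minimal_graded_free_resolution V I D d \<longleftrightarrow>
     graded_free_resolution V I D d \<and>
     (\<forall>i. \<forall>k<length (D i). \<forall>l<length (D (Suc i)).
        Poly_Mapping.lookup (d (Suc i) $$ (k, l)) 0 = 0)"

text \<open>
  For a homogeneous ideal a minimal graded free resolution exists and is unique up to
  isomorphism, so the number of shifts does not depend on the choice.
\<close>

definition betti :: "'v set \<Rightarrow> ('v, 'k::field) mpoly set \<Rightarrow> nat \<Rightarrow> nat \<Rightarrow> nat" where
  "betti V I i j =
     count_list (fst (SOME (D, d). minimal_graded_free_resolution V I D d) i) j"

text \<open>
  The supremum in the extended reals makes the regularity of the zero ideal equal to
  \<open>-\<infinity>\<close>; for nonzero homogeneous ideals it is a maximum.
\<close>

definition regularity :: "'v set \<Rightarrow> ('v, 'k::field) mpoly set \<Rightarrow> ereal" where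
  "regularity V I = Sup {ereal (real j - real i) |i j. betti V I i j \<noteq> 0}"

end

theory Submission
  imports Defs "HOL-Library.Multiset" "HOL-Library.Function_Algebras"
begin

text \<open>
  Let \<open>I\<close> be the edge ideal, and write \<open>r\<close> for a bound on the regularity. The proof has two halves.

  The Betti number of a homogeneous ideal in homological degree \<open>p\<close> and internal degree \<open>d\<close> is the
  dimension of its Koszul homology there. For a monomial ideal the Koszul complex splits into
  multidegrees: at the monomial \<open>m\<close> it is the augmented chain complex of the simplicial complex of
  all squarefree divisors of \<open>m\<close> whose cofactor lies in the ideal. Thus \<open>reg_le r\<close>, the condition
  that these complexes have no homology beyond degree \<open>r\<close>, is a statement about finite set systems,
  and the long exact sequence of a colon ideal becomes a Mayer-Vietoris argument:
  \<open>reg_le_colon\<close> says \<open>reg J \<le> max (reg (J : f) + deg f) (reg (J + (f)))\<close>.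

  The combinatorial half bounds \<open>I^(s+1)\<close> by induction on \<open>s\<close>. The minimal generators of \<open>I^s\<close> are added
  to \<open>I^(s+1)\<close> one at a time, by increasing weight for some weight that is injective on the
  vertices, until the ideal has become \<open>I^s\<close>. When \<open>f\<close> is added, a comparison of perfect
  matchings (\<open>edge_power_exchange\<close>) shows that the colon ideal by \<open>f\<close> is generated by variables and
  by the quadratic monomials \<open>p q\<close> with \<open>p q f\<close> in \<open>I^(s+1)\<close> (\<open>colon_edge_power\<close>). An ideal of this
  shape has regularity at most one more than the length of the longest ordered matching of its
  quadratic part (\<open>reg_le_quadratic_ideal\<close>): split off a vertex \<open>x\<close> that has a neighbour \<open>y\<close>; the
  colon by \<open>x\<close> kills all neighbours of \<open>x\<close>, so that \<open>(x, y)\<close> can be appended to every ordered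
  matching that survives. Finally an ordered matching \<open>(a\<^sub>i, b\<^sub>i)\<close> of the quadratic part gives one of
  the same length in \<open>G\<close> (\<open>ordered_seq_even_connected\<close>): replace \<open>b\<^sub>i\<close> by the partner of \<open>a\<^sub>i\<close> in a
  factorization of \<open>a\<^sub>i b\<^sub>i f\<close> into edges.

  The algebraic half passes from \<open>reg_le r\<close> to minimal free resolutions. The Koszul complex of
  a free module is acyclic, so the vanishing of Koszul homology can be shifted from one
  syzygy module to the next (\<open>dimension_shift\<close>). In homological degree \<open>0\<close> it says that the
  \<open>i\<close>-th syzygy module is generated in degrees at most \<open>r + i\<close>. This bounds the degrees in every
  minimal resolution (\<open>basis_degree_bound\<close>), and since graded pieces are finite-dimensional it also
  makes every syzygy module finitely generated, so that a minimal resolution can be built step by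
  step (\<open>minimal_presentation\<close>, \<open>minimal_resolution_exists\<close>). Existence is needed because the Betti
  numbers refer to a chosen resolution.
\<close>

section \<open>Koszul differentials and acyclic families of sets\<close>

text \<open>
  The sign \<open>(-1)\<^sup>n\<close> acting on an arbitrary abelian group, so that the same differential serves chains
  with coefficients in a field and chains with coefficients in a module.
\<close>

definition alt :: "nat \<Rightarrow> 'a::ab_group_add \<Rightarrow> 'a" where
  "alt n x = (if even n then x else - x)"

lemma alt_simps [simp]:
  "alt n 0 = 0" "alt n (x + y) = alt n x + alt n y" "alt n (- x) = - alt n x"
  "alt m (alt n x) = alt (m + n) x" "alt (n + n) x = x" "alt n x = 0 \<longleftrightarrow> x = 0"
  by (auto simp: alt_def)

lemma alt_diff: "alt n (x - y) = alt n x - alt n y"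
  by (simp add: alt_def)

lemma alt_sum: "alt n (sum f A) = (\<Sum>i\<in>A. alt n (f i))"
  by (simp add: alt_def sum_negf)

text \<open>
  The induction pairs the terms \<open>(v, w)\<close> and \<open>(w, v)\<close>; halving the sum would fail in characteristic 2.
\<close>

lemma antisymmetric_double_sum:
  fixes g :: "'v \<Rightarrow> 'v \<Rightarrow> 'a::ab_group_add"
  assumes "finite A" and "\<And>v w. v \<in> A \<Longrightarrow> w \<in> A \<Longrightarrow> v \<noteq> w \<Longrightarrow> g v w = - g w v"
  shows "(\<Sum>v\<in>A. \<Sum>w\<in>A - {v}. g v w) = 0"
  using assms
proof (induction A rule: finite_induct)
  case (insert a A)
  have eq: "(\<Sum>w\<in>insert a A - {v}. g v w) = g v a + (\<Sum>w\<in>A - {v}. g v w)" if "v \<in> A" for v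
  proof -
    have "insert a A - {v} = insert a (A - {v})" using insert.hyps that by auto
    then show ?thesis using insert.hyps by simp
  qed
  have "(\<Sum>v\<in>insert a A. \<Sum>w\<in>insert a A - {v}. g v w)
      = (\<Sum>w\<in>A. g a w) + (\<Sum>v\<in>A. g v a + (\<Sum>w\<in>A - {v}. g v w))"
    using insert.hyps by (simp add: eq)
  also have "\<dots> = (\<Sum>w\<in>A. g a w + g w a) + (\<Sum>v\<in>A. \<Sum>w\<in>A - {v}. g v w)"
    by (simp add: sum.distrib)
  also have "(\<Sum>w\<in>A. g a w + g w a) = 0"
  proof (intro sum.neutral ballI)
    fix w assume "w \<in> A"
    then have "g a w = - g w a" using insert.hyps by (intro insert.prems) auto
    then show "g a w + g w a = 0" by simp
  qed
  also have "(\<Sum>v\<in>A. \<Sum>w\<in>A - {v}. g v w) = 0"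
    by (intro insert.IH insert.prems) auto
  finally show ?case by simp
qed simp

text \<open>
  The numbering \<open>idx\<close> only fixes the signs of the differential; later its injectivity on \<open>V\<close> also
  makes it a weight that separates the vertices. The parameter \<open>K\<close> carries the type of coefficients.
\<close>

locale vertex_order =
  fixes V :: "'v set" and idx :: "'v \<Rightarrow> nat" and K :: "'k::ab_group_add itself"
  assumes finite_V: "finite V" and inj_idx: "inj_on idx V"
begin

definition pos :: "'v \<Rightarrow> 'v set \<Rightarrow> nat" where
  "pos v \<sigma> = card {w \<in> \<sigma>. idx w < idx v}"

lemma pos_insert:
  assumes "finite \<sigma>" "w \<notin> \<sigma>"
  shows "pos v (insert w \<sigma>) = (if idx w < idx v then 1 else 0) + pos v \<sigma>"
proof -
  have "{u \<in> insert w \<sigma>. idx u < idx v} =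
    (if idx w < idx v then insert w {u \<in> \<sigma>. idx u < idx v} else {u \<in> \<sigma>. idx u < idx v})"
    by auto
  then show ?thesis using assms by (simp add: pos_def)
qed

text \<open>
  The only property of the signs that matters: inserting \<open>v\<close> and \<open>w\<close> in the two possible orders gives
  opposite signs, because exactly one of \<open>v\<close>, \<open>w\<close> precedes the other.
\<close>

lemma pos_swap:
  assumes "v \<in> V" "w \<in> V" "v \<noteq> w" "finite \<sigma>" "v \<notin> \<sigma>" "w \<notin> \<sigma>"
  shows "odd (pos v \<sigma> + pos w (insert v \<sigma>) + (pos w \<sigma> + pos v (insert w \<sigma>)))"
proof -
  have "idx v \<noteq> idx w" using assms inj_idx by (auto dest: inj_onD)
  then show ?thesis using assms by (auto simp: pos_insert)
qed

text \<open>
  The Koszul differential for commuting operators \<open>X v\<close>. For \<open>X v = id\<close> it is the simplicial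
  boundary with coefficients recorded on faces: the value at \<open>\<sigma>\<close> collects all faces \<open>insert v \<sigma>\<close>.
\<close>

definition bdry :: "('v \<Rightarrow> 'a \<Rightarrow> 'a) \<Rightarrow> ('v set \<Rightarrow> 'a::ab_group_add) \<Rightarrow> 'v set \<Rightarrow> 'a" where
  "bdry X c \<sigma> = (\<Sum>v\<in>V - \<sigma>. alt (pos v \<sigma>) (X v (c (insert v \<sigma>))))"

lemma bdry_outside:
  assumes "\<And>\<tau>. \<not> \<tau> \<subseteq> V \<Longrightarrow> c \<tau> = 0" "\<And>v. X v 0 = 0" "\<not> \<sigma> \<subseteq> V"
  shows "bdry X c \<sigma> = 0"
  using assms by (auto simp: bdry_def intro!: sum.neutral)

lemma bdry_bdry:
  assumes add: "\<And>v x y. X v (x + y) = X v x + X v y"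
    and comm: "\<And>v w x. X v (X w x) = X w (X v x)"
    and fin: "finite \<sigma>"
  shows "bdry X (bdry X c) \<sigma> = 0"
proof -
  have zero: "X v 0 = 0" for v using add[of v 0 0] by simp
  have sum: "X v (sum f A) = (\<Sum>i\<in>A. X v (f i))" for v and f :: "'v \<Rightarrow> _" and A
    by (induction A rule: infinite_finite_induct) (simp_all add: zero add)
  have minus: "X v (- x) = - X v x" for v x
    using add[of v x "- x"] by (simp add: zero eq_neg_iff_add_eq_0 add.commute)
  have alt: "X v (alt n x) = alt n (X v x)" for v n x by (simp add: alt_def minus)
  define g where "g v w = alt (pos v \<sigma> + pos w (insert v \<sigma>)) (X v (X w (c (insert w (insert v \<sigma>)))))" for v w
  have "bdry X (bdry X c) \<sigma> = (\<Sum>v\<in>V - \<sigma>. \<Sum>w\<in>(V - \<sigma>) - {v}. g v w)"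
    unfolding bdry_def sum alt_sum alt g_def
    by (intro sum.cong refl) (auto simp: alt_def)
  also have "\<dots> = 0"
  proof (rule antisymmetric_double_sum)
    fix v w assume "v \<in> V - \<sigma>" "w \<in> V - \<sigma>" "v \<noteq> w"
    then have "odd (pos v \<sigma> + pos w (insert v \<sigma>) + (pos w \<sigma> + pos v (insert w \<sigma>)))"
      using fin by (intro pos_swap) auto
    then show "g v w = - g w v"
      by (auto simp: g_def alt_def comm[of v w] insert_commute[of v w])
  qed (use finite_V in auto)
  finally show ?thesis .
qed

definition chain :: "nat \<Rightarrow> 'v set set \<Rightarrow> ('v set \<Rightarrow> 'k) \<Rightarrow> bool" where
  "chain p \<Delta> c \<longleftrightarrow> (\<forall>\<tau>. c \<tau> \<noteq> 0 \<longrightarrow> \<tau> \<in> \<Delta> \<and> card \<tau> = p)"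

abbreviation bd :: "('v set \<Rightarrow> 'k) \<Rightarrow> 'v set \<Rightarrow> 'k" where
  "bd \<equiv> bdry (\<lambda>v x. x)"

text \<open>
  Vanishing of the reduced homology in degree \<open>p - 1\<close>; the index is the number of vertices of a face,
  so that \<open>p = 0\<close> refers to the empty face.
\<close>

definition acyc :: "nat \<Rightarrow> 'v set set \<Rightarrow> bool" where
  "acyc p \<Delta> \<longleftrightarrow> (\<forall>c. chain p \<Delta> c \<longrightarrow> (\<forall>\<sigma>. bd c \<sigma> = 0) \<longrightarrow> (\<exists>b. chain (Suc p) \<Delta> b \<and> bd b = c))"

definition complex :: "'v set set \<Rightarrow> bool" where
  "complex \<Delta> \<longleftrightarrow> \<Delta> \<subseteq> Pow V \<and> (\<forall>\<tau>\<in>\<Delta>. \<forall>\<sigma>\<subseteq>\<tau>. \<sigma> \<in> \<Delta>)"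

lemma chain_bd:
  assumes "complex \<Delta>" "chain (Suc p) \<Delta> b"
  shows "chain p \<Delta> (bd b)"
  unfolding chain_def
proof (intro allI impI)
  fix \<sigma> assume "bd b \<sigma> \<noteq> 0"
  then obtain v where v: "v \<in> V - \<sigma>" "b (insert v \<sigma>) \<noteq> 0"
    unfolding bdry_def by (metis (mono_tags, lifting) alt_simps(6) sum.neutral)
  then have *: "insert v \<sigma> \<in> \<Delta>" "card (insert v \<sigma>) = Suc p"
    using assms(2) by (auto simp: chain_def)
  moreover have "finite \<sigma>"
    using * assms(1) finite_V by (auto simp: complex_def intro: finite_subset)
  ultimately show "\<sigma> \<in> \<Delta> \<and> card \<sigma> = p"
    using v(1) assms(1) by (auto simp: complex_def)
qed

lemma bdry_diff:
  assumes add: "\<And>v x y. X v (x + y) = X v x + X v y"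
  shows "bdry X (\<lambda>\<tau>. b \<tau> - c \<tau>) \<sigma> = bdry X b \<sigma> - bdry X c \<sigma>"
proof -
  have "X v (x - y) = X v x - X v y" for v x y
    using add[of v "x - y" y] by (simp add: algebra_simps)
  then show ?thesis by (simp add: bdry_def alt_diff sum_subtractf)
qed

lemma bdry_add:
  assumes add: "\<And>v x y. X v (x + y) = X v x + X v y"
  shows "bdry X (\<lambda>\<tau>. b \<tau> + c \<tau>) \<sigma> = bdry X b \<sigma> + bdry X c \<sigma>"
  by (simp add: bdry_def add sum.distrib)

lemma bd_bd:
  assumes "\<And>\<tau>. b \<tau> \<noteq> 0 \<Longrightarrow> finite \<tau>"
  shows "bd (bd b) \<sigma> = 0"
proof (cases "finite \<sigma>")
  case True
  then show ?thesis by (intro bdry_bdry) auto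
next
  case False
  then show ?thesis unfolding bdry_def using assms
    by (intro sum.neutral ballI) (auto intro!: sum.neutral, metis finite_insert)
qed

lemma chain_mono: "chain p A c \<Longrightarrow> A \<subseteq> B \<Longrightarrow> chain p B c"
  by (auto simp: chain_def)

text \<open>
  The part \<open>H(A \<inter> B) \<rightarrow> H(A) \<oplus> H(B) \<rightarrow> H(A \<union> B)\<close> of the Mayer-Vietoris sequence. A cycle on \<open>A\<close> bounds
  some \<open>b\<close> on \<open>A \<union> B\<close>. Cut \<open>b\<close> into a part on \<open>A\<close> and a part on \<open>B\<close>: the boundary of the second part
  lives on \<open>A \<inter> B\<close>, is a cycle there, and can be filled there.
\<close>

theorem mayer_vietoris:
  assumes A: "complex A" and B: "complex B"
    and un: "acyc p (A \<union> B)" and int: "acyc p (A \<inter> B)"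
  shows "acyc p A"
  unfolding acyc_def
proof (intro allI impI)
  fix c assume c: "chain p A c" and cyc: "\<forall>\<sigma>. bd c \<sigma> = 0"
  obtain b where b: "chain (Suc p) (A \<union> B) b" "bd b = c"
    using un c cyc chain_mono[OF c, of "A \<union> B"] by (auto simp: acyc_def)
  define b1 where "b1 \<tau> = (if \<tau> \<in> A then b \<tau> else 0)" for \<tau>
  define b2 where "b2 \<tau> = (if \<tau> \<in> A then 0 else b \<tau>)" for \<tau>
  have b1: "chain (Suc p) A b1" and b2: "chain (Suc p) B b2"
    using b(1) by (auto simp: chain_def b1_def b2_def)
  have b12: "b = (\<lambda>\<tau>. b1 \<tau> + b2 \<tau>)" by (auto simp: b1_def b2_def)
  have eq: "bd b2 \<sigma> = c \<sigma> - bd b1 \<sigma>" for \<sigma>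
    using b(2)[symmetric] by (simp add: b12 bdry_add)
  have "chain p A (bd b2)"
    using chain_bd[OF A b1] c unfolding eq chain_def by (metis diff_zero diff_self)
  then have "chain p (A \<inter> B) (bd b2)"
    using chain_bd[OF B b2] by (auto simp: chain_def)
  moreover have "bd (bd b2) \<sigma> = 0" for \<sigma>
    using b2 B finite_V by (intro bd_bd) (auto simp: chain_def complex_def intro: finite_subset)
  ultimately obtain e where e: "chain (Suc p) (A \<inter> B) e" "bd e = bd b2"
    using int by (auto simp: acyc_def)
  have "chain (Suc p) A (\<lambda>\<tau>. b1 \<tau> + e \<tau>)"
    using b1 e(1) unfolding chain_def by (metis Int_iff add_0)
  moreover have "bd (\<lambda>\<tau>. b1 \<tau> + e \<tau>) = c"
    by (rule ext) (simp add: bdry_add e eq)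
  ultimately show "\<exists>b. chain (Suc p) A b \<and> bd b = c" by blast
qed

text \<open>
  Adding the apex \<open>v\<close> to each face is a contracting homotopy.
\<close>

theorem cone_acyc:
  assumes D: "\<Delta> \<subseteq> Pow V" and v: "v \<in> V"
    and cone: "\<And>\<tau>. insert v \<tau> \<in> \<Delta> \<longleftrightarrow> \<tau> \<in> \<Delta>"
  shows "acyc p \<Delta>"
  unfolding acyc_def
proof (intro allI impI)
  fix c assume c: "chain p \<Delta> c" and cyc: "\<forall>\<sigma>. bd c \<sigma> = 0"
  have c0: "c \<tau> = 0" if "\<not> \<tau> \<subseteq> V" for \<tau> using c that D by (auto simp: chain_def)
  define h where "h \<tau> = (if v \<in> \<tau> then alt (pos v (\<tau> - {v})) (c (\<tau> - {v})) else 0)" for \<tau>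
  have "chain (Suc p) \<Delta> h"
    unfolding chain_def
  proof (intro allI impI)
    fix \<tau> assume "h \<tau> \<noteq> 0"
    then have *: "v \<in> \<tau>" "c (\<tau> - {v}) \<noteq> 0" by (auto simp: h_def split: if_splits)
    then have **: "\<tau> - {v} \<in> \<Delta>" "card (\<tau> - {v}) = p" using c by (auto simp: chain_def)
    then have "\<tau> \<in> \<Delta>" using cone[of "\<tau> - {v}"] *(1) by (simp add: insert_absorb)
    moreover from this have "finite \<tau>" using D finite_V by (auto intro: finite_subset)
    ultimately show "\<tau> \<in> \<Delta> \<and> card \<tau> = Suc p"
      using * ** by (metis card_Suc_Diff1)
  qed
  moreover have "bd h \<sigma> = c \<sigma>" for \<sigma>
  proof (cases "\<sigma> \<subseteq> V")
    case False
    have "h \<tau> = 0" if "\<not> \<tau> \<subseteq> V" for \<tau>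
      using that v c0[of "\<tau> - {v}"] by (auto simp: h_def)
    then have "bd h \<sigma> = 0" using False by (intro bdry_outside) auto
    then show ?thesis using c0 False by simp
  next
    case sub: True
    then have fin: "finite \<sigma>" using finite_V by (rule finite_subset)
    show ?thesis
    proof (cases "v \<in> \<sigma>")
      case False
      have "bd h \<sigma> = (\<Sum>w\<in>V - \<sigma>. if w = v then c \<sigma> else 0)"
        unfolding bdry_def using False
        by (intro sum.cong refl) (auto simp: h_def insert_Diff_if)
      also have "\<dots> = c \<sigma>" using v False finite_V by simp
      finally show ?thesis .
    next
      case True
      define \<rho> where "\<rho> = \<sigma> - {v}"
      have \<sigma>: "\<sigma> = insert v \<rho>" "v \<notin> \<rho>" "finite \<rho>" using True fin by (auto simp: \<rho>_def)
      have V\<rho>: "V - \<rho> = insert v (V - \<sigma>)" using v \<sigma> by auto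
      have h: "alt (pos w \<sigma>) (h (insert w \<sigma>)) = - alt (pos v \<rho>) (alt (pos w \<rho>) (c (insert w \<rho>)))"
        if "w \<in> V - \<sigma>" for w
      proof -
        have "odd (pos v \<rho> + pos w (insert v \<rho>) + (pos w \<rho> + pos v (insert w \<rho>)))"
          using that \<sigma> v by (intro pos_swap) auto
        moreover have "insert w (insert v \<rho>) - {v} = insert w \<rho>" using that \<sigma> by auto
        ultimately show ?thesis by (auto simp: h_def \<sigma>(1) alt_def)
      qed
      have "0 = bd c \<rho>" using cyc by simp
      also have "\<dots> = alt (pos v \<rho>) (c \<sigma>) + (\<Sum>w\<in>V - \<sigma>. alt (pos w \<rho>) (c (insert w \<rho>)))"
        unfolding bdry_def V\<rho> using finite_V \<sigma>(1) by simp
      finally have "alt (pos v \<rho>) (c \<sigma>) = - (\<Sum>w\<in>V - \<sigma>. alt (pos w \<rho>) (c (insert w \<rho>)))"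
        by (simp add: eq_neg_iff_add_eq_0)
      then have "alt (pos v \<rho>) (alt (pos v \<rho>) (c \<sigma>))
          = alt (pos v \<rho>) (- (\<Sum>w\<in>V - \<sigma>. alt (pos w \<rho>) (c (insert w \<rho>))))"
        by simp
      then have "c \<sigma> = - alt (pos v \<rho>) (\<Sum>w\<in>V - \<sigma>. alt (pos w \<rho>) (c (insert w \<rho>)))"
        by simp
      also have "\<dots> = bd h \<sigma>"
        unfolding bdry_def alt_sum sum_negf[symmetric] by (intro sum.cong refl) (simp only: h)
      finally show ?thesis by simp
    qed
  qed
  ultimately show "\<exists>b. chain (Suc p) \<Delta> b \<and> bd b = c" by (intro exI[of _ h]) auto
qed

lemma acyc_empty: "acyc p {}"
  by (auto simp: acyc_def chain_def bdry_def intro!: exI[of _ "\<lambda>_. 0"])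

end

section \<open>Monomial ideals and their regularity\<close>

definition upset :: "'v multiset set \<Rightarrow> bool" where
  "upset U \<longleftrightarrow> (\<forall>u\<in>U. \<forall>w. u + w \<in> U)"

definition up :: "'v multiset set \<Rightarrow> 'v multiset set" where
  "up G = {u. \<exists>g\<in>G. g \<subseteq># u}"

text \<open>
  A monomial is a multiset of vertices and a monomial ideal is given by the set \<open>U\<close> of its monomials.
  The complex below is the upper Koszul simplicial complex of the ideal at \<open>m\<close>; its chain complex is the
  strand of multidegree \<open>m\<close> of the Koszul complex with coefficients in the ideal.
\<close>

definition faces :: "'v multiset set \<Rightarrow> 'v multiset \<Rightarrow> 'v set set" where
  "faces U m = {\<tau>. finite \<tau> \<and> (\<exists>u\<in>U. u + mset_set \<tau> = m)}"

lemma upset_up: "upset (up G)"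
  unfolding upset_def up_def by (auto intro: subset_mset.trans mset_subset_eq_add_left)

lemma upset_Un: "upset A \<Longrightarrow> upset B \<Longrightarrow> upset (A \<union> B)"
  by (auto simp: upset_def)

lemma upsetD: "upset U \<Longrightarrow> u \<in> U \<Longrightarrow> u \<subseteq># w \<Longrightarrow> w \<in> U"
  unfolding upset_def by (metis subset_mset.add_diff_inverse)

lemma faces_iff: "\<tau> \<in> faces U m \<longleftrightarrow> finite \<tau> \<and> mset_set \<tau> \<subseteq># m \<and> m - mset_set \<tau> \<in> U"
  unfolding faces_def by (auto simp: subset_mset.add_diff_inverse intro!: bexI[of _ "m - mset_set \<tau>"])

lemma faces_Un: "faces (A \<union> B) m = faces A m \<union> faces B m"
  by (auto simp: faces_iff)

lemma mset_set_subseteq_iff: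
  assumes "finite \<tau>" shows "mset_set \<tau> \<subseteq># m \<longleftrightarrow> \<tau> \<subseteq> set_mset m"
  using assms by (metis finite_set_mset finite_set_mset_mset_set mset_set_set_mset_msubset
      msubset_mset_set_iff set_mset_mono subset_mset.trans)

context vertex_order
begin

lemma faces_subset_V: "\<tau> \<in> faces U m \<Longrightarrow> set_mset m \<subseteq> V \<Longrightarrow> \<tau> \<subseteq> V"
  by (metis faces_iff elem_mset_set mset_subset_eqD subset_iff)

lemma complex_faces:
  assumes "upset U" "set_mset m \<subseteq> V"
  shows "complex (faces U m)"
  unfolding complex_def
proof (intro conjI ballI allI impI)
  show "faces U m \<subseteq> Pow V" using faces_subset_V[OF _ assms(2)] by auto
  fix \<tau> \<sigma> assume \<tau>: "\<tau> \<in> faces U m" and \<sigma>: "\<sigma> \<subseteq> \<tau>"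
  then have fin: "finite \<tau>" "finite \<sigma>" by (auto simp: faces_iff intro: finite_subset)
  then have "mset_set \<sigma> \<subseteq># mset_set \<tau>" using \<sigma> by (simp add: subset_imp_msubset_mset_set)
  moreover obtain u where u: "u \<in> U" "u + mset_set \<tau> = m" using \<tau> by (auto simp: faces_def)
  moreover from calculation(1) have "mset_set \<tau> - mset_set \<sigma> + mset_set \<sigma> = mset_set \<tau>"
    by (rule subset_mset.diff_add)
  ultimately have "u + (mset_set \<tau> - mset_set \<sigma>) + mset_set \<sigma> = m" by (simp only: add.assoc)
  moreover have "u + (mset_set \<tau> - mset_set \<sigma>) \<in> U" using assms(1) u(1) by (simp add: upset_def)
  ultimately show "\<sigma> \<in> faces U m" using fin unfolding faces_def by blast
qed

text \<open>
  By Koszul homology this says that the monomial ideal has regularity at most \<open>r\<close>: nothing survives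
  in homological degree \<open>p\<close> and internal degree \<open>size m > r + p\<close>.
\<close>

definition reg_le :: "nat \<Rightarrow> 'v multiset set \<Rightarrow> bool" where
  "reg_le r U \<longleftrightarrow> (\<forall>m p. set_mset m \<subseteq> V \<longrightarrow> r + p < size m \<longrightarrow> acyc p (faces U m))"

lemma reg_le_mono: "reg_le r U \<Longrightarrow> r \<le> r' \<Longrightarrow> reg_le r' U"
  by (auto simp: reg_le_def)

lemma reg_le_cong:
  assumes "reg_le r U" and "\<And>u. set_mset u \<subseteq> V \<Longrightarrow> u \<in> U \<longleftrightarrow> u \<in> U'"
  shows "reg_le r U'"
proof -
  have "faces U m = faces U' m" if "set_mset m \<subseteq> V" for m
    using assms(2) that by (auto simp: faces_iff) (meson in_diffD subset_iff)+
  then show ?thesis using assms(1) by (simp add: reg_le_def)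
qed

text \<open>
  The exact sequence of \<open>J : f\<close> (shifted by the degree of \<open>f\<close>), \<open>J\<close> and \<open>J + (f)\<close> in multidegree \<open>m\<close> is
  the Mayer-Vietoris sequence for the complexes of \<open>J\<close> and \<open>(f)\<close>, since \<open>J \<inter> (f) = f (J : f)\<close>.
\<close>

theorem reg_le_colon:
  assumes U: "upset U"
    and colon: "reg_le r {u. f + u \<in> U}" and add: "reg_le (r + size f) (U \<union> up {f})"
  shows "reg_le (r + size f) U"
  unfolding reg_le_def
proof (intro allI impI)
  fix m p assume m: "set_mset m \<subseteq> V" and big: "r + size f + p < size m"
  have "acyc p (faces U m \<inter> faces (up {f}) m)"
  proof (cases "f \<subseteq># m")
    case True
    then obtain m' where m': "m = f + m'" by (metis subset_mset.add_diff_inverse)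
    have "faces U m \<inter> faces (up {f}) m = faces {u. f + u \<in> U} m'"
    proof (intro equalityI subsetI)
      fix \<tau> assume "\<tau> \<in> faces U m \<inter> faces (up {f}) m"
      then obtain u where u: "u \<in> U" "u + mset_set \<tau> = m" "f \<subseteq># u" "finite \<tau>"
        by (auto simp: faces_def up_def)
      then obtain u' where "u = f + u'" by (metis subset_mset.add_diff_inverse)
      then show "\<tau> \<in> faces {u. f + u \<in> U} m'"
        using u m' by (auto simp: faces_def add.assoc)
    next
      fix \<tau> assume "\<tau> \<in> faces {u. f + u \<in> U} m'"
      then obtain u where u: "f + u \<in> U" "u + mset_set \<tau> = m'" "finite \<tau>"
        by (auto simp: faces_def)
      have "f + u \<in> up {f}" by (simp add: up_def)
      then show "\<tau> \<in> faces U m \<inter> faces (up {f}) m"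
        using u m' by (auto simp: faces_def add.assoc intro!: bexI[of _ "f + u"])
    qed
    moreover have "set_mset m' \<subseteq> V" "r + p < size m'" using m big m' by auto
    ultimately show ?thesis using colon by (simp add: reg_le_def)
  next
    case False
    then have "faces (up {f}) m = {}"
      using subset_mset.trans[OF _ mset_subset_eq_add_left] by (auto simp: faces_def up_def)
    then show ?thesis by (simp add: acyc_empty)
  qed
  moreover have "acyc p (faces U m \<union> faces (up {f}) m)"
    using add m big by (simp add: reg_le_def faces_Un)
  ultimately show "acyc p (faces U m)"
    using mayer_vietoris[OF complex_faces[OF U m] complex_faces[OF upset_up m]] by blast
qed

text \<open>
  At \<open>m\<close> the whole ring gives the full simplex on the support of \<open>m\<close>, which is a cone unless \<open>m = 1\<close>.
\<close>

lemma acyc_faces_UNIV: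
  assumes "set_mset m \<subseteq> V" "m \<noteq> {#} \<or> 0 < p"
  shows "acyc p (faces UNIV m)"
proof (cases "m = {#}")
  case False
  then obtain v where v: "v \<in># m" by blast
  have iff: "\<tau> \<in> faces UNIV m \<longleftrightarrow> \<tau> \<subseteq> set_mset m" for \<tau>
    using finite_subset[OF _ finite_set_mset, of \<tau> m] by (auto simp: faces_iff mset_set_subseteq_iff)
  show ?thesis using assms v iff by (intro cone_acyc[of _ v]) auto
next
  case True
  have "faces UNIV m \<subseteq> {{}}" by (auto simp: faces_iff True mset_set_empty_iff)
  then have "c = (\<lambda>_. 0)" if "chain p (faces UNIV m) c" for c
    using that assms(2) True unfolding chain_def by fastforce
  then show ?thesis unfolding acyc_def
    by (metis acyc_def acyc_empty chain_def chain_mono empty_subsetI)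
qed

lemma reg_le_unit: "reg_le 0 UNIV"
  unfolding reg_le_def by (intro allI impI acyc_faces_UNIV) auto

end

section \<open>Ideals generated by variables and quadratic monomials\<close>

text \<open>
  The relation \<open>R\<close> plays the role of a graph in which loops are allowed; a loop at \<open>p\<close> contributes
  the square of \<open>p\<close>. Loops do occur: \<open>p p f\<close> may be a product of edges although \<open>p\<close> is not adjacent to itself.
\<close>

definition quadratic_ideal :: "('v \<Rightarrow> 'v \<Rightarrow> bool) \<Rightarrow> 'v set \<Rightarrow> 'v multiset set" where
  "quadratic_ideal R Y = {u. (\<exists>y\<in>Y. y \<in># u) \<or> (\<exists>p q. R p q \<and> {#p, q#} \<subseteq># u)}"

text \<open>
  Ordered matchings of a graph with loops. The conditions force distinct pairs to be disjoint; a
  loop allows \<open>a i = b i\<close>.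
\<close>

definition ordered_seq :: "('v \<Rightarrow> 'v \<Rightarrow> bool) \<Rightarrow> 'v set \<Rightarrow> nat \<Rightarrow> (nat \<Rightarrow> 'v) \<Rightarrow> (nat \<Rightarrow> 'v) \<Rightarrow> bool" where
  "ordered_seq R W r a b \<longleftrightarrow>
     (\<forall>i\<in>{1..r}. a i \<in> W \<and> b i \<in> W \<and> R (a i) (b i)) \<and>
     (\<forall>i\<in>{1..r}. \<forall>j\<in>{1..r}. i \<noteq> j \<longrightarrow> \<not> R (a i) (a j)) \<and>
     (\<forall>i\<in>{1..r}. \<forall>j\<in>{1..r}. R (a i) (b j) \<longrightarrow> i \<le> j)"

text \<open>
  The new pair is put last: \<open>x\<close> has no neighbour among the earlier vertices, and an earlier \<open>a i\<close> may
  well be adjacent to \<open>y\<close>.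
\<close>

lemma ordered_seq_snoc:
  assumes sym: "\<And>u v. R u v \<Longrightarrow> R v u" and xy: "x \<in> W" "y \<in> W" "R x y"
    and seq: "ordered_seq R (W - {z. R x z}) r a b"
  shows "ordered_seq R W (Suc r) (a(Suc r := x)) (b(Suc r := y))"
proof -
  have ab: "a i \<in> W" "\<not> R x (a i)" "b i \<in> W" "\<not> R x (b i)" "R (a i) (b i)" if "i \<in> {1..r}" for i
    using seq that unfolding ordered_seq_def by blast+
  have indep: "\<not> R (a i) (a j)" if "i \<in> {1..r}" "j \<in> {1..r}" "i \<noteq> j" for i j
    using seq that unfolding ordered_seq_def by blast
  have order: "i \<le> j" if "i \<in> {1..r}" "j \<in> {1..r}" "R (a i) (b j)" for i j
    using seq that unfolding ordered_seq_def by blast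
  have split: "i \<in> {1..r} \<or> i = Suc r" if "i \<in> {1..Suc r}" for i using that by auto
  let ?a = "a(Suc r := x)" and ?b = "b(Suc r := y)"
  have old: "?a i = a i" "?b i = b i" if "i \<in> {1..r}" for i using that by auto
  show ?thesis
    unfolding ordered_seq_def
  proof (intro conjI ballI impI)
    fix i assume "i \<in> {1..Suc r}"
    then consider "i \<in> {1..r}" | "i = Suc r" using split by blast
    then show "?a i \<in> W" "?b i \<in> W" "R (?a i) (?b i)"
      using ab[of i] old[of i] xy by (cases; simp)+
  next
    fix i j assume ij: "i \<in> {1..Suc r}" "j \<in> {1..Suc r}"
    then consider "i \<in> {1..r}" "j \<in> {1..r}" | "i \<in> {1..r}" "j = Suc r"
      | "i = Suc r" "j \<in> {1..r}" | "i = Suc r" "j = Suc r"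
      using split by blast
    then show "i \<noteq> j \<Longrightarrow> \<not> R (?a i) (?a j)" and "R (?a i) (?b j) \<Longrightarrow> i \<le> j"
      using old[of i] old[of j] ab(2)[of i] ab(2)[of j] ab(4)[of j] indep[of i j] order[of i j] sym[of "a i" x]
      by (cases; force)+
  qed
qed

lemma ordered_seq_mono: "ordered_seq R W r a b \<Longrightarrow> W \<subseteq> W' \<Longrightarrow> ordered_seq R W' r a b"
  unfolding ordered_seq_def by blast

lemma upset_quadratic_ideal: "upset (quadratic_ideal R Y)"
  using subset_mset.trans[OF _ mset_subset_eq_add_left] unfolding upset_def quadratic_ideal_def
  by fastforce

context vertex_order
begin

text \<open>
  At \<open>m\<close> the complex is a cone as soon as some vertex of \<open>m\<close> lies outside \<open>Y\<close> or is repeated.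
  Otherwise \<open>m\<close> is squarefree on \<open>Y\<close> and the complex is the boundary of the simplex on its support,
  which has homology only in the top degree \<open>p = size m - 1\<close>.
\<close>

lemma reg_le_variables: "reg_le 1 (quadratic_ideal (\<lambda>_ _. False) Y)"
  unfolding reg_le_def
proof (intro allI impI)
  fix m :: "'v multiset" and p assume m: "set_mset m \<subseteq> V" and size: "1 + p < size m"
  let ?U = "quadratic_ideal (\<lambda>_ _. False) Y"
  have U: "u \<in> ?U \<longleftrightarrow> (\<exists>y\<in>Y. y \<in># u)" for u by (auto simp: quadratic_ideal_def)
  have face: "\<tau> \<in> faces ?U m \<longleftrightarrow> \<tau> \<subseteq> set_mset m \<and> (\<exists>y\<in>Y. y \<in># m \<and> (y \<in> \<tau> \<longrightarrow> 2 \<le> count m y))" for \<tau>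
  proof -
    have mem: "y \<in># m - mset_set \<tau> \<longleftrightarrow> y \<in># m \<and> (y \<in> \<tau> \<longrightarrow> 2 \<le> count m y)" if "finite \<tau>" for y
    proof -
      have "y \<in># m" if "2 \<le> count m y" using that by (intro count_inI) simp
      then show ?thesis using that by (cases "y \<in> \<tau>") (auto simp: in_diff_count)
    qed
    show ?thesis
    proof (cases "finite \<tau> \<and> \<tau> \<subseteq> set_mset m")
      case True
      then show ?thesis by (simp only: faces_iff U mset_set_subseteq_iff mem simp_thms)
    next
      case False
      then have "\<not> \<tau> \<subseteq> set_mset m" using finite_subset[OF _ finite_set_mset] by blast
      then show ?thesis using faces_iff[of \<tau> ?U m] mset_set_subseteq_iff[of \<tau> m] by auto
    qed
  qed
  show "acyc p (faces ?U m)"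
  proof (cases "\<exists>v\<in>#m. v \<notin> Y \<or> 2 \<le> count m v")
    case True
    then obtain v where v: "v \<in># m" "v \<notin> Y \<or> 2 \<le> count m v" by blast
    show ?thesis
    proof (rule cone_acyc)
      show "faces ?U m \<subseteq> Pow V" using faces_subset_V[OF _ m] by blast
      show "v \<in> V" using v m by auto
      show "insert v \<tau> \<in> faces ?U m \<longleftrightarrow> \<tau> \<in> faces ?U m" for \<tau>
        unfolding face using v by fastforce
    qed
  next
    case False
    then have Y: "set_mset m \<subseteq> Y" and one: "\<And>v. v \<in># m \<Longrightarrow> count m v = 1"
      by (auto simp: not_le le_antisym count_greater_eq_one_iff Suc_leI)
    have face': "\<tau> \<in> faces ?U m \<longleftrightarrow> \<tau> \<subset> set_mset m" for \<tau>
      using Y one by (auto simp: face)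
    have card: "card (set_mset m) = size m"
      using one by (simp add: size_multiset_overloaded_eq)
    obtain v where v: "v \<in># m" using size by fastforce
    have cone: "acyc p (Pow (set_mset m))"
      using v m by (intro cone_acyc[of _ v]) auto
    show ?thesis
      unfolding acyc_def
    proof (intro allI impI)
      fix c assume c: "chain p (faces ?U m) c" and cyc: "\<forall>\<sigma>. bd c \<sigma> = 0"
      have "chain p (Pow (set_mset m)) c" using c by (rule chain_mono) (auto simp: face')
      then obtain b where b: "chain (Suc p) (Pow (set_mset m)) b" "bd b = c"
        using cone cyc by (auto simp: acyc_def)
      have "chain (Suc p) (faces ?U m) b"
        using b(1) size card by (fastforce simp: chain_def face')
      then show "\<exists>b. chain (Suc p) (faces ?U m) b \<and> bd b = c" using b by blast
    qed
  qed
qed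

text \<open>
  Induction on the number of vertices outside \<open>Y\<close>. For \<open>x\<close> with a neighbour \<open>y\<close>, adding the variable
  \<open>x\<close> deletes \<open>x\<close>, and the colon by \<open>x\<close> turns all neighbours of \<open>x\<close> into variables, which shortens
  the ordered sequences by one and so pays for the degree of \<open>x\<close>. If \<open>x\<close> is a loop it is one of
  its own neighbours and the argument is the same.
\<close>

theorem reg_le_quadratic_ideal:
  assumes sym: "\<And>u v. R u v \<Longrightarrow> R v u"
    and "\<And>r a b. ordered_seq R (V - Y) r a b \<Longrightarrow> r \<le> \<nu>"
  shows "reg_le (\<nu> + 1) (quadratic_ideal R Y)"
  using assms(2)
proof (induction "card (V - Y)" arbitrary: Y \<nu> rule: less_induct)
  case less
  show ?case
  proof (cases "\<exists>x\<in>V - Y. \<exists>y\<in>V - Y. R x y")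
    case False
    have "reg_le 1 (quadratic_ideal R Y)"
    proof (rule reg_le_cong[OF reg_le_variables[of Y]])
      fix u assume u: "set_mset u \<subseteq> V"
      have "\<exists>y\<in>Y. y \<in># u" if "R p q" "{#p, q#} \<subseteq># u" for p q
      proof -
        have "p \<in># u" "q \<in># u" using mset_subset_eqD[OF that(2)] by simp_all
        then show ?thesis using False u that(1) by blast
      qed
      then show "u \<in> quadratic_ideal (\<lambda>_ _. False) Y \<longleftrightarrow> u \<in> quadratic_ideal R Y"
        unfolding quadratic_ideal_def by blast
    qed
    then show ?thesis by (rule reg_le_mono) simp
  next
    case True
    then obtain x y where xy: "x \<in> V - Y" "y \<in> V - Y" "R x y" by blast
    define N where "N = {z. R x z}"
    have ext: "Suc r \<le> \<nu>" if "ordered_seq R (V - (Y \<union> N)) r a b" for r a b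
    proof (rule less.prems)
      have "V - (Y \<union> N) = V - Y - {z. R x z}" by (auto simp: N_def)
      then show "ordered_seq R (V - Y) (Suc r) (a(Suc r := x)) (b(Suc r := y))"
        using ordered_seq_snoc[of R, OF sym xy] that by simp
    qed
    \<comment> \<open>The empty sequence extends as well, hence \<open>\<nu>\<close> is positive.\<close>
    have "ordered_seq R (V - (Y \<union> N)) 0 a a" for a by (simp add: ordered_seq_def)
    from ext[OF this] obtain \<nu>' where \<nu>: "\<nu> = Suc \<nu>'" by (cases \<nu>) auto
    have "reg_le (\<nu>' + 1) (quadratic_ideal R (Y \<union> N))"
    proof (rule less.hyps)
      show "card (V - (Y \<union> N)) < card (V - Y)"
        using finite_V xy by (intro psubset_card_mono) (auto simp: N_def)
    qed (use ext \<nu> in auto)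
    moreover have "{u. {#x#} + u \<in> quadratic_ideal R Y} = quadratic_ideal R (Y \<union> N)"
    proof (intro equalityI subsetI)
      fix u assume "u \<in> {u. {#x#} + u \<in> quadratic_ideal R Y}"
      then consider z where "z \<in> Y" "z \<in># add_mset x u" | p q where "R p q" "{#p, q#} \<subseteq># add_mset x u"
        by (auto simp: quadratic_ideal_def)
      then show "u \<in> quadratic_ideal R (Y \<union> N)"
      proof cases
        case 1
        then show ?thesis using xy by (auto simp: quadratic_ideal_def)
      next
        case 2
        show ?thesis
        proof (cases "p = x \<or> q = x")
          case True
          then have "\<exists>z. R x z \<and> z \<in># u"
          proof
            assume "p = x"
            then show ?thesis using 2 by (auto intro!: exI[of _ q])
          next
            assume "q = x"
            then show ?thesis using 2 sym[of p q] by (auto simp: add_mset_commute[of p x] intro!: exI[of _ p])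
          qed
          then show ?thesis by (auto simp: quadratic_ideal_def N_def)
        next
          case False
          have "count {#p, q#} z \<le> count u z" for z
            using False mset_subset_eq_count[OF 2(2), of z] by (auto split: if_splits)
          then have "{#p, q#} \<subseteq># u" unfolding subseteq_mset_def by blast
          then show ?thesis using 2(1) unfolding quadratic_ideal_def by blast
        qed
      qed
    next
      fix u assume "u \<in> quadratic_ideal R (Y \<union> N)"
      then consider z where "z \<in> Y" "z \<in># u" | z where "R x z" "z \<in># u"
        | p q where "R p q" "{#p, q#} \<subseteq># u"
        by (auto simp: quadratic_ideal_def N_def)
      then show "u \<in> {u. {#x#} + u \<in> quadratic_ideal R Y}"
      proof cases
        case 1
        then show ?thesis by (auto simp: quadratic_ideal_def)
      next
        case 2
        then have "{#x, z#} \<subseteq># add_mset x u" by simp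
        then show ?thesis using 2(1) unfolding quadratic_ideal_def by fastforce
      next
        case 3
        then have "{#p, q#} \<subseteq># add_mset x u"
          using subset_mset.trans[OF 3(2), of "add_mset x u"] by simp
        then show ?thesis using 3(1) unfolding quadratic_ideal_def by fastforce
      qed
    qed
    moreover have "reg_le (\<nu> + 1) (quadratic_ideal R (insert x Y))"
    proof (rule less.hyps)
      show "card (V - insert x Y) < card (V - Y)"
        using finite_V xy by (intro psubset_card_mono) auto
      show "r \<le> \<nu>" if "ordered_seq R (V - insert x Y) r a b" for r a b
        using ordered_seq_mono[OF that] by (intro less.prems[of r a b]) blast
    qed
    moreover have "quadratic_ideal R (insert x Y) = quadratic_ideal R Y \<union> up {{#x#}}"
      by (auto simp: quadratic_ideal_def up_def)
    ultimately show ?thesis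
      using reg_le_colon[where f = "{#x#}" and r = "\<nu>' + 1" and U = "quadratic_ideal R Y"]
        upset_quadratic_ideal[of R Y] \<nu> by simp
  qed
qed

end

section \<open>An exchange property for products of edges\<close>

text \<open>
  The products of \<open>s\<close> edges, that is, the monomials that have a perfect matching with \<open>s\<close> edges when a
  vertex of exponent \<open>k\<close> is replaced by \<open>k\<close> copies.
\<close>

fun edge_power :: "'v set set \<Rightarrow> nat \<Rightarrow> 'v multiset set" where
  "edge_power E 0 = {{#}}"
| "edge_power E (Suc s) = {add_mset u (add_mset w g) |u w g. {u, w} \<in> E \<and> g \<in> edge_power E s}"

lemma edge_power_SucI:
  "{u, w} \<in> E \<Longrightarrow> g \<in> edge_power E s \<Longrightarrow> add_mset u (add_mset w g) \<in> edge_power E (Suc s)"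
  by auto

lemma edge_power_SucE:
  assumes "f \<in> edge_power E (Suc s)"
  obtains u w g where "f = add_mset u (add_mset w g)" "{u, w} \<in> E" "g \<in> edge_power E s"
  using assms by auto

lemma size_edge_power: "f \<in> edge_power E s \<Longrightarrow> size f = 2 * s"
  by (induction s arbitrary: f) auto

lemma set_edge_power:
  assumes "\<Union>E \<subseteq> V"
  shows "f \<in> edge_power E s \<Longrightarrow> set_mset f \<subseteq> V"
proof (induction s arbitrary: f)
  case (Suc s)
  then obtain u w g where "f = add_mset u (add_mset w g)" "{u, w} \<in> E" "g \<in> edge_power E s"
    by (auto elim: edge_power_SucE)
  then show ?case using Suc.IH[of g] assms by auto
qed simp

lemma finite_edge_power:
  assumes "finite V" "\<Union>E \<subseteq> V"
  shows "finite (edge_power E s)"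
proof (induction s)
  case (Suc s)
  have "edge_power E (Suc s) \<subseteq> (\<lambda>(u, w, g). add_mset u (add_mset w g)) ` (V \<times> V \<times> edge_power E s)"
  proof
    fix f assume "f \<in> edge_power E (Suc s)"
    then obtain u w g where f: "f = add_mset u (add_mset w g)" "{u, w} \<in> E" "g \<in> edge_power E s" by auto
    then have "(u, w, g) \<in> V \<times> V \<times> edge_power E s" using assms(2) by blast
    then show "f \<in> (\<lambda>(u, w, g). add_mset u (add_mset w g)) ` (V \<times> V \<times> edge_power E s)"
      unfolding f(1) by force
  qed
  then show ?case using Suc assms(1) by (meson finite_SigmaI finite_imageI finite_subset)
qed simp

text \<open>
  Given a factorization into edges, some factor contains \<open>x\<close>; \<open>y\<close> is its other end.
\<close>

lemma edge_power_split:
  "f \<in> edge_power E s \<Longrightarrow> x \<in># f \<Longrightarrow>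
     \<exists>y f' s'. s = Suc s' \<and> {x, y} \<in> E \<and> f = add_mset x (add_mset y f') \<and> f' \<in> edge_power E s'"
proof (induction s arbitrary: f)
  case (Suc s)
  then obtain u w g where f: "f = add_mset u (add_mset w g)" "{u, w} \<in> E" "g \<in> edge_power E s"
    by auto
  show ?case
  proof (cases "x = u \<or> x = w")
    case True
    then show ?thesis
    proof
      assume "x = u"
      then show ?thesis using f by (intro exI[of _ w] exI[of _ g] exI[of _ s]) simp
    next
      assume "x = w"
      then show ?thesis using f
        by (intro exI[of _ u] exI[of _ g] exI[of _ s]) (simp add: insert_commute add_mset_commute)
    qed
  next
    case False
    then have "x \<in># g" using Suc.prems(2) f(1) by auto
    from Suc.IH[OF f(3) this] obtain y g' s' where g: "s = Suc s'" "{x, y} \<in> E"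
      "g = add_mset x (add_mset y g')" "g' \<in> edge_power E s'" by blast
    have "add_mset u (add_mset w g') \<in> edge_power E s"
      unfolding g(1) by (rule edge_power_SucI[OF f(2) g(4)])
    moreover have "f = add_mset x (add_mset y (add_mset u (add_mset w g')))"
      by (simp add: f(1) g(3) add_mset_commute)
    ultimately show ?thesis using g(2) by blast
  qed
qed simp

text \<open>
  The exchanges that turn \<open>f\<close> into \<open>g\<close>: the excess of \<open>g\<close> over \<open>f\<close> is matched with the excess of
  \<open>f\<close> over \<open>g\<close> such that each single exchange already leads to another product of edges.
\<close>

definition pairing :: "'v set set \<Rightarrow> nat \<Rightarrow> 'v multiset \<Rightarrow> 'v multiset \<Rightarrow> ('v \<times> 'v) multiset \<Rightarrow> bool" where
  "pairing E s f g P \<longleftrightarrow> image_mset fst P = g - f \<and> image_mset snd P = f - g \<and>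
     (\<forall>(u, z) \<in># P. add_mset u (f - {#z#}) \<in> edge_power E s)"

text \<open>
  Overlay perfect matchings of \<open>f\<close> and \<open>g\<close>, identifying as many vertices as possible. The union consists of
  cycles and alternating paths. A path with both ends in the excess of \<open>g\<close> is augmenting and gives the
  first alternative. If there is none then both sides have equal size, and every path joins
  an excess vertex \<open>u\<close> of \<open>g\<close> to an excess vertex \<open>z\<close> of \<open>f\<close>; switching \<open>f\<close> along this path
  alone replaces \<open>z\<close> by \<open>u\<close>.

  The induction walks along such a path from \<open>u\<close>, an edge \<open>u w\<close> of \<open>g\<close> and an edge \<open>w w'\<close> of \<open>f\<close> at
  a time. After both edges are removed, \<open>w'\<close> takes over the role of \<open>u\<close>, unless \<open>f\<close> has more
  copies of it than \<open>g\<close> and the path ends there.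
\<close>

lemma edge_power_exchange:
  assumes "g \<in> edge_power E t" "f \<in> edge_power E s" "s \<le> t"
  shows "(\<exists>p q. {#p, q#} \<subseteq># g - f \<and> add_mset p (add_mset q f) \<in> edge_power E (Suc s)) \<or>
         (s = t \<and> (\<exists>P. pairing E s f g P))"
  using assms
proof (induction t arbitrary: f g s)
  case 0
  then show ?case by (auto simp: pairing_def)
next
  case (Suc t)
  show ?case
  proof (cases "g - f = {#}")
    case True
    then have "g \<subseteq># f" by (simp add: Diff_eq_empty_iff_mset)
    moreover have "size f \<le> size g"
      using Suc.prems size_edge_power[OF Suc.prems(1)] size_edge_power[OF Suc.prems(2)] by simp
    ultimately have eq: "f = g"
      by (metis mset_subset_size not_le subset_mset.le_imp_less_or_eq)
    then have "s = Suc t"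
      using size_edge_power[OF Suc.prems(1)] size_edge_power[OF Suc.prems(2)] by simp
    moreover have "pairing E s f g {#}" by (simp add: pairing_def eq)
    ultimately show ?thesis by blast
  next
    case False
    then obtain u where u: "u \<in># g - f" by blast
    then have u_count: "count f u < count g u" by (simp add: in_diff_count)
    from u have "u \<in># g" by (rule in_diffD)
    from edge_power_split[OF Suc.prems(1) this] obtain w g1 where
      g: "{u, w} \<in> E" "g = add_mset u (add_mset w g1)" "g1 \<in> edge_power E t" by blast
    show ?thesis
    proof (cases "{#u, w#} \<subseteq># g - f")
      case True
      then show ?thesis using edge_power_SucI[OF g(1) Suc.prems(2)] by blast
    next
      case not_sub: False
      have "w \<in># f"
      proof (rule ccontr)
        assume w: "w \<notin># f"
        then have "count f w = 0" by (simp add: count_eq_zero_iff)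
        then have "count {#u, w#} x \<le> count (g - f) x" for x
          using u_count by (auto simp: g(2))
        then show False using not_sub by (simp add: subseteq_mset_def)
      qed
      from edge_power_split[OF Suc.prems(2) this] obtain w' f1 s' where
        s: "s = Suc s'" and f: "{w, w'} \<in> E" "f = add_mset w (add_mset w' f1)" "f1 \<in> edge_power E s'"
        by blast
      have s't: "s' \<le> t" using Suc.prems(3) s by simp
      have uf1: "add_mset u (add_mset w f1) \<in> edge_power E s"
        unfolding s by (rule edge_power_SucI[OF g(1) f(3)])
      from Suc.IH[OF g(3) f(3) s't] show ?thesis
      proof (elim disjE exE conjE)
        fix p q assume pq: "{#p, q#} \<subseteq># g1 - f1" and aug: "add_mset p (add_mset q f1) \<in> edge_power E (Suc s')"
        \<comment> \<open>An augmenting path that starts at \<open>w'\<close> extends by the edges \<open>w w'\<close> and \<open>u w\<close> to one that starts at \<open>u\<close>.\<close>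
        have shift: "{#u, q#} \<subseteq># g - f" if "{#w', q#} \<subseteq># g1 - f1" for q
        proof -
          have "count {#u, q#} x \<le> count (g - f) x" for x
            using mset_subset_eq_count[OF that, of x] u_count
            by (simp add: g(2) f(2)) (auto split: if_splits)
          then show ?thesis by (simp add: subseteq_mset_def)
        qed
        have augmented: "add_mset u (add_mset q f) \<in> edge_power E (Suc s)"
          if "add_mset w' (add_mset q f1) \<in> edge_power E (Suc s')" for q
          using edge_power_SucI[OF g(1) that]
          by (simp add: s f(2) add_mset_commute)
        consider "p = w'" | "q = w'" | "p \<noteq> w'" "q \<noteq> w'" by blast
        then show ?thesis
        proof cases
          case 1
          then show ?thesis using shift augmented pq aug by blast
        next
          case 2
          then have "{#w', p#} \<subseteq># g1 - f1" "add_mset w' (add_mset p f1) \<in> edge_power E (Suc s')"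
            using pq aug by (simp_all add: add_mset_commute)
          then show ?thesis using shift augmented by blast
        next
          case 3
          have "count {#p, q#} x \<le> count (g - f) x" for x
            using mset_subset_eq_count[OF pq, of x] 3
            by (simp add: g(2) f(2)) (auto split: if_splits)
          then have "{#p, q#} \<subseteq># g - f" by (simp add: subseteq_mset_def)
          moreover have "add_mset p (add_mset q f) \<in> edge_power E (Suc s)"
            using edge_power_SucI[OF f(1) aug] by (simp add: s f(2) add_mset_commute)
          ultimately show ?thesis by blast
        qed
      next
        fix P assume "s' = t" and P: "pairing E s' f1 g1 P"
        then have st: "s = Suc t" by (simp add: s)
        have old: "add_mset p (f - {#z#}) \<in> edge_power E s" if "(p, z) \<in># P" for p z
        proof -
          have "add_mset p (f1 - {#z#}) \<in> edge_power E s'" using P that by (auto simp: pairing_def)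
          from edge_power_SucI[OF f(1) this]
          have *: "add_mset w (add_mset w' (add_mset p (f1 - {#z#}))) \<in> edge_power E s" by (simp only: s)
          have "z \<in># image_mset snd P" using that by force
          then have "z \<in># f1 - g1" using P by (simp only: pairing_def)
          then have "z \<in># f1" by (rule in_diffD)
          then obtain f2 where "f1 = add_mset z f2" by (metis multi_member_split)
          then have "f - {#z#} = add_mset w (add_mset w' (f1 - {#z#}))"
            by (simp add: f(2) multiset_eq_iff)
          then show ?thesis using * by (simp add: add_mset_commute)
        qed
        \<comment> \<open>Either the path ends at \<open>w'\<close>, or the pair \<open>(w', z)\<close> of the shorter path becomes \<open>(u, z)\<close>.
        For \<open>w' = u\<close> the second step changes nothing.\<close>
        show ?thesis
        proof (cases "w' \<in># f - g")
          case True
          then have w': "count g w' < count f w'" by (simp add: in_diff_count)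
          then have "w' \<noteq> u" using u_count by auto
          have "count f1 u \<le> count g1 u" "count g1 w' \<le> count f1 w'"
            using u_count w' \<open>w' \<noteq> u\<close> by (simp_all add: g(2) f(2) split: if_splits)
          then have "g - f = add_mset u (g1 - f1)" "f - g = add_mset w' (f1 - g1)"
            using \<open>w' \<noteq> u\<close> unfolding multiset_eq_iff by (auto simp: g(2) f(2))
          moreover have "add_mset u (f - {#w'#}) \<in> edge_power E s"
            using uf1 by (simp add: f(2))
          ultimately have "pairing E s f g (add_mset (u, w') P)"
            using P old by (auto simp: pairing_def)
          then show ?thesis using st by blast
        next
          case False
          then have w': "count f w' \<le> count g w'" by (simp add: in_diff_count)
          have "w' \<in># g1 - f1"
            using u_count w' by (simp add: in_diff_count g(2) f(2) split: if_splits)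
          then have "w' \<in># image_mset fst P" using P by (simp add: pairing_def)
          then obtain z where z: "(w', z) \<in># P" by auto
          then obtain P' where P': "P = add_mset (w', z) P'" by (metis multi_member_split)
          have fst: "g - f = add_mset u ((g1 - f1) - {#w'#})" and snd: "f - g = f1 - g1"
            using u_count w' unfolding multiset_eq_iff
            by (auto simp: g(2) f(2) split: if_splits)
          have "add_mset w' (f1 - {#z#}) \<in> edge_power E s'" using P z by (auto simp: pairing_def)
          from edge_power_SucI[OF g(1) this]
          have *: "add_mset u (add_mset w (add_mset w' (f1 - {#z#}))) \<in> edge_power E s" by (simp only: s)
          have "z \<in># image_mset snd P" using z by force
          then have "z \<in># f1 - g1" using P by (simp only: pairing_def)
          then have "z \<in># f1" by (rule in_diffD)
          then obtain f2 where "f1 = add_mset z f2" by (metis multi_member_split)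
          then have "f - {#z#} = add_mset w (add_mset w' (f1 - {#z#}))"
            by (simp add: f(2) multiset_eq_iff)
          with * have "add_mset u (f - {#z#}) \<in> edge_power E s" by simp
          moreover have "add_mset w' (image_mset fst P') = g1 - f1" "add_mset z (image_mset snd P') = f1 - g1"
            using P by (simp_all add: pairing_def P')
          then have "image_mset fst P' = (g1 - f1) - {#w'#}" "add_mset z (image_mset snd P') = f1 - g1"
            by (metis add_mset_remove_trivial)+
          ultimately have "pairing E s f g (add_mset (u, z) P')"
            using old unfolding pairing_def fst snd by (auto simp: P' simp del: diff_diff_add_mset)
          then show ?thesis using st by blast
        qed
      qed
    qed
  qed
qed

declare edge_power.simps(2) [simp del]

section \<open>Colon ideals of powers\<close>

text \<open>
  For a product \<open>f\<close> of edges these are the pairs that are even-connected in the sense of Banerjee. The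
  definition by membership avoids alternating walks.
\<close>

definition even_connected :: "'v set set \<Rightarrow> nat \<Rightarrow> 'v multiset \<Rightarrow> 'v \<Rightarrow> 'v \<Rightarrow> bool" where
  "even_connected E s f p q \<longleftrightarrow> add_mset p (add_mset q f) \<in> edge_power E (Suc s)"

lemma even_connected_sym: "even_connected E s f p q \<Longrightarrow> even_connected E s f q p"
  by (simp add: even_connected_def add_mset_commute)

lemma edge_imp_even_connected:
  "f \<in> edge_power E s \<Longrightarrow> {p, q} \<in> E \<Longrightarrow> even_connected E s f p q"
  unfolding even_connected_def by (rule edge_power_SucI)

text \<open>
  Let \<open>T\<close> consist of generators of \<open>I^s\<close> that precede \<open>f\<close>, all those of smaller weight included. If some
  \<open>g \<in> T\<close> divides \<open>f u\<close> and no augmenting pair exists, then the exchanges from \<open>f\<close> to \<open>g\<close> lower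
  the total weight or keep it. Each of them changes the weight, as \<open>\<phi>\<close> is injective, so one of
  them lowers it and leads to an element of \<open>T\<close>. This element is \<open>f y / z\<close> with \<open>y\<close> dividing \<open>u\<close>, so
  the variable \<open>y\<close> is in the colon ideal. Generators of equal weight may be added in any order.
\<close>

lemma colon_edge_power:
  fixes \<phi> :: "'v \<Rightarrow> nat"
  assumes EV: "\<Union>E \<subseteq> V" and inj: "inj_on \<phi> V"
    and f: "f \<in> edge_power E s" and T: "T \<subseteq> edge_power E s" "f \<notin> T"
    and before: "\<And>g. g \<in> edge_power E s \<Longrightarrow> (\<Sum>x\<in>#g. \<phi> x) < (\<Sum>x\<in>#f. \<phi> x) \<Longrightarrow> g \<in> T"
    and least: "\<And>g. g \<in> T \<Longrightarrow> (\<Sum>x\<in>#g. \<phi> x) \<le> (\<Sum>x\<in>#f. \<phi> x)"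
  shows "{u. f + u \<in> up (edge_power E (Suc s)) \<union> up T} =
    quadratic_ideal (even_connected E s f) {y. add_mset y f \<in> up T}"
    (is "?L = quadratic_ideal ?R ?Y")
proof (intro equalityI subsetI)
  have aug: "u \<in> quadratic_ideal ?R ?Y"
    if "{#p, q#} \<subseteq># g - f" "g \<subseteq># f + u" "even_connected E s f p q" for p q g u
  proof -
    have "{#p, q#} \<subseteq># u"
      using that(1,2) by (metis subset_eq_diff_conv subset_mset.order_trans add.commute)
    then show ?thesis using that(3) unfolding quadratic_ideal_def by blast
  qed
  fix u assume "u \<in> ?L"
  then consider g where "g \<in> edge_power E (Suc s)" "g \<subseteq># f + u" | g where "g \<in> T" "g \<subseteq># f + u"
    by (auto simp: up_def)
  then show "u \<in> quadratic_ideal ?R ?Y"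
  proof cases
    case 1
    then obtain p q where "{#p, q#} \<subseteq># g - f" "add_mset p (add_mset q f) \<in> edge_power E (Suc s)"
      using edge_power_exchange[OF 1(1) f] by auto
    then show ?thesis using aug[OF _ 1(2)] by (simp add: even_connected_def)
  next
    case 2
    then have g: "g \<in> edge_power E s" using T by blast
    show ?thesis
    proof (cases "\<exists>p q. {#p, q#} \<subseteq># g - f \<and> even_connected E s f p q")
      case True
      then show ?thesis using aug[OF _ 2(2)] by blast
    next
      case False
      then obtain P where P: "pairing E s f g P"
        using edge_power_exchange[OF g f] unfolding even_connected_def by blast
      have "\<exists>(y, z) \<in># P. \<phi> y < \<phi> z"
      proof (rule ccontr)
        assume no: "\<not> ?thesis"
        have strict: "\<phi> z < \<phi> y" if "(y, z) \<in># P" for y z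
        proof -
          have "y \<in># image_mset fst P" "z \<in># image_mset snd P" using that by force+
          then have yz: "y \<in># g - f" "z \<in># f - g" using P by (simp_all only: pairing_def)
          then have "y \<noteq> z" by (auto simp: in_diff_count)
          moreover have "y \<in> V" "z \<in> V"
            using yz in_diffD set_edge_power[OF EV g] set_edge_power[OF EV f] by fast+
          ultimately have "\<phi> y \<noteq> \<phi> z" using inj by (auto dest: inj_onD)
          moreover have "\<not> \<phi> y < \<phi> z" using no that by auto
          ultimately show ?thesis by simp
        qed
        have "P \<noteq> {#}"
        proof
          assume "P = {#}"
          then have "g - f = {#}" "f - g = {#}" using P by (simp_all add: pairing_def)
          then have "f = g" by (simp add: Diff_eq_empty_iff_mset)
          then show False using T(2) 2(1) by simp
        qed
        then have "(\<Sum>e\<in>#P. \<phi> (snd e)) < (\<Sum>e\<in>#P. \<phi> (fst e))"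
          using strict
        proof (induction P)
          case (add p P)
          then show ?case
            by (cases p; cases "P = {#}") (force intro: add_strict_mono)+
        qed simp
        moreover have "(\<Sum>e\<in>#P. \<phi> (fst e)) = (\<Sum>x\<in>#g - f. \<phi> x)"
        proof -
          have "(\<Sum>x\<in>#g - f. \<phi> x) = (\<Sum>x\<in>#image_mset fst P. \<phi> x)" using P by (simp add: pairing_def)
          then show ?thesis by (simp add: image_mset.compositionality comp_def case_prod_beta)
        qed
        moreover have "(\<Sum>e\<in>#P. \<phi> (snd e)) = (\<Sum>x\<in>#f - g. \<phi> x)"
        proof -
          have "(\<Sum>x\<in>#f - g. \<phi> x) = (\<Sum>x\<in>#image_mset snd P. \<phi> x)" using P by (simp add: pairing_def)
          then show ?thesis by (simp add: image_mset.compositionality comp_def case_prod_beta)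
        qed
        moreover have "(\<Sum>x\<in>#f - g. \<phi> x) + (\<Sum>x\<in>#g. \<phi> x) = (\<Sum>x\<in>#g - f. \<phi> x) + (\<Sum>x\<in>#f. \<phi> x)"
        proof -
          \<comment> \<open>Both sides are the least common multiple of \<open>f\<close> and \<open>g\<close>.\<close>
          have "(f - g) + g = (g - f) + f" by (auto simp: multiset_eq_iff)
          from arg_cong[OF this, of "\<lambda>m. \<Sum>x\<in>#m. \<phi> x"] show ?thesis by simp
        qed
        ultimately show False using least[OF 2(1)] by linarith
      qed
      then obtain y z where yz: "(y, z) \<in># P" "\<phi> y < \<phi> z" by auto
      define h where "h = add_mset y (f - {#z#})"
      have h: "h \<in> edge_power E s" using P yz(1) by (auto simp: pairing_def h_def)
      have "y \<in># image_mset fst P" "z \<in># image_mset snd P" using yz by force+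
      then have mem: "y \<in># g - f" "z \<in># f - g" using P by (simp_all only: pairing_def)
      then have "z \<in># f" using in_diffD by fast
      then obtain f' where f': "f = add_mset z f'" by (metis multi_member_split)
      have "h \<in> T" using yz(2) by (intro before[OF h]) (simp add: h_def f')
      moreover have "h \<subseteq># add_mset y f" by (simp add: h_def)
      ultimately have "y \<in> ?Y" by (auto simp: up_def)
      moreover have "y \<in># u"
      proof -
        have "count f y < count g y" using mem by (simp add: in_diff_count)
        moreover have "count g y \<le> count f y + count u y" using mset_subset_eq_count[OF 2(2), of y] by simp
        ultimately show ?thesis by (intro count_inI) simp
      qed
      ultimately show ?thesis unfolding quadratic_ideal_def by blast
    qed
  qed
next
  fix u assume "u \<in> quadratic_ideal ?R ?Y"
  then consider y where "add_mset y f \<in> up T" "y \<in># u"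
    | p q where "?R p q" "{#p, q#} \<subseteq># u" by (auto simp: quadratic_ideal_def)
  then show "u \<in> ?L"
  proof cases
    case 1
    then obtain u' where "u = add_mset y u'" by (metis multi_member_split)
    then have "add_mset y f \<subseteq># f + u" by simp
    then show ?thesis using upsetD[OF upset_up 1(1)] by simp
  next
    case 2
    have "add_mset p (add_mset q f) \<in> up (edge_power E (Suc s))"
      using 2(1) unfolding even_connected_def up_def by blast
    moreover have "add_mset p (add_mset q f) \<subseteq># f + u"
      using subset_mset.add_left_mono[OF 2(2), of f] by simp
    ultimately show ?thesis using upsetD[OF upset_up] by blast
  qed
qed

text \<open>
  Factor \<open>a\<^sub>i b\<^sub>i f\<close> into edges and let \<open>c\<^sub>i\<close> be the partner of \<open>a\<^sub>i\<close>. If \<open>a\<^sub>j\<close> is adjacent to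
  \<open>c\<^sub>i\<close>, then the edge \<open>a\<^sub>i c\<^sub>i\<close> can be traded for \<open>a\<^sub>j c\<^sub>i\<close>, which shows that \<open>a\<^sub>j b\<^sub>i f\<close> is a product of
  edges. Hence the \<open>c\<^sub>i\<close> inherit the order condition from the \<open>b\<^sub>i\<close>.
\<close>

lemma ordered_seq_even_connected:
  assumes f: "f \<in> edge_power E s" and loopless: "\<And>v. {v} \<notin> E"
    and seq: "ordered_seq (even_connected E s f) W r a b"
  shows "\<exists>M. card M = r \<and> (M = {} \<or> ordered_matching E M)"
proof -
  have R: "even_connected E s f (a i) (b i)" if "i \<in> {1..r}" for i
    using seq that unfolding ordered_seq_def by blast
  have indep: "{a i, a j} \<notin> E" if "i \<in> {1..r}" "j \<in> {1..r}" for i j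
  proof (cases "i = j")
    case True
    then show ?thesis using loopless by simp
  next
    case False
    then have "\<not> even_connected E s f (a i) (a j)"
      using seq that unfolding ordered_seq_def by blast
    then show ?thesis using edge_imp_even_connected[OF f] by blast
  qed
  have "\<exists>c g. {a i, c} \<in> E \<and> add_mset (b i) f = add_mset c g \<and> g \<in> edge_power E s" if "i \<in> {1..r}" for i
  proof -
    have "add_mset (a i) (add_mset (b i) f) \<in> edge_power E (Suc s)"
      using R[OF that] by (simp only: even_connected_def)
    from edge_power_split[OF this, of "a i"] show ?thesis by auto
  qed
  then obtain c g where c: "\<And>i. i \<in> {1..r} \<Longrightarrow> {a i, c i} \<in> E"
    and g: "\<And>i. i \<in> {1..r} \<Longrightarrow> add_mset (b i) f = add_mset (c i) (g i)"
      "\<And>i. i \<in> {1..r} \<Longrightarrow> g i \<in> edge_power E s"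
    by metis
  have order: "j \<le> i" if "i \<in> {1..r}" "j \<in> {1..r}" "{a j, c i} \<in> E" for i j
  proof -
    have "add_mset (a j) (add_mset (c i) (g i)) \<in> edge_power E (Suc s)"
      using that by (intro edge_power_SucI g)
    then have "even_connected E s f (a j) (b i)"
      using g(1)[OF that(1)] by (simp add: even_connected_def)
    then show ?thesis using seq that(1,2) unfolding ordered_seq_def by blast
  qed
  define M where "M = (\<lambda>i. {a i, c i}) ` {1..r}"
  have disj: "{a i, c i} \<inter> {a j, c j} = {}" if "i \<in> {1..r}" "j \<in> {1..r}" "i < j" for i j
  proof -
    have "{a j, c i} \<notin> E" using order[of i j] that by auto
    then have "a i \<noteq> a j" "c i \<noteq> c j" using c[OF that(1)] c[OF that(2)] by auto
    moreover have "a i \<noteq> c j" "c i \<noteq> a j"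
      using c[of i] c[of j] indep[of j i] indep[of i j] that by (auto simp: insert_commute)
    ultimately show ?thesis by auto
  qed
  have disj': "{a i, c i} \<inter> {a j, c j} = {}" if "i \<in> {1..r}" "j \<in> {1..r}" "i \<noteq> j" for i j
    using disj[of i j] disj[of j i] that by (cases "i < j") auto
  have inj: "inj_on (\<lambda>i. {a i, c i}) {1..r}"
  proof (rule inj_onI, rule ccontr)
    fix i j assume "i \<in> {1..r}" "j \<in> {1..r}" "{a i, c i} = {a j, c j}" "i \<noteq> j"
    then show False using disj'[of i j] by auto
  qed
  have "ordered_matching E M" if "M \<noteq> {}"
    unfolding ordered_matching_def
  proof (intro conjI exI)
    show "matching E M"
      unfolding matching_def M_def using c disj' by blast
    show "bij_betw (\<lambda>i. {a i, c i}) {1..r} M"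
      using inj by (simp add: bij_betw_def M_def)
    show "\<forall>i\<in>{1..r}. \<forall>j\<in>{1..r}. {a i, a j} \<notin> E" using indep by blast
    show "\<forall>i\<in>{1..r}. \<forall>j\<in>{1..r}. {a i, c j} \<in> E \<longrightarrow> i \<le> j" using order by blast
  qed (rule that)
  moreover have "card M = r" using inj by (simp add: M_def card_image)
  ultimately show ?thesis by blast
qed

lemma ordered_matching_card_le:
  assumes "finite E" "ordered_matching E M"
  shows "card M \<le> ord_match E"
proof -
  have sub: "{M. ordered_matching E M} \<subseteq> Pow E" by (auto simp: ordered_matching_def matching_def)
  then have "E \<noteq> {}" using assms(2) by (auto simp: ordered_matching_def matching_def)
  moreover have "finite (card ` {M. ordered_matching E M})"
    using sub assms(1) by (meson finite_Pow_iff finite_imageI finite_subset)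
  ultimately show ?thesis using assms(2) by (simp add: ord_match_def)
qed

context vertex_order
begin

text \<open>
  The set \<open>T\<close> of generators of \<open>I^s\<close> added so far is closed under passing to smaller weight. The
  induction runs backwards from the full set, where the ideal is \<open>I^s\<close>, to the empty one.
\<close>

lemma reg_le_edge_power_Suc:
  assumes E: "simple_graph V E" and IH: "reg_le (2 * s + ord_match E + 1) (up (edge_power E s))"
  shows "reg_le (2 * s + ord_match E + 1) (up (edge_power E (Suc s)))"
proof -
  have EV: "\<Union>E \<subseteq> V" and loopless: "\<And>v. {v} \<notin> E"
    using E by (auto simp: simple_graph_def)
  have "E \<subseteq> Pow V" using EV by auto
  then have finE: "finite E" using finite_V by (meson finite_Pow_iff finite_subset)
  let ?w = "\<lambda>g. \<Sum>x\<in>#g. idx x"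
  let ?G = "edge_power E s"
  have "reg_le (2 * s + ord_match E + 1) (up (edge_power E (Suc s)) \<union> up T)"
    if "T \<subseteq> ?G" "\<And>g h. h \<in> T \<Longrightarrow> g \<in> ?G \<Longrightarrow> ?w g < ?w h \<Longrightarrow> g \<in> T" for T
    using that
  proof (induction "card (?G - T)" arbitrary: T rule: less_induct)
    case less
    show ?case
    proof (cases "T = ?G")
      case True
      have "up (edge_power E (Suc s)) \<subseteq> up ?G"
      proof
        fix u assume "u \<in> up (edge_power E (Suc s))"
        then obtain f where "f \<in> edge_power E (Suc s)" "f \<subseteq># u" by (auto simp: up_def)
        then obtain x y g where "g \<in> ?G" "add_mset x (add_mset y g) \<subseteq># u" by (auto elim: edge_power_SucE)
        moreover have "g \<subseteq># add_mset x (add_mset y g)" by (simp add: subseteq_mset_def)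
        ultimately show "u \<in> up ?G" unfolding up_def using subset_mset.order_trans by blast
      qed
      then show ?thesis using IH True by (simp add: Un_absorb1)
    next
      case False
      then have ne: "?G - T \<noteq> {}" using less.prems(1) by blast
      have fin: "finite (?G - T)" using finite_edge_power[OF finite_V EV] by blast
      obtain f where f: "f \<in> ?G" "f \<notin> T" and min: "\<And>g. g \<in> ?G - T \<Longrightarrow> ?w f \<le> ?w g"
        using ex_min_if_finite[of "?w ` (?G - T)"] ne fin by (fastforce simp: not_less)
      have before: "g \<in> T" if "g \<in> ?G" "?w g < ?w f" for g
        using min[of g] that by force
      have least: "?w g \<le> ?w f" if "g \<in> T" for g
        using less.prems(2)[OF that f(1)] f(2) by force
      have "reg_le (ord_match E + 1) (quadratic_ideal (even_connected E s f) {y. add_mset y f \<in> up T})"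
      proof (rule reg_le_quadratic_ideal)
        fix r a b assume "ordered_seq (even_connected E s f) (V - {y. add_mset y f \<in> up T}) r a b"
        from ordered_seq_even_connected[OF f(1) loopless this]
        show "r \<le> ord_match E" using ordered_matching_card_le[OF finE] by auto
      qed (rule even_connected_sym)
      then have "reg_le (ord_match E + 1) {u. f + u \<in> up (edge_power E (Suc s)) \<union> up T}"
        using colon_edge_power[OF EV inj_idx f(1) less.prems(1) f(2) before least] by simp
      moreover have "reg_le (2 * s + ord_match E + 1) (up (edge_power E (Suc s)) \<union> up (insert f T))"
      proof (rule less.hyps)
        show "card (?G - insert f T) < card (?G - T)"
          using fin f by (intro psubset_card_mono) auto
        show "insert f T \<subseteq> ?G" using f less.prems(1) by blast
        show "g \<in> insert f T" if "h \<in> insert f T" "g \<in> ?G" "?w g < ?w h" for g h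
          using that before less.prems(2) by blast
      qed
      moreover have "up (edge_power E (Suc s)) \<union> up (insert f T) = (up (edge_power E (Suc s)) \<union> up T) \<union> up {f}"
        by (auto simp: up_def)
      moreover have size: "2 * s + ord_match E + 1 = ord_match E + 1 + size f"
        using size_edge_power[OF f(1)] by simp
      ultimately show ?thesis
        by (metis reg_le_colon[OF upset_Un[OF upset_up upset_up]])
    qed
  qed
  from this[of "{}"] show ?thesis by (simp add: up_def)
qed

text \<open>
  The induction starts at \<open>I^0\<close>, the unit ideal, so that the edge ideal itself needs no separate treatment.
\<close>

theorem reg_le_edge_power:
  assumes "simple_graph V E" "1 \<le> s"
  shows "reg_le (2 * s + ord_match E - 1) (up (edge_power E s))"
proof -
  have *: "reg_le (2 * s + ord_match E + 1) (up (edge_power E (Suc s)))" for s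
  proof (induction s)
    case 0
    have "up (edge_power E 0) = UNIV" by (auto simp: up_def)
    then have "reg_le (2 * 0 + ord_match E + 1) (up (edge_power E 0))"
      using reg_le_mono[OF reg_le_unit] by simp
    then show ?case by (rule reg_le_edge_power_Suc[OF assms(1)])
  next
    case (Suc s)
    then have "reg_le (2 * Suc s + ord_match E + 1) (up (edge_power E (Suc s)))"
      by (rule reg_le_mono) simp
    then show ?case by (rule reg_le_edge_power_Suc[OF assms(1)])
  qed
  obtain s' where "s = Suc s'" using assms(2) by (cases s) auto
  then show ?thesis using *[of s'] by simp
qed

end

section \<open>Polynomials and their coefficients\<close>

lift_definition mon :: "'v multiset \<Rightarrow> 'v \<Rightarrow>\<^sub>0 nat" is count
  by simp

definition cf :: "('v, 'k::zero) mpoly \<Rightarrow> 'v multiset \<Rightarrow> 'k" where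
  "cf p M = Poly_Mapping.lookup p (mon M)"

lemma mon_inject [simp]: "mon M = mon N \<longleftrightarrow> M = N"
  by transfer (simp add: count_inject)

lemma mon_add: "mon (M + N) = mon M + mon N"
  by transfer (simp add: fun_eq_iff)

lemma mon_empty: "mon {#} = 0"
  by transfer (simp add: fun_eq_iff)

lemma mon_single: "mon {#v#} = Poly_Mapping.single v 1"
  by transfer (auto simp: fun_eq_iff when_def)

lemma mon_surj: "\<exists>M. a = mon M"
proof -
  have "Poly_Mapping.lookup a = count (Abs_multiset (Poly_Mapping.lookup a))"
    by (simp add: Abs_multiset_inverse)
  then have "a = mon (Abs_multiset (Poly_Mapping.lookup a))"
    by (metis mon.rep_eq poly_mapping_eqI)
  then show ?thesis by blast
qed

lemma keys_mon: "Poly_Mapping.keys (mon M) = set_mset M"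
  by (auto simp: in_keys_iff mon.rep_eq)

lemma monomial_degree_mon: "monomial_degree (mon M) = size M"
  by (simp add: monomial_degree_def keys_mon mon.rep_eq size_multiset_overloaded_eq)

lemma mpoly_eq_iff: "p = q \<longleftrightarrow> (\<forall>M. cf p M = cf q M)"
  by (metis cf_def mon_surj poly_mapping_eqI)

lemma ball_keys_iff: "(\<forall>a\<in>Poly_Mapping.keys p. P a) \<longleftrightarrow> (\<forall>M. cf p M \<noteq> 0 \<longrightarrow> P (mon M))"
  by (metis cf_def in_keys_iff mon_surj)

lemma carrier_iff: "p \<in> carrier (poly_ring V) \<longleftrightarrow> (\<forall>M. cf p M \<noteq> 0 \<longrightarrow> set_mset M \<subseteq> V)"
  by (simp add: poly_ring_def ball_keys_iff keys_mon)

lemma finite_cf: "finite {M. cf p M \<noteq> 0}"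
proof -
  have "mon ` {M. cf p M \<noteq> 0} \<subseteq> Poly_Mapping.keys p" by (auto simp: cf_def in_keys_iff)
  then have "finite (mon ` {M. cf p M \<noteq> 0})" by (rule finite_subset) simp
  then show ?thesis by (rule finite_imageD) (simp add: inj_on_def)
qed

lemma cf_simps [simp]:
  "cf 0 M = 0" "cf (p + q) M = cf p M + cf q M"
  by (simp_all add: cf_def lookup_add)

lemma cf_group [simp]:
  fixes p :: "('v, 'k::ab_group_add) mpoly"
  shows "cf (- p) M = - cf p M" "cf (p - q) M = cf p M - cf q M" "cf (alt n p) M = alt n (cf p M)"
  by (simp_all add: cf_def lookup_minus alt_def)

lemma cf_sum: "cf (sum f A) M = (\<Sum>i\<in>A. cf (f i) M)"
  by (simp add: cf_def lookup_sum)

definition poly_of :: "('v multiset \<Rightarrow> 'k) \<Rightarrow> ('v, 'k::comm_monoid_add) mpoly" where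
  "poly_of h = (\<Sum>M | h M \<noteq> 0. Poly_Mapping.single (mon M) (h M))"

lemma cf_poly_of:
  assumes "finite {M. h M \<noteq> 0}" shows "cf (poly_of h) M = h M"
proof -
  have "cf (poly_of h) M = (\<Sum>N | h N \<noteq> 0. if N = M then h M else 0)"
    unfolding poly_of_def cf_def lookup_sum by (intro sum.cong refl) (auto simp: lookup_single when_def)
  then show ?thesis using assms by simp
qed

lemma lookup_single_mult:
  fixes p :: "('v, 'k::comm_semiring_1) mpoly"
  shows "Poly_Mapping.lookup (Poly_Mapping.single t c * p) (t + a) = c * Poly_Mapping.lookup p a"
    and "(\<And>a. b \<noteq> t + a) \<Longrightarrow> Poly_Mapping.lookup (Poly_Mapping.single t c * p) b = 0"
proof -
  have *: "Poly_Mapping.lookup (Poly_Mapping.single t c * p) b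
      = c * (\<Sum>q. Poly_Mapping.lookup p q when b = t + q)" for b
    by (simp add: lookup_mult lookup_single when_mult)
  show "Poly_Mapping.lookup (Poly_Mapping.single t c * p) (t + a) = c * Poly_Mapping.lookup p a"
    unfolding * by simp
  show "Poly_Mapping.lookup (Poly_Mapping.single t c * p) b = 0" if "\<And>a. b \<noteq> t + a"
    unfolding * using that by simp
qed

lemma cf_var_mult:
  fixes p :: "('v, 'k::field) mpoly"
  shows "cf (var v * p) M = (if v \<in># M then cf p (M - {#v#}) else 0)"
proof (cases "v \<in># M")
  case True
  then obtain N where M: "M = add_mset v N" by (metis multi_member_split)
  then have "mon M = Poly_Mapping.single v 1 + mon N" by (simp add: mon_add[of "{#v#}" N, simplified] mon_single)
  then show ?thesis by (simp add: cf_def var_def lookup_single_mult(1)) (simp add: M)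
next
  case False
  have "mon M \<noteq> Poly_Mapping.single v 1 + a" for a
  proof
    assume "mon M = Poly_Mapping.single v 1 + a"
    moreover obtain N where "a = mon N" using mon_surj by blast
    ultimately have "mon M = mon (add_mset v N)"
      by (simp add: mon_add[of "{#v#}" N, simplified] mon_single)
    then show False using False by simp
  qed
  then show ?thesis using False by (simp add: cf_def var_def lookup_single_mult(2))
qed

lemma cf_const_mult:
  fixes p :: "('v, 'k::field) mpoly"
  shows "cf (Poly_Mapping.single 0 c * p) M = c * cf p M"
  using lookup_single_mult(1)[of 0 c p "mon M"] by (simp add: cf_def)

lemma cf_mult_nonzero:
  fixes p :: "('v, 'k::field) mpoly"
  assumes "cf (p * q) M \<noteq> 0"
  shows "\<exists>M1 M2. M = M1 + M2 \<and> cf p M1 \<noteq> 0 \<and> cf q M2 \<noteq> 0"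
proof -
  have "mon M \<in> Poly_Mapping.keys (p * q)" using assms by (simp add: cf_def in_keys_iff)
  then obtain a b where ab: "mon M = a + b" "a \<in> Poly_Mapping.keys p" "b \<in> Poly_Mapping.keys q"
    using keys_mult[of p q] by blast
  obtain M1 M2 where "a = mon M1" "b = mon M2" using mon_surj by metis
  then show ?thesis using ab by (metis cf_def in_keys_iff mon_add mon_inject)
qed

definition part :: "('v multiset \<Rightarrow> bool) \<Rightarrow> ('v, 'k::comm_monoid_add) mpoly \<Rightarrow> ('v, 'k) mpoly" where
  "part P p = poly_of (\<lambda>M. if P M then cf p M else 0)"

lemma cf_part [simp]: "cf (part P p) M = (if P M then cf p M else 0)"
  unfolding part_def
  by (rule cf_poly_of, rule finite_subset[OF _ finite_cf[of p]]) auto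

text \<open>
  Degrees are shifted by \<open>x\<close> on the source and by \<open>y\<close> on the target, as for the entries of a graded matrix.
\<close>

lemma homogeneous_mult_part:
  fixes p :: "('v, 'k::field) mpoly"
  assumes "\<And>M. cf a M \<noteq> 0 \<Longrightarrow> size M + y = x"
  shows "a * part (\<lambda>M. size M + x = q) p = part (\<lambda>M. size M + y = q) (a * p)"
proof -
  let ?P = "\<lambda>M. size M + x = q" and ?Q = "\<lambda>M. size M + y = q"
  have split: "p = part ?P p + part (\<lambda>M. \<not> ?P M) p" by (auto simp: mpoly_eq_iff)
  have 1: "cf (a * part ?P p) M = 0" if "\<not> ?Q M" for M
  proof (rule ccontr)
    assume "cf (a * part ?P p) M \<noteq> 0"
    from cf_mult_nonzero[OF this] obtain M1 M2 where
      "M = M1 + M2" "cf a M1 \<noteq> 0" "cf (part ?P p) M2 \<noteq> 0" by blast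
    then show False using that assms[of M1] by (auto split: if_splits)
  qed
  have 2: "cf (a * part (\<lambda>M. \<not> ?P M) p) M = 0" if "?Q M" for M
  proof (rule ccontr)
    assume "cf (a * part (\<lambda>M. \<not> ?P M) p) M \<noteq> 0"
    from cf_mult_nonzero[OF this] obtain M1 M2 where
      "M = M1 + M2" "cf a M1 \<noteq> 0" "cf (part (\<lambda>M. \<not> ?P M) p) M2 \<noteq> 0" by blast
    then show False using that assms[of M1] by (auto split: if_splits)
  qed
  have "a * p = a * part ?P p + a * part (\<lambda>M. \<not> ?P M) p"
    using split by (metis distrib_left)
  then show ?thesis using 1 2 unfolding mpoly_eq_iff by (simp del: cf_part add: cf_part[of ?Q])
qed

section \<open>The Koszul complex of a graded module\<close>

type_synonym ('v, 'k) mvec = "nat \<Rightarrow> ('v, 'k) mpoly"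

lemma sum_fun_apply: "(sum F A) l = (\<Sum>i\<in>A. F i l)"
  by (induction A rule: infinite_finite_induct) (simp_all add: zero_fun_def plus_fun_def)

lemma alt_fun_apply: "(alt n f) l = alt n (f l)"
  by (simp add: alt_def)

definition xmult :: "'v \<Rightarrow> ('v, 'k::field) mvec \<Rightarrow> ('v, 'k) mvec" where
  "xmult v f = (\<lambda>l. var v * f l)"

lemma xmult_add: "xmult v (f + g) = xmult v f + xmult v g"
  by (simp add: xmult_def fun_eq_iff distrib_left)

lemma xmult_commute: "xmult v (xmult w f) = xmult w (xmult v f)"
  by (simp add: xmult_def fun_eq_iff mult.left_commute)

lemma xmult_zero [simp]: "xmult v 0 = 0"
  by (simp add: xmult_def fun_eq_iff)

text \<open>
  The piece of degree \<open>q\<close> of the direct sum of copies of the ideal \<open>U\<close>, shifted by the entries of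
  \<open>xs\<close>. For \<open>U = UNIV\<close> it is a piece of a free module. Vectors are functions that vanish outside the
  index range, because then they form an abelian group type.
\<close>

definition graded :: "'v set \<Rightarrow> 'v multiset set \<Rightarrow> nat list \<Rightarrow> nat \<Rightarrow> ('v, 'k::field) mvec set" where
  "graded V U xs q = {f. \<forall>l M. cf (f l) M \<noteq> 0 \<longrightarrow>
     l < length xs \<and> set_mset M \<subseteq> V \<and> M \<in> U \<and> size M + xs ! l = q}"

lemma graded_zero: "0 \<in> graded V U xs q"
  by (simp add: graded_def)

lemma graded_add: "f \<in> graded V U xs q \<Longrightarrow> g \<in> graded V U xs q \<Longrightarrow> f + g \<in> graded V U xs q"
  unfolding graded_def by (simp add: plus_fun_def) (metis add_0)

lemma graded_diff: "f \<in> graded V U xs q \<Longrightarrow> g \<in> graded V U xs q \<Longrightarrow> f - g \<in> graded V U xs q"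
  unfolding graded_def by (simp add: fun_diff_def) (metis diff_self)

lemma graded_alt: "f \<in> graded V U xs q \<Longrightarrow> alt n f \<in> graded V U xs q"
  unfolding graded_def by (simp add: alt_fun_apply)

lemma graded_sum: "(\<And>i. i \<in> A \<Longrightarrow> F i \<in> graded V U xs q) \<Longrightarrow> sum F A \<in> graded V U xs q"
  by (induction A rule: infinite_finite_induct) (simp_all add: graded_zero graded_add)

lemma graded_xmult:
  assumes "upset U" "v \<in> V" "f \<in> graded V U xs q"
  shows "xmult v f \<in> graded V U xs (Suc q)"
  unfolding graded_def mem_Collect_eq
proof (intro allI impI)
  fix l M assume "cf (xmult v f l) M \<noteq> 0"
  then have *: "v \<in># M" "cf (f l) (M - {#v#}) \<noteq> 0"
    by (auto simp: xmult_def cf_var_mult split: if_splits)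
  then obtain N where N: "M = add_mset v N" by (metis multi_member_split)
  then have "l < length xs \<and> set_mset N \<subseteq> V \<and> N \<in> U \<and> size N + xs ! l = q"
    using * assms(3) by (auto simp: graded_def)
  moreover from this have "M \<in> U" using assms(1) unfolding N by (metis add_mset_add_single upset_def)
  ultimately show "l < length xs \<and> set_mset M \<subseteq> V \<and> M \<in> U \<and> size M + xs ! l = Suc q"
    using N assms(2) by auto
qed

locale koszul = vertex_order V idx K for V :: "'v set" and idx :: "'v \<Rightarrow> nat" and K :: "'k::field itself"
begin

abbreviation koszul_bd :: "('v set \<Rightarrow> ('v, 'k) mvec) \<Rightarrow> 'v set \<Rightarrow> ('v, 'k) mvec" where
  "koszul_bd \<equiv> bdry xmult"

text \<open>
  Only one internal degree is considered at a time: a chain on sets of size \<open>p\<close> takes values in one graded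
  piece \<open>M\<close>, and in \<open>koszul_acyclic\<close> the piece \<open>M'\<close> is the one of the next lower degree.
\<close>

definition koszul_chain :: "nat \<Rightarrow> ('v, 'k) mvec set \<Rightarrow> ('v set \<Rightarrow> ('v, 'k) mvec) \<Rightarrow> bool" where
  "koszul_chain p M c \<longleftrightarrow> (\<forall>\<tau>. c \<tau> \<in> M \<and> (c \<tau> \<noteq> 0 \<longrightarrow> \<tau> \<subseteq> V \<and> card \<tau> = p))"

definition koszul_acyclic :: "nat \<Rightarrow> ('v, 'k) mvec set \<Rightarrow> ('v, 'k) mvec set \<Rightarrow> bool" where
  "koszul_acyclic p M M' \<longleftrightarrow> (\<forall>c. koszul_chain p M c \<longrightarrow> (\<forall>\<sigma>. koszul_bd c \<sigma> = 0) \<longrightarrow>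
     (\<exists>b. koszul_chain (Suc p) M' b \<and> koszul_bd b = c))"

text \<open>
  The strand of multidegree \<open>m\<close> in the component \<open>l\<close>: the multidegree of the coefficient of \<open>M\<close> at the
  face \<open>\<tau>\<close> is \<open>M\<close> plus the vertices of \<open>\<tau>\<close>.
\<close>

definition slice :: "('v set \<Rightarrow> ('v, 'k) mvec) \<Rightarrow> nat \<Rightarrow> 'v multiset \<Rightarrow> 'v set \<Rightarrow> 'k" where
  "slice c l m \<tau> = (if finite \<tau> \<and> mset_set \<tau> \<subseteq># m then cf (c \<tau> l) (m - mset_set \<tau>) else 0)"

lemma slice_add: "finite \<tau> \<Longrightarrow> slice c l (M + mset_set \<tau>) \<tau> = cf (c \<tau> l) M"
  by (simp add: slice_def)

lemma koszul_bd_apply: "koszul_bd c \<sigma> l = (\<Sum>v\<in>V - \<sigma>. alt (pos v \<sigma>) (var v * c (insert v \<sigma>) l))"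
  by (simp add: bdry_def sum_fun_apply alt_fun_apply xmult_def)

lemma slice_koszul_bd: "slice (koszul_bd c) l m \<sigma> = bd (slice c l m) \<sigma>"
proof (cases "finite \<sigma> \<and> mset_set \<sigma> \<subseteq># m")
  case True
  then obtain M where m: "m = M + mset_set \<sigma>" by (metis add.commute subset_mset.add_diff_inverse)
  have "slice c l m (insert v \<sigma>) = (if v \<in># M then cf (c (insert v \<sigma>) l) (M - {#v#}) else 0)"
    if "v \<in> V - \<sigma>" for v
    using that True by (auto simp: slice_def m)
  then have "bd (slice c l m) \<sigma> =
      (\<Sum>v\<in>V - \<sigma>. alt (pos v \<sigma>) (if v \<in># M then cf (c (insert v \<sigma>) l) (M - {#v#}) else 0))"
    unfolding bdry_def by (intro sum.cong refl) simp
  also have "\<dots> = cf (koszul_bd c \<sigma> l) M"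
    by (simp add: koszul_bd_apply cf_sum cf_var_mult)
  finally show ?thesis using True by (simp add: slice_def m)
next
  case False
  have "slice c l m (insert v \<sigma>) = 0" if "v \<in> V - \<sigma>" for v
  proof (cases "finite \<sigma>")
    case True
    have "\<not> mset_set (insert v \<sigma>) \<subseteq># m"
      using False True subset_mset.order_trans[OF subset_imp_msubset_mset_set[of \<sigma> "insert v \<sigma>"]] by auto
    then show ?thesis by (simp add: slice_def)
  qed (simp add: slice_def)
  then have "bd (slice c l m) \<sigma> = 0" by (simp add: bdry_def)
  moreover have "slice (koszul_bd c) l m \<sigma> = 0" using False by (auto simp: slice_def)
  ultimately show ?thesis by simp
qed

text \<open>
  The strands of different multidegrees do not interact, so a cycle is filled strand by strand. Strands on
  which the cycle vanishes are filled by zero; this leaves finitely many multidegrees and makes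
  the coefficients of the filling polynomials.
\<close>

theorem koszul_acyclic_from_faces:
  assumes c: "koszul_chain p (graded V U xs (Suc q)) c" and cyc: "\<forall>\<sigma>. koszul_bd c \<sigma> = 0"
    and faces: "\<And>\<tau> l M. \<tau> \<subseteq> V \<Longrightarrow> cf (c \<tau> l) M \<noteq> 0 \<Longrightarrow> acyc p (faces U (M + mset_set \<tau>))"
  shows "\<exists>b. koszul_chain (Suc p) (graded V U xs q) b \<and> koszul_bd b = c"
proof -
  have fin: "finite \<tau>" if "\<tau> \<subseteq> V" for \<tau> using that finite_V by (rule finite_subset)
  have supp: "\<tau> \<subseteq> V \<and> finite \<tau> \<and> card \<tau> = p \<and> l < length xs \<and> set_mset M \<subseteq> V \<and> M \<in> U \<and> size M + xs ! l = Suc q"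
    if "cf (c \<tau> l) M \<noteq> 0" for \<tau> l M
  proof -
    have "c \<tau> \<noteq> 0" using that by auto
    moreover have "c \<tau> \<in> graded V U xs (Suc q)" "c \<tau> \<noteq> 0 \<longrightarrow> \<tau> \<subseteq> V \<and> card \<tau> = p"
      using c by (simp_all add: koszul_chain_def)
    moreover from this(1) that have "l < length xs \<and> set_mset M \<subseteq> V \<and> M \<in> U \<and> size M + xs ! l = Suc q"
      by (simp add: graded_def)
    ultimately show ?thesis using fin by simp
  qed
  have slice: "\<exists>M. m = M + mset_set \<tau> \<and> cf (c \<tau> l) M \<noteq> 0" if "slice c l m \<tau> \<noteq> 0" for l m \<tau>
    using that unfolding slice_def by (metis subset_mset.diff_add)
  let ?fill = "\<lambda>l m b. chain (Suc p) (faces U m) b \<and> bd b = slice c l m \<and>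
    (slice c l m = (\<lambda>_. 0) \<longrightarrow> b = (\<lambda>_. 0))"
  have ex: "\<exists>b. ?fill l m b" for l m
  proof (cases "slice c l m = (\<lambda>_. 0)")
    case True
    then show ?thesis by (intro exI[of _ "\<lambda>_. 0"]) (auto simp: chain_def bdry_def)
  next
    case False
    then obtain \<tau> where "slice c l m \<tau> \<noteq> 0" by auto
    from slice[OF this] obtain M where M: "m = M + mset_set \<tau>" "cf (c \<tau> l) M \<noteq> 0" by blast
    then have "acyc p (faces U m)" using faces[of \<tau> l M] supp[OF M(2)] by simp
    moreover have "chain p (faces U m) (slice c l m)"
      unfolding chain_def
    proof (intro allI impI)
      fix \<tau> assume "slice c l m \<tau> \<noteq> 0"
      from slice[OF this] obtain M where "m = M + mset_set \<tau>" "cf (c \<tau> l) M \<noteq> 0" by blast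
      then show "\<tau> \<in> faces U m \<and> card \<tau> = p" using supp[of \<tau> l M] by (auto simp: faces_def)
    qed
    moreover have "bd (slice c l m) \<sigma> = 0" for \<sigma>
      unfolding slice_koszul_bd[symmetric] using cyc by (simp add: slice_def)
    ultimately show ?thesis using False by (auto simp: acyc_def)
  qed
  define bb where "bb l m = (SOME b. ?fill l m b)" for l m
  have fill: "?fill l m (bb l m)" for l m
    unfolding bb_def by (rule someI_ex[OF ex])
  have bb: "chain (Suc p) (faces U m) (bb l m)" "bd (bb l m) = slice c l m"
    "slice c l m = (\<lambda>_. 0) \<Longrightarrow> bb l m = (\<lambda>_. 0)" for l m
    using fill[of m l] by simp_all
  \<comment> \<open>The filling is nonzero only in multidegrees where the cycle is; this gives finite supports.\<close>
  have bb_supp: "\<exists>\<tau>' M'. M + mset_set \<tau> = M' + mset_set \<tau>' \<and> cf (c \<tau>' l) M' \<noteq> 0"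
    if "bb l (M + mset_set \<tau>) \<tau> \<noteq> 0" for l M \<tau>
  proof -
    have "slice c l (M + mset_set \<tau>) \<noteq> (\<lambda>_. 0)" using bb(3)[of l "M + mset_set \<tau>"] that by auto
    then obtain \<tau>' where "slice c l (M + mset_set \<tau>) \<tau>' \<noteq> 0" by auto
    from slice[OF this] show ?thesis by blast
  qed
  define b where "b \<tau> l = poly_of (\<lambda>M. bb l (M + mset_set \<tau>) \<tau>)" for \<tau> l
  have cf_b: "cf (b \<tau> l) M = bb l (M + mset_set \<tau>) \<tau>" for \<tau> l M
    unfolding b_def
  proof (rule cf_poly_of)
    let ?S = "\<Union>\<tau>'\<in>Pow V. (\<lambda>M'. M' + mset_set \<tau>') ` {M'. cf (c \<tau>' l) M' \<noteq> 0}"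
    have "(\<lambda>M. M + mset_set \<tau>) ` {M. bb l (M + mset_set \<tau>) \<tau> \<noteq> 0} \<subseteq> ?S"
    proof
      fix m assume "m \<in> (\<lambda>M. M + mset_set \<tau>) ` {M. bb l (M + mset_set \<tau>) \<tau> \<noteq> 0}"
      then obtain M where "m = M + mset_set \<tau>" "bb l (M + mset_set \<tau>) \<tau> \<noteq> 0" by auto
      then obtain \<tau>' M' where M': "m = M' + mset_set \<tau>'" "cf (c \<tau>' l) M' \<noteq> 0"
        using bb_supp[of l M \<tau>] by auto
      then have "\<tau>' \<in> Pow V" using supp[OF M'(2)] by simp
      moreover have "m \<in> (\<lambda>M'. M' + mset_set \<tau>') ` {M'. cf (c \<tau>' l) M' \<noteq> 0}" using M' by simp
      ultimately show "m \<in> ?S" by (rule UN_I)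
    qed
    moreover have "finite ?S" using finite_V finite_cf by (intro finite_UN_I finite_imageI) simp_all
    ultimately have "finite ((\<lambda>M. M + mset_set \<tau>) ` {M. bb l (M + mset_set \<tau>) \<tau> \<noteq> 0})"
      by (rule finite_subset)
    then show "finite {M. bb l (M + mset_set \<tau>) \<tau> \<noteq> 0}"
      by (rule finite_imageD) (simp add: inj_on_def)
  qed
  have slice_b: "slice b l m = bb l m" for l m
  proof
    fix \<tau> show "slice b l m \<tau> = bb l m \<tau>"
    proof (cases "finite \<tau> \<and> mset_set \<tau> \<subseteq># m")
      case False
      then have "\<tau> \<notin> faces U m" by (auto simp: faces_iff)
      then show ?thesis using False bb(1)[of m l] by (auto simp: slice_def chain_def)
    qed (simp add: slice_def cf_b)
  qed
  have b_supp: "\<tau> \<subseteq> V \<and> card \<tau> = Suc p \<and> l < length xs \<and> set_mset M \<subseteq> V \<and> M \<in> U \<and> size M + xs ! l = q"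
    if "cf (b \<tau> l) M \<noteq> 0" for \<tau> l M
  proof -
    let ?m = "M + mset_set \<tau>"
    have ne: "bb l ?m \<tau> \<noteq> 0" using that by (simp add: cf_b)
    then have \<tau>: "\<tau> \<in> faces U ?m" "card \<tau> = Suc p" using bb(1)[of ?m l] by (auto simp: chain_def)
    then have "finite \<tau>" "M \<in> U" by (auto simp: faces_iff)
    obtain \<tau>' M' where M': "?m = M' + mset_set \<tau>'" "cf (c \<tau>' l) M' \<noteq> 0" using bb_supp[OF ne] by blast
    have sub: "set_mset ?m \<subseteq> V" unfolding M'(1) using supp[OF M'(2)] by auto
    have "size ?m = size M' + p" unfolding M'(1) using supp[OF M'(2)] by simp
    then have "size M + Suc p = size M' + p" using \<tau>(2) \<open>finite \<tau>\<close> by simp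
    then show ?thesis using \<tau> sub \<open>finite \<tau>\<close> \<open>M \<in> U\<close> supp[OF M'(2)] by auto
  qed
  have "koszul_chain (Suc p) (graded V U xs q) b"
    unfolding koszul_chain_def
  proof (intro allI conjI impI)
    show "b \<tau> \<in> graded V U xs q" for \<tau> using b_supp by (simp add: graded_def)
    fix \<tau> assume "b \<tau> \<noteq> 0"
    then obtain l where "b \<tau> l \<noteq> 0" by (auto simp: fun_eq_iff)
    then obtain M where "cf (b \<tau> l) M \<noteq> 0" by (auto simp: mpoly_eq_iff)
    from b_supp[OF this] show "\<tau> \<subseteq> V" "card \<tau> = Suc p" by simp_all
  qed
  moreover have "koszul_bd b = c"
  proof (intro ext)
    fix \<sigma> l
    show "koszul_bd b \<sigma> l = c \<sigma> l"
    proof (cases "finite \<sigma>")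
      case True
      have "cf (koszul_bd b \<sigma> l) M = cf (c \<sigma> l) M" for M
      proof -
        have "cf (koszul_bd b \<sigma> l) M = slice (koszul_bd b) l (M + mset_set \<sigma>) \<sigma>" using True by (simp add: slice_add)
        also have "\<dots> = slice c l (M + mset_set \<sigma>) \<sigma>" by (simp add: slice_koszul_bd slice_b bb(2))
        finally show ?thesis using True by (simp add: slice_add)
      qed
      then show ?thesis by (simp add: mpoly_eq_iff)
    next
      case False
      have "cf (c \<sigma> l) M = 0" for M using supp[of \<sigma> l M] False by blast
      moreover have "cf (b (insert v \<sigma>) l) M = 0" for v M
        using b_supp[of "insert v \<sigma>" l M] fin[of "insert v \<sigma>"] False by auto
      ultimately have "c \<sigma> l = 0" "\<And>v. b (insert v \<sigma>) l = 0" by (simp_all add: mpoly_eq_iff)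
      then show ?thesis by (simp add: koszul_bd_apply)
    qed
  qed
  ultimately show ?thesis by blast
qed

text \<open>
  A constant term in homological degree \<open>0\<close> is the only obstruction: the homology of the
  Koszul complex of the polynomial ring is the residue field.
\<close>

lemma koszul_acyclic_free:
  assumes c: "koszul_chain p (graded V UNIV xs (Suc q)) c" and cyc: "\<forall>\<sigma>. koszul_bd c \<sigma> = 0"
    and const: "p = 0 \<Longrightarrow> (\<And>l. cf (c {} l) {#} = 0)"
  shows "\<exists>b. koszul_chain (Suc p) (graded V UNIV xs q) b \<and> koszul_bd b = c"
proof (rule koszul_acyclic_from_faces[OF c cyc])
  fix \<tau> l M assume \<tau>: "\<tau> \<subseteq> V" and ne: "cf (c \<tau> l) M \<noteq> 0"
  then have "c \<tau> \<noteq> 0" by auto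
  then have card: "card \<tau> = p" and M: "set_mset M \<subseteq> V"
    using c ne by (auto simp: koszul_chain_def graded_def)
  have fin: "finite \<tau>" using \<tau> finite_V by (rule finite_subset)
  show "acyc p (faces UNIV (M + mset_set \<tau>))"
  proof (rule acyc_faces_UNIV)
    show "set_mset (M + mset_set \<tau>) \<subseteq> V" using M \<tau> fin by simp
    show "M + mset_set \<tau> \<noteq> {#} \<or> 0 < p"
    proof (cases "p = 0")
      case True
      then have "\<tau> = {}" using card fin by simp
      then have "M \<noteq> {#}" using const[OF True, of l] ne by auto
      then show ?thesis by simp
    qed simp
  qed
qed

end

section \<open>Graded maps between free modules\<close>

definition app :: "('v, 'k::field) mpoly mat \<Rightarrow> ('v, 'k) mvec \<Rightarrow> ('v, 'k) mvec" where
  "app A f = (\<lambda>k. if k < dim_row A then \<Sum>l<dim_col A. A $$ (k, l) * f l else 0)"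

lemma app_zero [simp]: "app A 0 = 0"
  by (simp add: app_def fun_eq_iff)

lemma app_add: "app A (f + g) = app A f + app A g"
  by (simp add: app_def fun_eq_iff distrib_left sum.distrib)

lemma app_diff: "app A (f - g) = app A f - app A g"
  by (simp add: app_def fun_eq_iff right_diff_distrib sum_subtractf)

lemma app_sum: "app A (sum F S) = (\<Sum>i\<in>S. app A (F i))"
  by (induction S rule: infinite_finite_induct) (simp_all add: app_add del: plus_fun_apply zero_fun_apply)

lemma app_alt: "app A (alt n f) = alt n (app A f)"
  using app_diff[of A 0 f] by (simp add: alt_def)

lemma app_mult: "app A (\<lambda>l. a * f l) = (\<lambda>k. a * app A f k)"
  by (simp add: app_def fun_eq_iff sum_distrib_left mult.left_commute)

lemma app_xmult: "app A (xmult v f) = xmult v (app A f)"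
  by (simp add: xmult_def app_mult)

lemma graded_map_entry:
  assumes "graded_map V xs ys A" "k < length ys" "l < length xs" "cf (A $$ (k, l)) M \<noteq> 0"
  shows "set_mset M \<subseteq> V" "size M + ys ! k = xs ! l"
  using assms by (auto simp: graded_map_def carrier_iff ball_keys_iff monomial_degree_mon)

lemma graded_map_dims:
  assumes "graded_map V xs ys A" shows "dim_row A = length ys" "dim_col A = length xs"
  using assms by (auto simp: graded_map_def)

definition poly_vectors :: "'v set \<Rightarrow> nat \<Rightarrow> ('v, 'k::field) mvec set" where
  "poly_vectors V n = {f. \<forall>l M. cf (f l) M \<noteq> 0 \<longrightarrow> l < n \<and> set_mset M \<subseteq> V}"

lemma cf_app_nonzero:
  assumes A: "graded_map V xs ys A" and ne: "cf (app A f k) M \<noteq> 0"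
  shows "\<exists>l M1 M2. k < length ys \<and> l < length xs \<and> M = M1 + M2 \<and> set_mset M1 \<subseteq> V \<and>
    size M1 + ys ! k = xs ! l \<and> cf (f l) M2 \<noteq> 0"
proof -
  have k: "k < length ys" using ne graded_map_dims[OF A] by (auto simp: app_def split: if_splits)
  have "(\<Sum>l<length xs. cf (A $$ (k, l) * f l) M) \<noteq> 0"
    using ne k graded_map_dims[OF A] by (simp add: app_def cf_sum)
  then obtain l where l: "l < length xs" "cf (A $$ (k, l) * f l) M \<noteq> 0"
    by (metis (mono_tags, lifting) lessThan_iff sum.neutral)
  from cf_mult_nonzero[OF l(2)] obtain M1 M2 where
    "M = M1 + M2" "cf (A $$ (k, l)) M1 \<noteq> 0" "cf (f l) M2 \<noteq> 0" by blast
  then show ?thesis using graded_map_entry[OF A k l(1)] k l(1) by blast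
qed

lemma app_graded:
  assumes A: "graded_map V xs ys A" and f: "f \<in> graded V UNIV xs q"
  shows "app A f \<in> graded V UNIV ys q"
  unfolding graded_def mem_Collect_eq
proof (intro allI impI)
  fix k M assume "cf (app A f k) M \<noteq> 0"
  from cf_app_nonzero[OF A this] obtain l M1 M2 where *: "k < length ys" "l < length xs"
    "M = M1 + M2" "set_mset M1 \<subseteq> V" "size M1 + ys ! k = xs ! l" "cf (f l) M2 \<noteq> 0" by blast
  then have "set_mset M2 \<subseteq> V" "size M2 + xs ! l = q" using f by (auto simp: graded_def)
  then show "k < length ys \<and> set_mset M \<subseteq> V \<and> M \<in> UNIV \<and> size M + ys ! k = q"
    using * by auto
qed

lemma app_poly_vectors:
  assumes A: "graded_map V xs ys A" and f: "f \<in> poly_vectors V (length xs)"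
  shows "app A f \<in> poly_vectors V (length ys)"
  unfolding poly_vectors_def mem_Collect_eq
proof (intro allI impI)
  fix k M assume "cf (app A f k) M \<noteq> 0"
  from cf_app_nonzero[OF A this] obtain l M1 M2 where *: "k < length ys" "l < length xs"
    "M = M1 + M2" "set_mset M1 \<subseteq> V" "size M1 + ys ! k = xs ! l" "cf (f l) M2 \<noteq> 0" by blast
  then have "set_mset M2 \<subseteq> V" using f by (auto simp: poly_vectors_def)
  then show "k < length ys \<and> set_mset M \<subseteq> V" using * by auto
qed

lemma graded_poly_vectors: "f \<in> graded V U xs q \<Longrightarrow> f \<in> poly_vectors V (length xs)"
  by (auto simp: graded_def poly_vectors_def)

lemma poly_vectors_zero: "0 \<in> poly_vectors V n"
  by (simp add: poly_vectors_def)

lemma poly_vectors_add: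
  "f \<in> poly_vectors V n \<Longrightarrow> g \<in> poly_vectors V n \<Longrightarrow> f + g \<in> poly_vectors V n"
  unfolding poly_vectors_def by (simp add: plus_fun_def) (metis add_0)

lemma poly_vectors_sum:
  "(\<And>i. i \<in> S \<Longrightarrow> F i \<in> poly_vectors V n) \<Longrightarrow> sum F S \<in> poly_vectors V n"
  by (induction S rule: infinite_finite_induct) (simp_all add: poly_vectors_zero poly_vectors_add)

definition degree_part :: "nat list \<Rightarrow> nat \<Rightarrow> ('v, 'k::field) mvec \<Rightarrow> ('v, 'k) mvec" where
  "degree_part xs q f = (\<lambda>l. part (\<lambda>M. size M + xs ! l = q) (f l))"

lemma degree_part_graded: "f \<in> poly_vectors V (length xs) \<Longrightarrow> degree_part xs q f \<in> graded V UNIV xs q"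
  by (auto simp: graded_def poly_vectors_def degree_part_def split: if_splits)

lemma degree_part_id: "f \<in> graded V U xs q \<Longrightarrow> degree_part xs q f = f"
  by (auto simp: degree_part_def graded_def fun_eq_iff mpoly_eq_iff)

lemma degree_part_zero [simp]: "degree_part xs q 0 = 0"
  by (simp add: degree_part_def fun_eq_iff mpoly_eq_iff)

lemma app_degree_part:
  assumes A: "graded_map V xs ys A"
  shows "app A (degree_part xs q f) = degree_part ys q (app A f)"
proof
  fix k
  show "app A (degree_part xs q f) k = degree_part ys q (app A f) k"
  proof (cases "k < length ys")
    case True
    have "A $$ (k, l) * degree_part xs q f l = part (\<lambda>M. size M + ys ! k = q) (A $$ (k, l) * f l)"
      if "l < length xs" for l
      unfolding degree_part_def by (rule homogeneous_mult_part) (rule graded_map_entry(2)[OF A True that])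
    then have "app A (degree_part xs q f) k = (\<Sum>l<length xs. part (\<lambda>M. size M + ys ! k = q) (A $$ (k, l) * f l))"
      using True graded_map_dims[OF A] by (simp add: app_def)
    also have "\<dots> = part (\<lambda>M. size M + ys ! k = q) (app A f k)"
      using True graded_map_dims[OF A] by (simp add: mpoly_eq_iff app_def cf_sum)
    finally show ?thesis by (simp add: degree_part_def)
  next
    case False
    then show ?thesis using graded_map_dims[OF A] by (simp add: app_def degree_part_def mpoly_eq_iff)
  qed
qed

lemma sum_degree_part:
  assumes f: "f \<in> poly_vectors V (length xs)"
  shows "\<exists>Q. finite Q \<and> f = (\<Sum>q\<in>Q. degree_part xs q f)"
proof (intro exI conjI)
  let ?Q = "\<Union>l<length xs. (\<lambda>M. size M + xs ! l) ` {M. cf (f l) M \<noteq> 0}"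
  show fin: "finite ?Q" using finite_cf by (intro finite_UN_I finite_imageI) simp_all
  have eq: "cf (f l) M = cf ((\<Sum>q\<in>?Q. degree_part xs q f) l) M" for l M
  proof (cases "cf (f l) M = 0")
    case True
    have "cf ((\<Sum>q\<in>?Q. degree_part xs q f) l) M = 0"
      unfolding sum_fun_apply cf_sum degree_part_def cf_part by (intro sum.neutral ballI) (simp add: True)
    then show ?thesis using True by simp
  next
    case False
    then have "size M + xs ! l \<in> ?Q" using f by (auto simp: poly_vectors_def)
    moreover have "cf ((\<Sum>q\<in>?Q. degree_part xs q f) l) M = (\<Sum>q\<in>?Q. if size M + xs ! l = q then cf (f l) M else 0)"
      by (simp add: sum_fun_apply cf_sum degree_part_def)
    ultimately show ?thesis using fin by (simp only: sum.delta' sum.delta if_True)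
  qed
  show "f = (\<Sum>q\<in>?Q. degree_part xs q f)"
    by (intro ext iffD2[OF mpoly_eq_iff] allI eq)
qed

text \<open>
  Exactness can be checked degree by degree: preimages of the finitely many components add up.
\<close>

lemma mem_image_app:
  assumes f: "f \<in> poly_vectors V (length ys)"
    and comp: "\<And>q. degree_part ys q f \<in> app A ` graded V UNIV xs q"
  shows "f \<in> app A ` poly_vectors V (length xs)"
proof -
  obtain Q where Q: "f = (\<Sum>q\<in>Q. degree_part ys q f)" using sum_degree_part[OF f] by blast
  have "\<forall>q. \<exists>g. g \<in> graded V UNIV xs q \<and> degree_part ys q f = app A g" using comp by blast
  then obtain g where g: "\<And>q. g q \<in> graded V UNIV xs q" "\<And>q. degree_part ys q f = app A (g q)"
    by metis
  have "f = app A (\<Sum>q\<in>Q. g q)"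
    by (subst Q) (simp add: app_sum g(2))
  moreover have "(\<Sum>q\<in>Q. g q) \<in> poly_vectors V (length xs)"
    by (intro poly_vectors_sum graded_poly_vectors[OF g(1)])
  ultimately show ?thesis by blast
qed

definition graded_kernel :: "'v set \<Rightarrow> nat list \<Rightarrow> ('v, 'k::field) mpoly mat \<Rightarrow> nat \<Rightarrow> ('v, 'k) mvec set" where
  "graded_kernel V xs A q = {f \<in> graded V UNIV xs q. app A f = 0}"

text \<open>
  The kernel is contained in the maximal ideal times the free module, which means that the columns of
  \<open>A\<close> form a minimal system of generators of its image.
\<close>

definition minimal_map :: "'v set \<Rightarrow> nat list \<Rightarrow> ('v, 'k::field) mpoly mat \<Rightarrow> bool" where
  "minimal_map V xs A \<longleftrightarrow> (\<forall>q. \<forall>f\<in>graded_kernel V xs A q. \<forall>l. cf (f l) {#} = 0)"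

section \<open>Shifting acyclicity along syzygies\<close>

lemma upset_UNIV: "upset UNIV"
  by (simp add: upset_def)

context koszul
begin

lemma app_koszul_bd: "app A (koszul_bd c \<sigma>) = koszul_bd (\<lambda>\<tau>. app A (c \<tau>)) \<sigma>"
  by (simp add: bdry_def app_sum app_alt app_xmult)

lemma koszul_chain_koszul_bd:
  assumes U: "upset U" and a: "koszul_chain (Suc p) (graded V U xs q) a"
  shows "koszul_chain p (graded V U xs (Suc q)) (koszul_bd a)"
  unfolding koszul_chain_def
proof (intro allI conjI impI)
  fix \<sigma>
  have "a (insert v \<sigma>) \<in> graded V U xs q" for v using a by (simp add: koszul_chain_def)
  then show "koszul_bd a \<sigma> \<in> graded V U xs (Suc q)"
    unfolding bdry_def using U by (intro graded_sum graded_alt graded_xmult) auto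
  assume "koszul_bd a \<sigma> \<noteq> 0"
  then obtain v where v: "v \<in> V - \<sigma>" "alt (pos v \<sigma>) (xmult v (a (insert v \<sigma>))) \<noteq> 0"
    unfolding bdry_def by (metis (no_types, lifting) sum.neutral)
  then have "a (insert v \<sigma>) \<noteq> 0" by auto
  then have *: "insert v \<sigma> \<subseteq> V" "card (insert v \<sigma>) = Suc p"
    using a unfolding koszul_chain_def by blast+
  then show "\<sigma> \<subseteq> V" by simp
  have "finite \<sigma>" using * finite_V by (metis card.infinite finite_insert nat.distinct(1))
  then show "card \<sigma> = p" using * v(1) by simp
qed

lemma koszul_bd_koszul_bd:
  assumes "koszul_chain p M a"
  shows "koszul_bd (koszul_bd a) \<sigma> = 0"
proof (cases "finite \<sigma>")
  case True
  then show ?thesis by (intro bdry_bdry xmult_add xmult_commute)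
next
  case False
  have "a \<tau> = 0" if "\<not> \<tau> \<subseteq> V" for \<tau> using assms that by (auto simp: koszul_chain_def)
  then have "koszul_bd a \<tau> = 0" if "\<not> \<tau> \<subseteq> V" for \<tau>
    by (rule bdry_outside) (simp_all add: that)
  moreover have "\<not> \<sigma> \<subseteq> V" using False finite_V finite_subset by blast
  ultimately show ?thesis by (intro bdry_outside[of "koszul_bd a" xmult \<sigma>] xmult_zero)
qed

text \<open>
  Let \<open>0 \<rightarrow> N \<rightarrow> F \<rightarrow> M \<rightarrow> 0\<close> be given by the minimal map \<open>A\<close>. A Koszul cycle \<open>c\<close> in \<open>N\<close> bounds some \<open>b\<close> in
  \<open>F\<close>; in homological degree \<open>0\<close> this uses that \<open>N\<close> has no constant terms. The image of \<open>b\<close> in \<open>M\<close>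
  is a cycle of the next homological degree and bounds by assumption. Lift its filling to \<open>a'\<close> in \<open>F\<close>: then
  \<open>b\<close> minus the boundary of \<open>a'\<close> lies in \<open>N\<close> and still fills \<open>c\<close>.
\<close>

theorem dimension_shift:
  assumes A: "graded_map V xs ys A" and min: "minimal_map V xs A"
    and ac: "\<And>p q. r \<le> q \<Longrightarrow> koszul_acyclic p (app A ` graded V UNIV xs (Suc q)) (app A ` graded V UNIV xs q)"
    and q: "Suc r \<le> q"
  shows "koszul_acyclic p (graded_kernel V xs A (Suc q)) (graded_kernel V xs A q)"
  unfolding koszul_acyclic_def
proof (intro allI impI)
  fix c assume c: "koszul_chain p (graded_kernel V xs A (Suc q)) c" and cyc: "\<forall>\<sigma>. koszul_bd c \<sigma> = 0"
  have c': "koszul_chain p (graded V UNIV xs (Suc q)) c" and Ac: "\<And>\<tau>. app A (c \<tau>) = 0"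
    using c by (auto simp: koszul_chain_def graded_kernel_def)
  have "c {} \<in> graded_kernel V xs A (Suc q)" using c by (simp add: koszul_chain_def)
  then have "cf (c {} l) {#} = 0" for l
    using min unfolding minimal_map_def by blast
  from koszul_acyclic_free[OF c' cyc this] obtain b where
    b: "koszul_chain (Suc p) (graded V UNIV xs q) b" "koszul_bd b = c" by blast
  obtain q0 where q0: "q = Suc q0" "r \<le> q0" using q by (cases q) auto
  have "koszul_chain (Suc p) (app A ` graded V UNIV xs (Suc q0)) (\<lambda>\<tau>. app A (b \<tau>))"
    using b(1) q0(1) unfolding koszul_chain_def by (metis app_zero image_eqI)
  moreover have "koszul_bd (\<lambda>\<tau>. app A (b \<tau>)) \<sigma> = 0" for \<sigma>
    using Ac[of \<sigma>] by (simp add: app_koszul_bd[symmetric] b(2))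
  ultimately obtain a where a: "koszul_chain (Suc (Suc p)) (app A ` graded V UNIV xs q0) a"
    "koszul_bd a = (\<lambda>\<tau>. app A (b \<tau>))"
    using ac[OF q0(2), of "Suc p"] unfolding koszul_acyclic_def by blast
  have "\<exists>a'. a' \<in> graded V UNIV xs q0 \<and> app A a' = a \<tau> \<and> (a \<tau> = 0 \<longrightarrow> a' = 0)" for \<tau>
  proof (cases "a \<tau> = 0")
    case True
    then show ?thesis using graded_zero by (intro exI[of _ 0]) auto
  next
    case False
    have "a \<tau> \<in> app A ` graded V UNIV xs q0" using a(1) by (simp add: koszul_chain_def)
    then show ?thesis using False by auto
  qed
  then obtain a' where a': "\<And>\<tau>. a' \<tau> \<in> graded V UNIV xs q0" "\<And>\<tau>. app A (a' \<tau>) = a \<tau>"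
    "\<And>\<tau>. a \<tau> = 0 \<Longrightarrow> a' \<tau> = 0" by metis
  have ga': "koszul_chain (Suc (Suc p)) (graded V UNIV xs q0) a'"
    unfolding koszul_chain_def
  proof (intro allI conjI impI a'(1))
    fix \<tau> assume "a' \<tau> \<noteq> 0"
    then have "a \<tau> \<noteq> 0" using a'(3) by blast
    then show "\<tau> \<subseteq> V" "card \<tau> = Suc (Suc p)" using a(1) unfolding koszul_chain_def by blast+
  qed
  have da': "koszul_chain (Suc p) (graded V UNIV xs q) (koszul_bd a')"
    unfolding q0(1) by (rule koszul_chain_koszul_bd[OF upset_UNIV ga'])
  define e where "e \<tau> = b \<tau> - koszul_bd a' \<tau>" for \<tau>
  have Ae: "app A (e \<tau>) = 0" for \<tau>
  proof -
    have "app A (koszul_bd a' \<tau>) = koszul_bd a \<tau>" unfolding app_koszul_bd a'(2) ..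
    then show ?thesis by (simp add: e_def app_diff a(2))
  qed
  have "koszul_chain (Suc p) (graded_kernel V xs A q) e"
    unfolding koszul_chain_def
  proof (intro allI conjI impI)
    fix \<tau>
    show "e \<tau> \<in> graded_kernel V xs A q"
      using Ae b(1) da' by (simp add: graded_kernel_def e_def koszul_chain_def graded_diff)
    assume "e \<tau> \<noteq> 0"
    then have "b \<tau> \<noteq> 0 \<or> koszul_bd a' \<tau> \<noteq> 0" by (auto simp: e_def)
    then show "\<tau> \<subseteq> V" "card \<tau> = Suc p" using b(1) da' unfolding koszul_chain_def by blast+
  qed
  moreover have "koszul_bd e = c"
  proof
    fix \<sigma>
    have "koszul_bd e \<sigma> = koszul_bd b \<sigma> - koszul_bd (koszul_bd a') \<sigma>"
      unfolding e_def by (rule bdry_diff) (rule xmult_add)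
    then show "koszul_bd e \<sigma> = c \<sigma>" using koszul_bd_koszul_bd[OF ga'] b(2) by simp
  qed
  ultimately show "\<exists>b. koszul_chain (Suc p) (graded_kernel V xs A q) b \<and> koszul_bd b = c" by blast
qed

text \<open>
  Every chain of homological degree \<open>0\<close> is a cycle, and a filling of it writes \<open>w\<close> as a combination of
  the variables.
\<close>

lemma koszul_acyclic_generation:
  assumes ac: "koszul_acyclic 0 M' M" and w: "w \<in> M'" and zero: "0 \<in> M'"
  shows "\<exists>b. (\<forall>v. b v \<in> M) \<and> w = (\<Sum>v\<in>V. xmult v (b v))"
proof -
  define c where "c \<tau> = (if \<tau> = {} then w else 0)" for \<tau> :: "'v set"
  have "koszul_chain 0 M' c" using w zero by (auto simp: koszul_chain_def c_def)
  moreover have "koszul_bd c \<sigma> = 0" for \<sigma> by (simp add: bdry_def c_def)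
  ultimately obtain b where b: "koszul_chain 1 M b" "koszul_bd b = c"
    using ac unfolding koszul_acyclic_def by auto
  have "w = koszul_bd b {}" by (simp add: b(2) c_def)
  also have "\<dots> = (\<Sum>v\<in>V. xmult v (b {v}))" by (simp add: bdry_def pos_def alt_def)
  finally show ?thesis using b(1) by (intro exI[of _ "\<lambda>v. b {v}"]) (simp add: koszul_chain_def)
qed

lemma cf_xmult_const: "cf (xmult v f l) {#} = 0"
  by (simp add: xmult_def cf_var_mult)

text \<open>
  If a basis vector \<open>e\<close> had larger degree, its image would be a combination \<open>\<Sum> x\<^sub>v A u\<^sub>v\<close>. Then
  \<open>e - \<Sum> x\<^sub>v u\<^sub>v\<close> would be a relation with a constant term \<open>1\<close>, against minimality.
\<close>

theorem basis_degree_bound: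
  assumes A: "graded_map V xs ys A" and min: "minimal_map V xs A"
    and ac: "\<And>q. r \<le> q \<Longrightarrow> koszul_acyclic 0 (app A ` graded V UNIV xs (Suc q)) (app A ` graded V UNIV xs q)"
    and l: "l < length xs"
  shows "xs ! l \<le> r"
proof (rule ccontr)
  assume "\<not> xs ! l \<le> r"
  then obtain q where q: "xs ! l = Suc q" "r \<le> q" by (cases "xs ! l") auto
  define e :: "('v, 'k) mvec" where "e j = (if j = l then 1 else 0)" for j
  have cf_one: "cf (1 :: ('v, 'k) mpoly) M = (if M = {#} then 1 else 0)" for M
    by (simp add: cf_def lookup_one when_def) (metis mon_empty mon_inject)
  have e: "e \<in> graded V UNIV xs (Suc q)"
    using l q by (auto simp: graded_def e_def cf_one)
  have "0 \<in> app A ` graded V UNIV xs (Suc q)"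
    using graded_zero app_zero by (metis image_eqI)
  from koszul_acyclic_generation[OF ac[OF q(2)] imageI[OF e] this] obtain b where
    b: "\<forall>v. b v \<in> app A ` graded V UNIV xs q" "app A e = (\<Sum>v\<in>V. xmult v (b v))" by blast
  then obtain u where u: "\<And>v. u v \<in> graded V UNIV xs q" "\<And>v. b v = app A (u v)"
    unfolding image_iff by metis
  define z where "z = e - (\<Sum>v\<in>V. xmult v (u v))"
  have "z \<in> graded V UNIV xs (Suc q)"
    unfolding z_def by (intro graded_diff[OF e] graded_sum graded_xmult upset_UNIV u(1))
  moreover have "app A z = 0"
    by (simp add: z_def app_diff app_sum app_xmult b(2) u(2))
  ultimately have "cf (z l) {#} = 0"
    using min by (auto simp: minimal_map_def graded_kernel_def)
  moreover have "cf (z l) {#} = 1"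
    by (simp add: z_def fun_diff_def sum_fun_apply cf_sum cf_xmult_const e_def cf_one)
  ultimately show False by simp
qed

end

section \<open>Minimal presentations\<close>

lemma finite_multisets_bounded:
  assumes "finite V" shows "finite {M. set_mset M \<subseteq> V \<and> size M \<le> n}"
proof -
  have "{M. set_mset M \<subseteq> V \<and> size M \<le> n} \<subseteq> mset ` {l. set l \<subseteq> V \<and> length l \<le> n}"
  proof
    fix M assume "M \<in> {M. set_mset M \<subseteq> V \<and> size M \<le> n}"
    moreover obtain l where "mset l = M" using ex_mset by blast
    ultimately show "M \<in> mset ` {l. set l \<subseteq> V \<and> length l \<le> n}" by force
  qed
  then show ?thesis using finite_lists_length_le[OF assms] by (meson finite_imageI finite_subset)
qed

abbreviation const :: "'k \<Rightarrow> ('v, 'k::field) mpoly" where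
  "const c \<equiv> Poly_Mapping.single 0 c"

lemma zero_eq_mon_iff: "0 = mon M \<longleftrightarrow> M = {#}"
  by (metis mon_empty mon_inject)

lemma cf_const: "cf (const c) M = (if M = {#} then c else 0)"
  by (simp add: cf_def lookup_single when_def zero_eq_mon_iff)

text \<open>
  Graded pieces are finite-dimensional over the field, being spanned by finitely many monomial
  vectors.
\<close>

lemma graded_finite_spanning:
  fixes W :: "('v, 'k::field) mvec set"
  assumes V: "finite V" and W: "W \<subseteq> graded V UNIV xs q"
  shows "\<exists>B. finite B \<and> B \<subseteq> W \<and> (\<forall>w\<in>W. \<exists>u. w = (\<Sum>b\<in>B. (\<lambda>l. const (u b) * b l)))"
proof -
  let ?scale = "\<lambda>c (f :: ('v, 'k) mvec). (\<lambda>l. const c * f l)"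
  interpret vs: vector_space ?scale
  proof
    fix a b :: 'k and f g :: "('v, 'k) mvec"
    show "?scale a (f + g) = ?scale a f + ?scale a g" by (simp add: fun_eq_iff distrib_left)
    show "?scale (a + b) f = ?scale a f + ?scale b f" by (simp add: fun_eq_iff distrib_right single_add)
    show "?scale a (?scale b f) = ?scale (a * b) f"
      by (simp add: fun_eq_iff mult_single mult.assoc[symmetric])
    show "?scale 1 f = f" by simp
  qed
  define I where "I = {(l, M). l < length xs \<and> set_mset M \<subseteq> V \<and> size M \<le> q}"
  have "I = {..<length xs} \<times> {M. set_mset M \<subseteq> V \<and> size M \<le> q}" by (auto simp: I_def)
  then have finI: "finite I" using finite_multisets_bounded[OF V] by simp
  define e :: "nat \<times> 'v multiset \<Rightarrow> ('v, 'k) mvec" where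
    "e i = (\<lambda>l. if l = fst i then Poly_Mapping.single (mon (snd i)) 1 else 0)" for i
  have span: "f \<in> vs.span (e ` I)" if "f \<in> W" for f
  proof -
    have f: "l < length xs \<and> set_mset M \<subseteq> V \<and> size M + xs ! l = q" if "cf (f l) M \<noteq> 0" for l M
    proof -
      have "f \<in> graded V UNIV xs q" using W \<open>f \<in> W\<close> by blast
      then show ?thesis using that by (simp add: graded_def)
    qed
    have "cf (f l) M = cf ((\<Sum>i\<in>I. ?scale (cf (f (fst i)) (snd i)) (e i)) l) M" for l M
    proof -
      have "cf ((\<Sum>i\<in>I. ?scale (cf (f (fst i)) (snd i)) (e i)) l) M
          = (\<Sum>i\<in>I. if i = (l, M) then cf (f l) M else 0)"
        unfolding sum_fun_apply cf_sum
      proof (intro sum.cong refl)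
        fix i
        show "cf (?scale (cf (f (fst i)) (snd i)) (e i) l) M = (if i = (l, M) then cf (f l) M else 0)"
          by (cases i) (auto simp: cf_const_mult e_def cf_def[of "Poly_Mapping.single _ _"] lookup_single when_def)
      qed
      also have "\<dots> = cf (f l) M"
      proof (cases "cf (f l) M = 0")
        case True
        have "(\<Sum>i\<in>I. if i = (l, M) then cf (f l) M else 0) = 0" by (rule sum.neutral) (simp add: True)
        then show ?thesis using True by simp
      next
        case False
        then have "(l, M) \<in> I" using f[OF False] by (simp add: I_def)
        then show ?thesis using finI by simp
      qed
      finally show ?thesis by simp
    qed
    then have "f = (\<Sum>i\<in>I. ?scale (cf (f (fst i)) (snd i)) (e i))"
      by (intro ext iffD2[OF mpoly_eq_iff] allI)
    moreover have "(\<Sum>i\<in>I. ?scale (cf (f (fst i)) (snd i)) (e i)) \<in> vs.span (e ` I)"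
      by (intro vs.span_sum vs.span_scale vs.span_base imageI)
    ultimately show ?thesis by simp
  qed
  obtain B where B: "B \<subseteq> W" "vs.independent B" "W \<subseteq> vs.span B"
    using vs.maximal_independent_subset by blast
  have "B \<subseteq> vs.span (e ` I)" using B(1) span by blast
  then have finB: "finite B" using vs.independent_span_bound[of "e ` I" B] finI B(2) by blast
  have "\<exists>u. w = (\<Sum>b\<in>B. ?scale (u b) b)" if "w \<in> W" for w
    using that B(3) vs.span_finite[OF finB] by auto
  then show ?thesis using B(1) finB by blast
qed

text \<open>
  Generators are pairs of a degree and a homogeneous vector of this degree. The coefficient of a
  generator is homogeneous of the complementary degree, hence zero if the generator has degree
  above \<open>q\<close>.
\<close>

definition generated :: "'v set \<Rightarrow> (nat \<times> ('v, 'k::field) mvec) set \<Rightarrow> nat \<Rightarrow> ('v, 'k) mvec set" where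
  "generated V B q = {w. \<exists>h. (\<forall>b M. cf (h b) M \<noteq> 0 \<longrightarrow> b \<in> B \<and> set_mset M \<subseteq> V \<and> size M + fst b = q) \<and>
     w = (\<Sum>b\<in>B. (\<lambda>k. h b * snd b k))}"

text \<open>
  Vector space bases of the pieces of degree at most \<open>N\<close> generate everything, since all higher pieces are
  combinations of the variables.
\<close>

lemma generated_finite:
  fixes M :: "nat \<Rightarrow> ('v, 'k::field) mvec set"
  assumes V: "finite V" and M: "\<And>q. M q \<subseteq> graded V UNIV ys q"
    and gen: "\<And>q w. N \<le> q \<Longrightarrow> w \<in> M (Suc q) \<Longrightarrow> \<exists>b. (\<forall>v. b v \<in> M q) \<and> w = (\<Sum>v\<in>V. xmult v (b v))"
  shows "\<exists>B. finite B \<and> (\<forall>b\<in>B. snd b \<in> M (fst b)) \<and> (\<forall>q. M q \<subseteq> generated V B q)"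
proof -
  have "\<forall>q. \<exists>B. finite B \<and> B \<subseteq> M q \<and> (\<forall>w\<in>M q. \<exists>u. w = (\<Sum>b\<in>B. (\<lambda>l. const (u b) * b l)))"
    using graded_finite_spanning[OF V M] by blast
  from choice[OF this] obtain C where C': "\<forall>q. finite (C q) \<and> C q \<subseteq> M q \<and>
      (\<forall>w\<in>M q. \<exists>u. w = (\<Sum>b\<in>C q. (\<lambda>l. const (u b) * b l)))" by blast
  then have C: "finite (C q)" "C q \<subseteq> M q" for q by simp_all
  have C_span: "\<exists>u. w = (\<Sum>b\<in>C q. (\<lambda>l. const (u b) * b l))" if "w \<in> M q" for q w
    using C' that by simp
  define B where "B = (SIGMA q:{..N}. C q)"
  have fin: "finite B" using C(1) by (simp add: B_def)
  have low: "w \<in> generated V B q" if "q \<le> N" "w \<in> M q" for q w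
  proof -
    from C_span[OF that(2)] obtain u where u: "w = (\<Sum>b\<in>C q. (\<lambda>l. const (u b) * b l))" by blast
    define h :: "nat \<times> ('v, 'k) mvec \<Rightarrow> ('v, 'k) mpoly"
      where "h b = (if b \<in> B \<and> fst b = q then const (u (snd b)) else 0)" for b
    have "\<forall>b M. cf (h b) M \<noteq> 0 \<longrightarrow> b \<in> B \<and> set_mset M \<subseteq> V \<and> size M + fst b = q"
      by (simp add: h_def cf_const)
    moreover have "w = (\<Sum>b\<in>B. (\<lambda>k. h b * snd b k))"
    proof -
      have "(\<Sum>b\<in>B. (\<lambda>k. h b * snd b k)) = (\<Sum>b\<in>Pair q ` C q. (\<lambda>k. h b * snd b k))"
        using fin that(1) by (intro sum.mono_neutral_right) (auto simp: B_def h_def fun_eq_iff)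
      also have "\<dots> = (\<Sum>b\<in>C q. (\<lambda>k. h (q, b) * b k))"
        by (subst sum.reindex) (auto simp: inj_on_def)
      also have "\<dots> = w"
        unfolding u using that(1) by (intro sum.cong refl) (auto simp: h_def B_def)
      finally show ?thesis by simp
    qed
    ultimately show ?thesis unfolding generated_def by blast
  qed
  have "w \<in> generated V B q" if "w \<in> M q" for q w
    using that
  proof (induction q arbitrary: w)
    case 0
    then show ?case using low by simp
  next
    case (Suc q)
    show ?case
    proof (cases "Suc q \<le> N")
      case True
      then show ?thesis using low Suc.prems by blast
    next
      case False
      then obtain b where b: "\<And>v. b v \<in> M q" "w = (\<Sum>v\<in>V. xmult v (b v))"
        using gen[OF _ Suc.prems] by auto
      have "\<forall>v. \<exists>h. (\<forall>x M. cf (h x) M \<noteq> 0 \<longrightarrow> x \<in> B \<and> set_mset M \<subseteq> V \<and> size M + fst x = q) \<and>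
          b v = (\<Sum>x\<in>B. (\<lambda>k. h x * snd x k))"
        using Suc.IH[OF b(1)] unfolding generated_def by blast
      from choice[OF this] obtain h where
        h: "\<And>v x M. cf (h v x) M \<noteq> 0 \<Longrightarrow> x \<in> B \<and> set_mset M \<subseteq> V \<and> size M + fst x = q"
          "\<And>v. b v = (\<Sum>x\<in>B. (\<lambda>k. h v x * snd x k))" by blast
      define H where "H x = (\<Sum>v\<in>V. var v * h v x)" for x
      have "x \<in> B \<and> set_mset M \<subseteq> V \<and> size M + fst x = Suc q" if "cf (H x) M \<noteq> 0" for x M
      proof -
        from that obtain v where v: "v \<in> V" "cf (var v * h v x) M \<noteq> 0"
          unfolding H_def cf_sum by (metis (mono_tags, lifting) sum.neutral)
        then have *: "v \<in># M" "cf (h v x) (M - {#v#}) \<noteq> 0" by (auto simp: cf_var_mult split: if_splits)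
        then obtain M' where M': "M = add_mset v M'" by (metis multi_member_split)
        then show ?thesis using h(1)[of v x M'] * v(1) by simp
      qed
      moreover have "w = (\<Sum>x\<in>B. (\<lambda>k. H x * snd x k))"
      proof
        fix k
        have "w k = (\<Sum>v\<in>V. \<Sum>x\<in>B. var v * h v x * snd x k)"
          by (simp add: b(2) h(2) xmult_def sum_fun_apply sum_distrib_left mult.assoc)
        also have "\<dots> = (\<Sum>x\<in>B. H x * snd x k)"
          unfolding H_def sum_distrib_right by (rule sum.swap)
        finally show "w k = (\<Sum>x\<in>B. (\<lambda>k. H x * snd x k)) k" by (simp add: sum_fun_apply)
      qed
      ultimately show ?thesis unfolding generated_def by blast
    qed
  qed
  moreover have "snd b \<in> M (fst b)" if "b \<in> B" for b
    using that C(2)[of "fst b"] by (auto simp: B_def)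
  ultimately show ?thesis using fin by blast
qed

text \<open>
  A homogeneous relation with a constant coefficient at \<open>b0\<close> can be solved for \<open>b0\<close>: by homogeneity this
  coefficient is a nonzero scalar.
\<close>

lemma generator_redundant:
  assumes gen: "M q' \<subseteq> generated V B q'" and B: "finite B"
    and f: "\<And>b M. cf (f b) M \<noteq> 0 \<Longrightarrow> b \<in> B \<and> set_mset M \<subseteq> V \<and> size M + fst b = q"
    and rel: "(\<Sum>b\<in>B. (\<lambda>k. f b * snd b k)) = 0" and unit: "cf (f b0) {#} \<noteq> 0"
  shows "M q' \<subseteq> generated V (B - {b0}) q'"
proof
  fix w assume "w \<in> M q'"
  then obtain h where h: "\<And>b M. cf (h b) M \<noteq> 0 \<Longrightarrow> b \<in> B \<and> set_mset M \<subseteq> V \<and> size M + fst b = q'"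
    and w: "w = (\<Sum>b\<in>B. (\<lambda>k. h b * snd b k))"
    using gen unfolding generated_def by blast
  define c where "c = cf (f b0) {#}"
  have b0: "b0 \<in> B" "fst b0 = q" using f[OF unit] by auto
  have "M = {#}" if "cf (f b0) M \<noteq> 0" for M using f[OF that] b0(2) by simp
  then have fb0: "f b0 = const c"
    unfolding mpoly_eq_iff by (auto simp: c_def cf_const)
  \<comment> \<open>Subtracting the multiple \<open>t\<close> of the relation cancels the coefficient at \<open>b0\<close>.\<close>
  define t where "t = h b0 * const (1 / c)"
  define h' where "h' b = h b - t * f b" for b
  have "c \<noteq> 0" using unit by (simp add: c_def)
  then have h'0: "h' b0 = 0"
    by (simp add: h'_def t_def fb0 mult.assoc mult_single)
  have "b \<in> B - {b0} \<and> set_mset M \<subseteq> V \<and> size M + fst b = q'" if ne: "cf (h' b) M \<noteq> 0" for b M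
  proof (cases "cf (h b) M = 0")
    case False
    have "b \<noteq> b0" using ne h'0 by auto
    then show ?thesis using h[OF False] by simp
  next
    case True
    then have "cf (t * f b) M \<noteq> 0" using ne by (simp add: h'_def)
    from cf_mult_nonzero[OF this] obtain M1 M2 where
      M: "M = M1 + M2" "cf t M1 \<noteq> 0" "cf (f b) M2 \<noteq> 0" by blast
    have "cf (h b0) M1 \<noteq> 0" using M(2) by (simp add: t_def mult.commute[of "h b0"] cf_const_mult)
    moreover have "b \<noteq> b0" using ne h'0 by auto
    ultimately show ?thesis using h[of b0 M1] f[OF M(3)] M(1) b0(2) by auto
  qed
  moreover have "w = (\<Sum>b\<in>B - {b0}. (\<lambda>k. h' b * snd b k))"
  proof
    fix k
    have "(\<Sum>b\<in>B. f b * snd b k) = 0" using fun_cong[OF rel, of k] by (simp add: sum_fun_apply)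
    then have "(\<Sum>b\<in>B. h' b * snd b k) = w k"
      by (simp add: h'_def w sum_fun_apply left_diff_distrib sum_subtractf mult.assoc sum_distrib_left[symmetric])
    moreover have "(\<Sum>b\<in>B. h' b * snd b k) = (\<Sum>b\<in>B - {b0}. h' b * snd b k)"
      using b0(1) B h'0 by (simp add: sum.remove)
    ultimately show "w k = (\<Sum>b\<in>B - {b0}. (\<lambda>k. h' b * snd b k)) k" by (simp add: sum_fun_apply)
  qed
  ultimately show "w \<in> generated V (B - {b0}) q'" unfolding generated_def by blast
qed

text \<open>
  Take a generating set of least cardinality: by \<open>generator_redundant\<close> no relation has a
  constant term.
\<close>

theorem minimal_presentation:
  fixes M :: "nat \<Rightarrow> ('v, 'k::field) mvec set"
  assumes V: "finite V" and M: "\<And>q. M q \<subseteq> graded V UNIV ys q"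
    and zero: "\<And>q. 0 \<in> M q" and add: "\<And>q w w'. w \<in> M q \<Longrightarrow> w' \<in> M q \<Longrightarrow> w + w' \<in> M q"
    and smul: "\<And>q d a w. w \<in> M q \<Longrightarrow> (\<And>N. cf a N \<noteq> 0 \<Longrightarrow> set_mset N \<subseteq> V \<and> size N = d) \<Longrightarrow>
      (\<lambda>k. a * w k) \<in> M (d + q)"
    and gen: "\<And>q w. N \<le> q \<Longrightarrow> w \<in> M (Suc q) \<Longrightarrow> \<exists>b. (\<forall>v. b v \<in> M q) \<and> w = (\<Sum>v\<in>V. xmult v (b v))"
  shows "\<exists>xs A. graded_map V xs ys A \<and> minimal_map V xs A \<and> (\<forall>q. app A ` graded V UNIV xs q = M q)"
proof -
  let ?P = "\<lambda>B. finite B \<and> (\<forall>b\<in>B. snd b \<in> M (fst b)) \<and> (\<forall>q. M q \<subseteq> generated V B q)"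
  have "\<exists>B. ?P B" by (rule generated_finite[OF V M gen])
  then obtain B0 where "?P B0" ..
  from ex_has_least_nat[of ?P, OF this, of card] obtain B where
    B: "?P B" and least: "\<And>C. ?P C \<Longrightarrow> card B \<le> card C" by blast
  have finB: "finite B" using B by simp
  have BM: "snd b \<in> M (fst b)" if "b \<in> B" for b using B that by simp
  have B_gen: "M q \<subseteq> generated V B q" for q using B by simp
  have sumM: "sum F S \<in> M q" if "\<And>i. i \<in> S \<Longrightarrow> F i \<in> M q" for F :: "nat \<times> ('v, 'k) mvec \<Rightarrow> _" and S q
    using that by (induction S rule: infinite_finite_induct) (simp_all add: zero add)
  have generated_eq: "generated V B q = M q" for q
  proof
    show "generated V B q \<subseteq> M q"
    proof
      fix w assume "w \<in> generated V B q"
      then obtain h where h: "\<And>b M. cf (h b) M \<noteq> 0 \<Longrightarrow> b \<in> B \<and> set_mset M \<subseteq> V \<and> size M + fst b = q"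
        and w: "w = (\<Sum>b\<in>B. (\<lambda>k. h b * snd b k))" unfolding generated_def by blast
      show "w \<in> M q" unfolding w
      proof (rule sumM)
        fix b assume b: "b \<in> B"
        show "(\<lambda>k. h b * snd b k) \<in> M q"
        proof (cases "h b = 0")
          case True
          then have "(\<lambda>k. h b * snd b k) = 0" by (simp add: fun_eq_iff)
          then show ?thesis using zero by simp
        next
          case False
          then obtain M0 where "cf (h b) M0 \<noteq> 0" by (auto simp: mpoly_eq_iff)
          from h[OF this] have "fst b \<le> q" by auto
          moreover have "set_mset N \<subseteq> V \<and> size N = q - fst b" if "cf (h b) N \<noteq> 0" for N
            using h[OF that] by auto
          ultimately show ?thesis
            using smul[of "snd b" "fst b" "h b" "q - fst b"] BM[OF b] by simp
        qed
      qed
    qed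
  qed (rule B_gen)
  obtain gs where gs: "set gs = B" "distinct gs" using finite_distinct_list[OF finB] by blast
  define n where "n = length gs"
  define xs where "xs = map fst gs"
  define A where "A = mat (length ys) n (\<lambda>(k, l). snd (gs ! l) k)"
  have lxs: "length xs = n" "\<And>l. l < n \<Longrightarrow> xs ! l = fst (gs ! l)" by (simp_all add: xs_def n_def)
  have bij: "bij_betw ((!) gs) {..<n} B"
    using bij_betw_nth[OF gs(2)] gs(1) by (simp add: n_def)
  have colM: "snd (gs ! l) \<in> M (xs ! l)" if "l < n" for l
    using BM[of "gs ! l"] gs(1) that by (auto simp: lxs n_def)
  have col: "k < length ys \<and> set_mset N \<subseteq> V \<and> size N + ys ! k = xs ! l"
    if "l < n" "cf (snd (gs ! l) k) N \<noteq> 0" for k l N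
    using colM[OF that(1)] M[of "xs ! l"] that(2) by (auto simp: graded_def)
  have gm: "graded_map V xs ys A"
    unfolding graded_map_def ball_keys_iff carrier_iff monomial_degree_mon
    using col by (auto simp: A_def lxs)
  have appA: "app A f k = (\<Sum>l<n. f l * snd (gs ! l) k)" for f k
  proof (cases "k < length ys")
    case True
    then show ?thesis by (simp add: app_def A_def mult.commute)
  next
    case False
    then have "snd (gs ! l) k = 0" if "l < n" for l
      using col[OF that] by (auto simp: mpoly_eq_iff)
    then show ?thesis using False by (simp add: app_def A_def)
  qed
  define pos_of where "pos_of b = the_inv_into {..<n} ((!) gs) b" for b
  have pos_of: "pos_of (gs ! l) = l" if "l < n" for l
    using that bij unfolding pos_of_def by (intro the_inv_into_f_f) (auto simp: bij_betw_def)
  have to_B: "\<exists>h. (\<forall>b N. cf (h b) N \<noteq> 0 \<longrightarrow> b \<in> B \<and> set_mset N \<subseteq> V \<and> size N + fst b = q) \<and>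
      app A f = (\<Sum>b\<in>B. (\<lambda>k. h b * snd b k)) \<and> (\<forall>l<n. h (gs ! l) = f l)"
    if f: "f \<in> graded V UNIV xs q" for f q
  proof (intro exI conjI)
    let ?h = "\<lambda>b. if b \<in> B then f (pos_of b) else 0"
    have mem: "gs ! l \<in> B" if "l < n" for l using that gs(1) by (auto simp: n_def)
    show "\<forall>l<n. ?h (gs ! l) = f l" using mem pos_of by simp
    show "\<forall>b N. cf (?h b) N \<noteq> 0 \<longrightarrow> b \<in> B \<and> set_mset N \<subseteq> V \<and> size N + fst b = q"
    proof (intro allI impI)
      fix b N assume ne: "cf (?h b) N \<noteq> 0"
      then have b: "b \<in> B" by (auto split: if_splits)
      then obtain l where l: "l < n" "b = gs ! l" using bij by (auto simp: bij_betw_def)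
      then have "cf (f l) N \<noteq> 0" using ne b pos_of by simp
      then show "b \<in> B \<and> set_mset N \<subseteq> V \<and> size N + fst b = q"
        using f b l lxs(2)[OF l(1)] unfolding graded_def by force
    qed
    show "app A f = (\<Sum>b\<in>B. (\<lambda>k. ?h b * snd b k))"
    proof
      fix k
      have "(\<Sum>b\<in>B. (\<lambda>k. ?h b * snd b k)) k = (\<Sum>b\<in>B. ?h b * snd b k)"
        by (simp only: sum_fun_apply)
      also have "\<dots> = (\<Sum>l<n. ?h (gs ! l) * snd (gs ! l) k)"
        by (rule sum.reindex_bij_betw[OF bij, symmetric])
      also have "\<dots> = app A f k" unfolding appA using mem pos_of by (intro sum.cong refl) simp
      finally show "app A f k = (\<Sum>b\<in>B. (\<lambda>k. ?h b * snd b k)) k" by simp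
    qed
  qed
  have "app A ` graded V UNIV xs q = M q" for q
  proof (intro equalityI subsetI)
    fix w assume "w \<in> app A ` graded V UNIV xs q"
    then obtain f where f: "f \<in> graded V UNIV xs q" "w = app A f" by blast
    have "w \<in> generated V B q" unfolding f(2) generated_def using to_B[OF f(1)] by blast
    then show "w \<in> M q" by (simp add: generated_eq)
  next
    fix w assume "w \<in> M q"
    then have "w \<in> generated V B q" by (simp add: generated_eq)
    then obtain h where h: "\<And>b N. cf (h b) N \<noteq> 0 \<Longrightarrow> b \<in> B \<and> set_mset N \<subseteq> V \<and> size N + fst b = q"
      and w: "w = (\<Sum>b\<in>B. (\<lambda>k. h b * snd b k))" unfolding generated_def by blast
    define f where "f l = (if l < n then h (gs ! l) else 0)" for l
    have "l < length xs \<and> set_mset N \<subseteq> V \<and> N \<in> UNIV \<and> size N + xs ! l = q" if "cf (f l) N \<noteq> 0" for l N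
      using that h[of "gs ! l" N] lxs by (auto simp: f_def split: if_splits)
    then have "f \<in> graded V UNIV xs q" by (simp add: graded_def)
    moreover have "w = app A f"
    proof
      fix k
      have "w k = (\<Sum>b\<in>B. h b * snd b k)" by (simp add: w sum_fun_apply)
      also have "\<dots> = (\<Sum>l<n. h (gs ! l) * snd (gs ! l) k)"
        by (rule sum.reindex_bij_betw[OF bij, symmetric])
      also have "\<dots> = app A f k" unfolding appA by (intro sum.cong refl) (simp add: f_def)
      finally show "w k = app A f k" .
    qed
    ultimately show "w \<in> app A ` graded V UNIV xs q" by blast
  qed
  moreover have "minimal_map V xs A"
    unfolding minimal_map_def
  proof (intro allI ballI, rule ccontr)
    fix q f l assume "f \<in> graded_kernel V xs A q" and unit: "cf (f l) {#} \<noteq> 0"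
    then have f: "f \<in> graded V UNIV xs q" "app A f = 0" by (auto simp: graded_kernel_def)
    then have l: "l < n" using unit lxs(1) by (auto simp: graded_def)
    from to_B[OF f(1)] obtain h where
      h: "\<And>b N. cf (h b) N \<noteq> 0 \<Longrightarrow> b \<in> B \<and> set_mset N \<subseteq> V \<and> size N + fst b = q"
        "app A f = (\<Sum>b\<in>B. (\<lambda>k. h b * snd b k))" "\<And>l. l < n \<Longrightarrow> h (gs ! l) = f l" by blast
    have "(\<Sum>b\<in>B. (\<lambda>k. h b * snd b k)) = 0" using h(2) f(2) by simp
    moreover have "cf (h (gs ! l)) {#} \<noteq> 0" using h(3)[OF l] unit by simp
    ultimately have "M q' \<subseteq> generated V (B - {gs ! l}) q'" for q'
      using h(1) by (intro generator_redundant[of M q' V B h q "gs ! l"] B_gen finB) simp_all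
    then have "card B \<le> card (B - {gs ! l})" using finB BM by (intro least) simp
    moreover have "gs ! l \<in> B" using l gs(1) by (auto simp: n_def)
    ultimately show False using card_Diff1_less[OF finB, of "gs ! l"] by simp
  qed
  ultimately show ?thesis using gm by blast
qed

section \<open>Minimal free resolutions\<close>

definition monomial_ideal :: "'v set \<Rightarrow> 'v multiset set \<Rightarrow> ('v, 'k::field) mpoly set" where
  "monomial_ideal V U = {p. \<forall>M. cf p M \<noteq> 0 \<longrightarrow> set_mset M \<subseteq> V \<and> M \<in> U}"

lemma mult_mat_vec_vec:
  assumes "dim_col A = n" shows "A *\<^sub>v vec n f = vec (dim_row A) (app A f)"
  using assms by (intro eq_vecI) (auto simp: mult_mat_vec_def scalar_prod_def app_def lessThan_atLeast0)

lemma free_module_eq: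
  "(free_module V n :: ('v, 'k::field) mpoly vec set) = vec n ` poly_vectors V n"
proof (intro equalityI subsetI)
  fix w :: "('v, 'k) mpoly vec" assume w: "w \<in> free_module V n"
  define f where "f l = (if l < n then w $ l else 0)" for l
  have "w = vec n f" using w by (intro eq_vecI) (auto simp: free_module_def f_def)
  moreover have "f \<in> poly_vectors V n"
    using w by (simp add: poly_vectors_def free_module_def carrier_iff f_def)
  ultimately show "w \<in> vec n ` poly_vectors V n" by blast
next
  fix w :: "('v, 'k) mpoly vec" assume "w \<in> vec n ` poly_vectors V n"
  then obtain f where f: "w = vec n f" "f \<in> poly_vectors V n" by blast
  then have "f l \<in> carrier (poly_ring V)" for l by (simp add: poly_vectors_def carrier_iff)
  then show "w \<in> free_module V n" by (simp add: f(1) free_module_def)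
qed

lemma poly_vectors_outside: "f \<in> poly_vectors V n \<Longrightarrow> n \<le> l \<Longrightarrow> f l = 0"
  by (fastforce simp: poly_vectors_def mpoly_eq_iff)

lemma inj_on_vec: "inj_on (vec n) (poly_vectors V n :: ('v, 'k::field) mvec set)"
proof (rule inj_onI)
  fix f g :: "('v, 'k) mvec"
  assume fg: "f \<in> poly_vectors V n" "g \<in> poly_vectors V n" "vec n f = vec n g"
  show "f = g"
  proof
    fix l show "f l = g l"
    proof (cases "l < n")
      case True
      then show ?thesis using arg_cong[OF fg(3), of "\<lambda>w. w $ l"] by simp
    next
      case False
      then show ?thesis using poly_vectors_outside[OF fg(1)] poly_vectors_outside[OF fg(2)] by simp
    qed
  qed
qed

text \<open>
  Translates exactness from vectors of fixed length to functions that vanish beyond the length.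
\<close>

lemma kernel_eq_image_iff:
  assumes A: "graded_map V xs ys A" and B: "graded_map V zs xs B"
  shows "{w \<in> free_module V (length xs). A *\<^sub>v w = 0\<^sub>v (length ys)} = (\<lambda>w. B *\<^sub>v w) ` free_module V (length zs)
    \<longleftrightarrow> {f \<in> poly_vectors V (length xs). app A f = 0} = app B ` poly_vectors V (length zs)"
proof -
  note dims = graded_map_dims[OF A] graded_map_dims[OF B]
  have zero: "vec (length ys) (app A f) = 0\<^sub>v (length ys) \<longleftrightarrow> app A f = 0" for f
  proof
    assume eq: "vec (length ys) (app A f) = 0\<^sub>v (length ys)"
    show "app A f = 0"
    proof
      fix k show "app A f k = 0 k"
      proof (cases "k < length ys")
        case True
        then show ?thesis using arg_cong[OF eq, of "\<lambda>w. w $ k"] by simp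
      qed (simp add: app_def dims)
    qed
  qed (auto intro: eq_vecI)
  have 1: "{w \<in> free_module V (length xs). A *\<^sub>v w = 0\<^sub>v (length ys)} =
      vec (length xs) ` {f \<in> poly_vectors V (length xs). app A f = 0}"
    unfolding free_module_eq using zero by (auto simp: mult_mat_vec_vec dims)
  have 2: "(\<lambda>w. B *\<^sub>v w) ` free_module V (length zs) = vec (length xs) ` app B ` poly_vectors V (length zs)"
    unfolding free_module_eq image_image by (simp add: mult_mat_vec_vec dims)
  have "app B ` poly_vectors V (length zs) \<subseteq> poly_vectors V (length xs)"
    using app_poly_vectors[OF B] by blast
  then show ?thesis unfolding 1 2 by (intro inj_on_image_eq_iff[OF inj_on_vec]) auto
qed

lemma graded_free_resolution_iff:
  "graded_free_resolution V I D d \<longleftrightarrow>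
     (\<forall>i. graded_map V (D i) (target_degrees D i) (d i)) \<and>
     (\<lambda>f. app (d 0) f 0) ` poly_vectors V (length (D 0)) = I \<and>
     (\<forall>i. {f \<in> poly_vectors V (length (D i)). app (d i) f = 0} =
       app (d (Suc i)) ` poly_vectors V (length (D (Suc i))))"
proof (cases "\<forall>i. graded_map V (D i) (target_degrees D i) (d i)")
  case True
  then have gm: "graded_map V (D i) (target_degrees D i) (d i)" for i by blast
  have gm_Suc: "graded_map V (D (Suc i)) (D i) (d (Suc i))" for i
    using gm[of "Suc i"] by (simp add: target_degrees_def)
  have dims: "dim_row (d 0) = 1" "dim_col (d 0) = length (D 0)"
    using graded_map_dims[OF gm[of 0]] by (simp_all add: target_degrees_def)
  have "(\<lambda>w. (d 0 *\<^sub>v w) $ 0) ` free_module V (length (D 0)) =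
      (\<lambda>f. app (d 0) f 0) ` poly_vectors V (length (D 0))"
    unfolding free_module_eq image_image by (simp add: mult_mat_vec_vec dims)
  then show ?thesis
    using True unfolding graded_free_resolution_def kernel_eq_image_iff[OF gm gm_Suc] by simp
next
  case False
  then show ?thesis unfolding graded_free_resolution_def by blast
qed

lemma smul_graded:
  assumes U: "upset U" and w: "w \<in> graded V U xs q"
    and a: "\<And>N. cf a N \<noteq> 0 \<Longrightarrow> set_mset N \<subseteq> V \<and> size N = d"
  shows "(\<lambda>k. a * w k) \<in> graded V U xs (d + q)"
  unfolding graded_def mem_Collect_eq
proof (intro allI impI)
  fix l M assume "cf (a * w l) M \<noteq> 0"
  from cf_mult_nonzero[OF this] obtain M1 M2 where
    M: "M = M1 + M2" "cf a M1 \<noteq> 0" "cf (w l) M2 \<noteq> 0" by blast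
  then have "l < length xs \<and> set_mset M2 \<subseteq> V \<and> M2 \<in> U \<and> size M2 + xs ! l = q"
    using w by (simp add: graded_def)
  moreover from this have "M \<in> U" using U unfolding M(1) upset_def by (metis add.commute)
  ultimately show "l < length xs \<and> set_mset M \<subseteq> V \<and> M \<in> U \<and> size M + xs ! l = d + q"
    using a[OF M(2)] M(1) by auto
qed

text \<open>
  The degreewise form of a minimal resolution of the monomial ideal \<open>U\<close>. Passing to components leads
  from the original form to this one (\<open>minimal_resolution_graded\<close>), and summing over the finitely many
  degrees of a vector leads back (\<open>graded_resolution_minimal\<close>).
\<close>

definition graded_minimal_resolution ::
  "'v set \<Rightarrow> 'v multiset set \<Rightarrow> (nat \<Rightarrow> nat list) \<Rightarrow> (nat \<Rightarrow> ('v, 'k::field) mpoly mat) \<Rightarrow> bool" where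
  "graded_minimal_resolution V U D d \<longleftrightarrow>
     (\<forall>i. graded_map V (D i) (target_degrees D i) (d i) \<and> minimal_map V (D i) (d i)) \<and>
     (\<forall>q. app (d 0) ` graded V UNIV (D 0) q = graded V U [0] q) \<and>
     (\<forall>i q. app (d (Suc i)) ` graded V UNIV (D (Suc i)) q = graded_kernel V (D i) (d i) q)"

lemma cf_one: "cf (1 :: ('v, 'k::field) mpoly) M = (if M = {#} then 1 else 0)"
  using cf_const[of "1 :: 'k" M] by simp

lemma cf_empty: "cf p {#} = Poly_Mapping.lookup p 0"
  by (simp add: cf_def mon_empty)

lemma minimal_resolution_graded:
  fixes d :: "nat \<Rightarrow> ('v, 'k::field) mpoly mat"
  assumes "minimal_graded_free_resolution V (monomial_ideal V U) D d"
  shows "graded_minimal_resolution V U D d"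
proof -
  have gm: "graded_map V (D i) (target_degrees D i) (d i)"
    and im: "(\<lambda>f. app (d 0) f 0) ` poly_vectors V (length (D 0)) = monomial_ideal V U"
    and ex: "{f \<in> poly_vectors V (length (D i)). app (d i) f = 0} =
       app (d (Suc i)) ` poly_vectors V (length (D (Suc i)))" for i
    using assms unfolding minimal_graded_free_resolution_def graded_free_resolution_iff by blast+
  have min: "Poly_Mapping.lookup (d (Suc i) $$ (k, l)) 0 = 0"
    if "k < length (D i)" "l < length (D (Suc i))" for i k l
    using assms that unfolding minimal_graded_free_resolution_def by blast
  have gm0: "graded_map V (D 0) [0] (d 0)" using gm[of 0] by (simp add: target_degrees_def)
  have gmS: "graded_map V (D (Suc i)) (D i) (d (Suc i))" for i
    using gm[of "Suc i"] by (simp add: target_degrees_def)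
  have exact: "app (d (Suc i)) ` graded V UNIV (D (Suc i)) q = graded_kernel V (D i) (d i) q" for i q
  proof (intro equalityI subsetI)
    fix w assume "w \<in> app (d (Suc i)) ` graded V UNIV (D (Suc i)) q"
    then obtain f where f: "f \<in> graded V UNIV (D (Suc i)) q" "w = app (d (Suc i)) f" by blast
    then have "w \<in> app (d (Suc i)) ` poly_vectors V (length (D (Suc i)))"
      using graded_poly_vectors by blast
    then have "app (d i) w = 0" unfolding ex[symmetric] by blast
    then show "w \<in> graded_kernel V (D i) (d i) q"
      using app_graded[OF gmS f(1)] f(2) by (simp add: graded_kernel_def)
  next
    fix w assume w: "w \<in> graded_kernel V (D i) (d i) q"
    then have "w \<in> {f \<in> poly_vectors V (length (D i)). app (d i) f = 0}"
      using graded_poly_vectors by (auto simp: graded_kernel_def)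
    then obtain f where f: "f \<in> poly_vectors V (length (D (Suc i)))" "w = app (d (Suc i)) f"
      unfolding ex by blast
    have "w \<in> graded V UNIV (D i) q" using w by (simp add: graded_kernel_def)
    then have "w = degree_part (D i) q w" by (rule degree_part_id[symmetric])
    also have "\<dots> = app (d (Suc i)) (degree_part (D (Suc i)) q f)"
      unfolding f(2) by (rule app_degree_part[OF gmS, symmetric])
    finally show "w \<in> app (d (Suc i)) ` graded V UNIV (D (Suc i)) q"
      using degree_part_graded[OF f(1)] by blast
  qed
  have "app (d 0) ` graded V UNIV (D 0) q = graded V U [0] q" for q
  proof (intro equalityI subsetI)
    fix w assume "w \<in> app (d 0) ` graded V UNIV (D 0) q"
    then obtain f where f: "f \<in> graded V UNIV (D 0) q" "w = app (d 0) f" by blast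
    have "w 0 \<in> monomial_ideal V U"
      unfolding f(2) using graded_poly_vectors[OF f(1)] im by blast
    then show "w \<in> graded V U [0] q"
      using app_graded[OF gm0 f(1)] unfolding f(2)[symmetric] graded_def monomial_ideal_def by auto
  next
    fix w :: "('v, 'k) mvec" assume w: "w \<in> graded V U [0] q"
    then have "w 0 \<in> monomial_ideal V U" by (auto simp: graded_def monomial_ideal_def)
    then obtain f where f: "f \<in> poly_vectors V (length (D 0))" "w 0 = app (d 0) f 0"
      unfolding im[symmetric] by blast
    have "w l = app (d 0) f l" for l
    proof (cases "l = 0")
      case False
      have "w l = 0" using False w by (auto simp: graded_def mpoly_eq_iff)
      then show ?thesis using False graded_map_dims[OF gm0] by (simp add: app_def)
    qed (simp add: f(2))
    then have wf: "w = app (d 0) f" by blast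
    have "w = degree_part [0] q w" using degree_part_id[OF w] by simp
    also have "\<dots> = app (d 0) (degree_part (D 0) q f)"
      unfolding wf by (rule app_degree_part[OF gm0, symmetric])
    finally show "w \<in> app (d 0) ` graded V UNIV (D 0) q"
      using degree_part_graded[OF f(1)] by blast
  qed
  moreover have "minimal_map V (D i) (d i)" for i
    unfolding minimal_map_def
  proof (intro allI ballI, rule ccontr)
    fix q f l assume "f \<in> graded_kernel V (D i) (d i) q" and ne: "cf (f l) {#} \<noteq> 0"
    then obtain g where f: "f = app (d (Suc i)) g" unfolding exact[symmetric] by blast
    have l: "l < length (D i)"
      using ne graded_map_dims[OF gmS] unfolding f by (auto simp: app_def split: if_splits)
    have "(\<Sum>j<length (D (Suc i)). cf (d (Suc i) $$ (l, j) * g j) {#}) \<noteq> 0"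
      using ne l graded_map_dims[OF gmS] by (simp add: f app_def cf_sum)
    then obtain j where j: "j < length (D (Suc i))" "cf (d (Suc i) $$ (l, j) * g j) {#} \<noteq> 0"
      by (metis (mono_tags, lifting) lessThan_iff sum.neutral)
    from cf_mult_nonzero[OF j(2)] have "cf (d (Suc i) $$ (l, j)) {#} \<noteq> 0" by auto
    then show False using min[OF l j(1)] by (simp add: cf_empty)
  qed
  ultimately show ?thesis using gm exact unfolding graded_minimal_resolution_def by blast
qed

lemma graded_resolution_minimal:
  fixes d :: "nat \<Rightarrow> ('v, 'k::field) mpoly mat"
  assumes "graded_minimal_resolution V U D d"
  shows "minimal_graded_free_resolution V (monomial_ideal V U) D d"
proof -
  have gm: "graded_map V (D i) (target_degrees D i) (d i)" and mm: "minimal_map V (D i) (d i)"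
    and im: "app (d 0) ` graded V UNIV (D 0) q = graded V U [0] q"
    and ex: "app (d (Suc i)) ` graded V UNIV (D (Suc i)) q = graded_kernel V (D i) (d i) q" for i q
    using assms unfolding graded_minimal_resolution_def by blast+
  have gm0: "graded_map V (D 0) [0] (d 0)" using gm[of 0] by (simp add: target_degrees_def)
  have gmS: "graded_map V (D (Suc i)) (D i) (d (Suc i))" for i
    using gm[of "Suc i"] by (simp add: target_degrees_def)
  have "(\<lambda>f. app (d 0) f 0) ` poly_vectors V (length (D 0)) = monomial_ideal V U"
  proof (intro equalityI subsetI)
    fix p assume "p \<in> (\<lambda>f. app (d 0) f 0) ` poly_vectors V (length (D 0))"
    then obtain f where f: "f \<in> poly_vectors V (length (D 0))" "p = app (d 0) f 0" by blast
    have "set_mset M \<subseteq> V \<and> M \<in> U" if "cf p M \<noteq> 0" for M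
    proof -
      have "degree_part [0] (size M) (app (d 0) f) \<in> graded V U [0] (size M)"
        unfolding app_degree_part[OF gm0, symmetric] im[symmetric] using degree_part_graded[OF f(1)] by blast
      moreover have "cf (degree_part [0] (size M) (app (d 0) f) 0) M \<noteq> 0"
        using that f(2) by (simp add: degree_part_def)
      ultimately show ?thesis unfolding graded_def by blast
    qed
    then show "p \<in> monomial_ideal V U" by (simp add: monomial_ideal_def)
  next
    fix p :: "('v, 'k) mpoly" assume p: "p \<in> monomial_ideal V U"
    define w where "w l = (if l = 0 then p else 0)" for l :: nat
    have "w \<in> poly_vectors V (length [0])" using p by (auto simp: w_def poly_vectors_def monomial_ideal_def)
    moreover have "degree_part [0] q w \<in> graded V U [0] q" for q
      using p by (auto simp: degree_part_def graded_def w_def monomial_ideal_def split: if_splits)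
    ultimately have "w \<in> app (d 0) ` poly_vectors V (length (D 0))"
      by (intro mem_image_app) (simp_all only: im)
    then obtain f where f: "f \<in> poly_vectors V (length (D 0))" "w = app (d 0) f" by blast
    have "p = app (d 0) f 0" using fun_cong[OF f(2), of 0] by (simp add: w_def)
    then show "p \<in> (\<lambda>f. app (d 0) f 0) ` poly_vectors V (length (D 0))" using f(1) by blast
  qed
  moreover have "{f \<in> poly_vectors V (length (D i)). app (d i) f = 0} =
      app (d (Suc i)) ` poly_vectors V (length (D (Suc i)))" for i
  proof (intro equalityI subsetI)
    fix f assume "f \<in> {f \<in> poly_vectors V (length (D i)). app (d i) f = 0}"
    then have f: "f \<in> poly_vectors V (length (D i))" "app (d i) f = 0" by auto
    have "app (d i) (degree_part (D i) q f) = 0" for q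
      using app_degree_part[OF gm, of i q f] f(2) by simp
    then have "degree_part (D i) q f \<in> graded_kernel V (D i) (d i) q" for q
      using degree_part_graded[OF f(1)] by (simp add: graded_kernel_def)
    then show "f \<in> app (d (Suc i)) ` poly_vectors V (length (D (Suc i)))"
      by (intro mem_image_app[OF f(1)]) (simp only: ex)
  next
    fix f assume "f \<in> app (d (Suc i)) ` poly_vectors V (length (D (Suc i)))"
    then obtain g where g: "g \<in> poly_vectors V (length (D (Suc i)))" "f = app (d (Suc i)) g" by blast
    have f: "f \<in> poly_vectors V (length (D i))" unfolding g(2) by (rule app_poly_vectors[OF gmS g(1)])
    have vanish: "app (d i) (degree_part (D i) q f) = 0" for q
    proof -
      have "degree_part (D i) q f \<in> graded_kernel V (D i) (d i) q"
        unfolding g(2) app_degree_part[OF gmS, symmetric] ex[symmetric] using degree_part_graded[OF g(1)] by blast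
      then show ?thesis by (simp add: graded_kernel_def)
    qed
    obtain Q where Q: "f = (\<Sum>q\<in>Q. degree_part (D i) q f)" using sum_degree_part[OF f] by blast
    have "app (d i) f = app (d i) (\<Sum>q\<in>Q. degree_part (D i) q f)" by (rule arg_cong[OF Q])
    also have "\<dots> = 0" by (simp only: app_sum vanish sum.neutral_const)
    finally have "app (d i) f = 0" .
    then show "f \<in> {f \<in> poly_vectors V (length (D i)). app (d i) f = 0}" using f by simp
  qed
  moreover have "Poly_Mapping.lookup (d (Suc i) $$ (k, l)) 0 = 0"
    if "k < length (D i)" "l < length (D (Suc i))" for i k l
  proof -
    define e :: "('v, 'k) mvec" where "e j = (if j = l then 1 else 0)" for j
    have "e \<in> graded V UNIV (D (Suc i)) (D (Suc i) ! l)"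
      using that(2) by (simp add: graded_def e_def cf_one)
    then have "app (d (Suc i)) e \<in> graded_kernel V (D i) (d i) (D (Suc i) ! l)"
      unfolding ex[symmetric] by blast
    then have "cf (app (d (Suc i)) e k) {#} = 0" using mm[of i] unfolding minimal_map_def by blast
    moreover have "app (d (Suc i)) e k = d (Suc i) $$ (k, l)"
    proof -
      have "app (d (Suc i)) e k = (\<Sum>j<length (D (Suc i)). if j = l then d (Suc i) $$ (k, l) else 0)"
        using that(1) graded_map_dims[OF gmS] unfolding app_def
        by (simp add: e_def if_distrib[of "(*) _"] cong: if_cong)
      then show ?thesis using that(2) by simp
    qed
    ultimately show ?thesis by (simp add: cf_empty)
  qed
  ultimately show ?thesis
    using gm unfolding minimal_graded_free_resolution_def graded_free_resolution_iff by blast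
qed

context koszul
begin

lemma koszul_acyclic_ideal:
  assumes reg: "reg_le r U" and q: "r \<le> q"
  shows "koszul_acyclic p (graded V U [0] (Suc q)) (graded V U [0] q :: ('v, 'k) mvec set)"
  unfolding koszul_acyclic_def
proof (intro allI impI)
  fix c :: "'v set \<Rightarrow> ('v, 'k) mvec"
  assume c: "koszul_chain p (graded V U [0] (Suc q)) c" and cyc: "\<forall>\<sigma>. koszul_bd c \<sigma> = 0"
  show "\<exists>b. koszul_chain (Suc p) (graded V U [0] q) b \<and> koszul_bd b = c"
  proof (rule koszul_acyclic_from_faces[OF c cyc])
    fix \<tau> l M assume \<tau>: "\<tau> \<subseteq> V" and ne: "cf (c \<tau> l) M \<noteq> 0"
    then have "c \<tau> \<noteq> 0" by auto
    then have "card \<tau> = p" and "c \<tau> \<in> graded V U [0] (Suc q)" using c by (simp_all add: koszul_chain_def)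
    from this(2)[unfolded graded_def mem_Collect_eq, rule_format, OF ne]
    have M: "set_mset M \<subseteq> V" "size M = Suc q" by auto
    note \<open>card \<tau> = p\<close>
    moreover have "finite \<tau>" using \<tau> finite_V by (rule finite_subset)
    ultimately show "acyc p (faces U (M + mset_set \<tau>))"
      using reg q \<tau> M by (simp add: reg_le_def)
  qed
qed

text \<open>
  The image of \<open>d i\<close> is the \<open>i\<close>-th syzygy module; each dimension shift costs one degree.
\<close>

lemma resolution_acyclic:
  assumes res: "graded_minimal_resolution V U D d" and reg: "reg_le r U" and "r + i \<le> q"
  shows "koszul_acyclic p (app (d i) ` graded V UNIV (D i) (Suc q)) (app (d i) ` graded V UNIV (D i) q :: ('v, 'k) mvec set)"
  using assms(3)
proof (induction i arbitrary: p q)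
  case 0
  then show ?case using res koszul_acyclic_ideal[OF reg] by (simp add: graded_minimal_resolution_def)
next
  case (Suc i)
  have "koszul_acyclic p (graded_kernel V (D i) (d i) (Suc q)) (graded_kernel V (D i) (d i) q)"
  proof (rule dimension_shift[where r = "r + i"])
    show "graded_map V (D i) (target_degrees D i) (d i)" "minimal_map V (D i) (d i)"
      using res by (simp_all add: graded_minimal_resolution_def)
    show "Suc (r + i) \<le> q" using Suc.prems by simp
  qed (rule Suc.IH)
  then show ?case using res by (simp add: graded_minimal_resolution_def)
qed

theorem resolution_degree_bound:
  assumes res: "graded_minimal_resolution V U D (d :: nat \<Rightarrow> ('v, 'k) mpoly mat)" and reg: "reg_le r U"
    and j: "j \<in> set (D i)"
  shows "j \<le> r + i"
proof -
  obtain l where l: "l < length (D i)" "D i ! l = j" using j by (auto simp: in_set_conv_nth)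
  have "D i ! l \<le> r + i"
  proof (rule basis_degree_bound[OF _ _ _ l(1)])
    show "graded_map V (D i) (target_degrees D i) (d i)" "minimal_map V (D i) (d i)"
      using res by (simp_all add: graded_minimal_resolution_def)
  qed (rule resolution_acyclic[OF res reg])
  then show ?thesis using l(2) by simp
qed

text \<open>
  Acyclicity in homological degree \<open>0\<close> bounds the degrees of generators, which replaces Hilbert's
  basis theorem here.
\<close>

lemma presentation_of_acyclic:
  assumes M: "\<And>q. M q \<subseteq> graded V UNIV ys q"
    and zero: "\<And>q. 0 \<in> M q" and add: "\<And>q w w'. w \<in> M q \<Longrightarrow> w' \<in> M q \<Longrightarrow> w + w' \<in> M q"
    and smul: "\<And>q d (a :: ('v, 'k) mpoly) w. w \<in> M q \<Longrightarrow>
      (\<And>N. cf a N \<noteq> 0 \<Longrightarrow> set_mset N \<subseteq> V \<and> size N = d) \<Longrightarrow> (\<lambda>k. a * w k) \<in> M (d + q)"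
    and ac: "\<And>p q. r \<le> q \<Longrightarrow> koszul_acyclic p (M (Suc q)) (M q)"
  shows "\<exists>xs A. graded_map V xs ys A \<and> minimal_map V xs A \<and> (\<forall>q. app A ` graded V UNIV xs q = M q) \<and>
    (\<forall>p q. r \<le> q \<longrightarrow> koszul_acyclic p (app A ` graded V UNIV xs (Suc q)) (app A ` graded V UNIV xs q))"
proof -
  have "\<exists>xs A. graded_map V xs ys A \<and> minimal_map V xs A \<and> (\<forall>q. app A ` graded V UNIV xs q = M q)"
  proof (rule minimal_presentation[OF finite_V M zero add smul])
    show "\<exists>b. (\<forall>v. b v \<in> M q) \<and> w = (\<Sum>v\<in>V. xmult v (b v))" if "r \<le> q" "w \<in> M (Suc q)" for q w
      by (rule koszul_acyclic_generation[OF ac[OF that(1)] that(2) zero])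
  qed
  then obtain xs A where "graded_map V xs ys A" "minimal_map V xs A"
    and eq: "\<And>q. app A ` graded V UNIV xs q = M q" by blast
  then show ?thesis using ac by (intro exI[of _ xs] exI[of _ A]) (simp add: eq)
qed

text \<open>
  A stage records the target degrees, the source degrees and the matrix; it also carries the
  acyclicity of its image, which makes the next kernel finitely generated.
\<close>

theorem minimal_resolution_exists:
  assumes U: "upset U" and reg: "reg_le r U"
  shows "\<exists>D (d :: nat \<Rightarrow> ('v, 'k) mpoly mat). graded_minimal_resolution V U D d"
proof -
  let ?stage = "\<lambda>n (ys, xs, A :: ('v, 'k) mpoly mat). graded_map V xs ys A \<and> minimal_map V xs A \<and>
    (\<forall>p q. r + n \<le> q \<longrightarrow> koszul_acyclic p (app A ` graded V UNIV xs (Suc q)) (app A ` graded V UNIV xs q)) \<and>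
    (n = 0 \<longrightarrow> ys = [0] \<and> (\<forall>q. app A ` graded V UNIV xs q = graded V U [0] q))"
  let ?next = "\<lambda>(n::nat) (ys, xs, A :: ('v, 'k) mpoly mat) (ys', xs', A'). ys' = xs \<and>
    (\<forall>q. app A' ` graded V UNIV xs' q = graded_kernel V xs A q)"
  have "\<exists>s. ?stage 0 s"
  proof -
    have "\<exists>xs A. graded_map V xs [0] A \<and> minimal_map V xs A \<and>
      (\<forall>q. app A ` graded V UNIV xs q = (graded V U [0] q :: ('v, 'k) mvec set)) \<and>
      (\<forall>p q. r \<le> q \<longrightarrow> koszul_acyclic p (app A ` graded V UNIV xs (Suc q)) (app A ` graded V UNIV xs q))"
      by (intro presentation_of_acyclic graded_zero graded_add smul_graded[OF U] koszul_acyclic_ideal[OF reg])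
        (fastforce simp: graded_def)
    then show ?thesis by auto
  qed
  moreover have "\<exists>s'. ?stage (Suc n) s' \<and> ?next n s s'" if "?stage n s" for n s
  proof -
    obtain ys xs A where s: "s = (ys, xs, A)" by (cases s)
    have A: "graded_map V xs ys A" "minimal_map V xs A"
      and ac: "\<And>p q. r + n \<le> q \<Longrightarrow> koszul_acyclic p (app A ` graded V UNIV xs (Suc q)) (app A ` graded V UNIV xs q)"
      using that by (auto simp: s)
    have "\<exists>zs B. graded_map V zs xs B \<and> minimal_map V zs B \<and>
      (\<forall>q. app B ` graded V UNIV zs q = graded_kernel V xs A q) \<and>
      (\<forall>p q. Suc (r + n) \<le> q \<longrightarrow> koszul_acyclic p (app B ` graded V UNIV zs (Suc q)) (app B ` graded V UNIV zs q))"
    proof (rule presentation_of_acyclic)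
      show "graded_kernel V xs A q \<subseteq> graded V UNIV xs q" for q by (auto simp: graded_kernel_def)
      show "0 \<in> graded_kernel V xs A q" for q by (simp add: graded_kernel_def graded_zero del: zero_fun_apply)
      show "w + w' \<in> graded_kernel V xs A q" if "w \<in> graded_kernel V xs A q" "w' \<in> graded_kernel V xs A q" for q w w'
        using that by (simp add: graded_kernel_def graded_add app_add del: plus_fun_apply)
      show "(\<lambda>k. a * w k) \<in> graded_kernel V xs A (d + q)"
        if "w \<in> graded_kernel V xs A q" "\<And>N. cf a N \<noteq> 0 \<Longrightarrow> set_mset N \<subseteq> V \<and> size N = d" for q d a w
        using that smul_graded[OF upset_UNIV, of w V xs q a d] by (simp add: graded_kernel_def app_mult fun_eq_iff)
      show "koszul_acyclic p (graded_kernel V xs A (Suc q)) (graded_kernel V xs A q)" if "Suc (r + n) \<le> q" for p q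
        using dimension_shift[OF A ac that] .
    qed
    then obtain zs B where "graded_map V zs xs B" "minimal_map V zs B"
      "\<forall>q. app B ` graded V UNIV zs q = graded_kernel V xs A q"
      "\<forall>p q. Suc (r + n) \<le> q \<longrightarrow> koszul_acyclic p (app B ` graded V UNIV zs (Suc q)) (app B ` graded V UNIV zs q)"
      by blast
    then show ?thesis by (intro exI[of _ "(xs, zs, B)"]) (simp add: s)
  qed
  ultimately have "\<exists>F. \<forall>n. ?stage n (F n) \<and> ?next n (F n) (F (Suc n))"
    by (rule dependent_nat_choice)
  then obtain F where F': "\<forall>n. ?stage n (F n) \<and> ?next n (F n) (F (Suc n))" by (rule exE)
  have F: "?stage n (F n)" "?next n (F n) (F (Suc n))" for n
    using F'[THEN spec, of n] by (rule conjunct1, rule conjunct2)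
  define D where "D n = fst (snd (F n))" for n
  define d where "d n = snd (snd (F n))" for n
  have Fn: "F n = (fst (F n), D n, d n)" for n by (simp add: D_def d_def)
  have stage: "?stage n (fst (F n), D n, d n)" for n using F(1)[of n] by (subst (asm) Fn)
  have nxt: "?next n (fst (F n), D n, d n) (fst (F (Suc n)), D (Suc n), d (Suc n))" for n
    using F(2)[of n] by (simp add: Fn[symmetric])
  have tgt: "fst (F n) = target_degrees D n" for n
  proof (cases n)
    case 0
    then show ?thesis using stage[of 0] by (simp add: target_degrees_def)
  next
    case (Suc m)
    then show ?thesis using nxt[of m] by (simp add: target_degrees_def)
  qed
  have "graded_minimal_resolution V U D d"
    unfolding graded_minimal_resolution_def
  proof (intro conjI allI)
    fix i q
    show "graded_map V (D i) (target_degrees D i) (d i)" "minimal_map V (D i) (d i)"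
      using stage[of i] tgt[of i] by simp_all
    show "app (d 0) ` graded V UNIV (D 0) q = graded V U [0] q" using stage[of 0] by simp
    show "app (d (Suc i)) ` graded V UNIV (D (Suc i)) q = graded_kernel V (D i) (d i) q"
      using nxt[of i] by simp
  qed
  then show ?thesis by blast
qed

theorem regularity_le:
  assumes U: "upset U" and reg: "reg_le r U"
  shows "regularity V (monomial_ideal V U :: ('v, 'k) mpoly set) \<le> ereal (real r)"
  unfolding regularity_def
proof (rule Sup_least)
  let ?I = "monomial_ideal V U :: ('v, 'k) mpoly set"
  fix x assume "x \<in> {ereal (real j - real i) |i j. betti V ?I i j \<noteq> 0}"
  then obtain i j where x: "x = ereal (real j - real i)" and b: "betti V ?I i j \<noteq> 0" by blast
  define R where "R = (SOME (D, d). minimal_graded_free_resolution V ?I D d)"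
  have "\<exists>R. case R of (D, d) \<Rightarrow> minimal_graded_free_resolution V ?I D d"
    using minimal_resolution_exists[OF U reg] graded_resolution_minimal by fast
  then have "case R of (D, d) \<Rightarrow> minimal_graded_free_resolution V ?I D d"
    unfolding R_def by (rule someI_ex)
  then have "minimal_graded_free_resolution V ?I (fst R) (snd R)" by (simp add: case_prod_beta)
  then have res: "graded_minimal_resolution V U (fst R) (snd R)" by (rule minimal_resolution_graded)
  have "j \<in> set (fst R i)"
    using b unfolding betti_def R_def[symmetric] by (metis count_notin)
  then have "j \<le> r + i" by (rule resolution_degree_bound[OF res reg])
  then show "x \<le> ereal (real r)" by (simp add: x)
qed

end

section \<open>Powers of the edge ideal are monomial\<close>

text \<open>
  A polynomial in a monomial ideal is a sum of terms in it, so membership in \<open>J\<close> has to be checked on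
  terms only.
\<close>

lemma monomial_ideal_subset:
  fixes J :: "('v, 'k::field) mpoly set"
  assumes zero: "0 \<in> J" and add: "\<And>p q. p \<in> J \<Longrightarrow> q \<in> J \<Longrightarrow> p + q \<in> J"
    and mon: "\<And>M c. set_mset M \<subseteq> V \<Longrightarrow> M \<in> U \<Longrightarrow> Poly_Mapping.single (mon M) c \<in> J"
  shows "monomial_ideal V U \<subseteq> J"
proof
  fix p :: "('v, 'k) mpoly" assume p: "p \<in> monomial_ideal V U"
  have "p = poly_of (cf p)" by (simp add: mpoly_eq_iff cf_poly_of finite_cf)
  also have "\<dots> \<in> J"
  proof -
    have sum: "sum F S \<in> J" if "\<And>i. i \<in> S \<Longrightarrow> F i \<in> J" for F and S :: "'v multiset set"
      using that by (induction S rule: infinite_finite_induct) (simp_all add: zero add)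
    show ?thesis unfolding poly_of_def using p by (intro sum mon) (simp_all add: monomial_ideal_def)
  qed
  finally show "p \<in> J" .
qed

lemma monomial_ideal_subset_carrier: "monomial_ideal V U \<subseteq> carrier (poly_ring V)"
  unfolding monomial_ideal_def by (intro subsetI) (simp add: carrier_iff)

lemma ideal_monomial_ideal:
  assumes U: "upset U"
  shows "ideal (monomial_ideal V U :: ('v, 'k::field) mpoly set) (poly_ring V)"
proof -
  let ?R = "poly_ring V :: ('v, 'k) mpoly ring" and ?I = "monomial_ideal V U :: ('v, 'k) mpoly set"
  interpret R: cring ?R by (rule cring_poly_ring)
  have sub: "?I \<subseteq> carrier ?R" by (rule monomial_ideal_subset_carrier)
  have mult: "a * x \<in> ?I" if "x \<in> ?I" "a \<in> carrier ?R" for a x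
    unfolding monomial_ideal_def mem_Collect_eq
  proof (intro allI impI)
    fix M assume "cf (a * x) M \<noteq> 0"
    from cf_mult_nonzero[OF this] obtain M1 M2 where
      M: "M = M1 + M2" "cf a M1 \<noteq> 0" "cf x M2 \<noteq> 0" by blast
    then have "set_mset M1 \<subseteq> V" "set_mset M2 \<subseteq> V" "M2 \<in> U"
      using that unfolding carrier_iff monomial_ideal_def by blast+
    then show "set_mset M \<subseteq> V \<and> M \<in> U"
      using U unfolding M(1) upset_def by (metis add.commute set_mset_union Un_least)
  qed
  have uminus: "\<ominus>\<^bsub>?R\<^esub> x = - x" if "x \<in> carrier ?R" for x
  proof (rule R.minus_equality)
    show "- x \<oplus>\<^bsub>?R\<^esub> x = \<zero>\<^bsub>?R\<^esub>" by (simp add: poly_ring_def)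
    show "- x \<in> carrier ?R" using that by (simp add: carrier_iff)
  qed (rule that)
  show ?thesis
  proof (rule idealI)
    show "subgroup ?I (add_monoid ?R)"
    proof (unfold_locales)
      show "?I \<subseteq> carrier (add_monoid ?R)" using sub by simp
      show "\<one>\<^bsub>add_monoid ?R\<^esub> \<in> ?I" by (simp add: poly_ring_def monomial_ideal_def)
      show "x \<otimes>\<^bsub>add_monoid ?R\<^esub> y \<in> ?I" if "x \<in> ?I" "y \<in> ?I" for x y
        using that unfolding monomial_ideal_def by (simp add: poly_ring_def) (metis add_0)
      show "inv\<^bsub>add_monoid ?R\<^esub> x \<in> ?I" if "x \<in> ?I" for x
      proof -
        have "inv\<^bsub>add_monoid ?R\<^esub> x = - x"
          using uminus[of x] sub that unfolding a_inv_def by blast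
        then show ?thesis using that by (simp add: monomial_ideal_def)
      qed
    qed
  qed (use mult R.ring_axioms in \<open>simp_all add: poly_ring_def mult.commute\<close>)
qed

lemma edge_ideal_eq:
  assumes E: "\<Union>E \<subseteq> V"
  shows "(edge_ideal V E :: ('v, 'k::field) mpoly set) = monomial_ideal V (up (edge_power E 1))"
proof (rule equalityI)
  let ?R = "poly_ring V :: ('v, 'k) mpoly ring"
  let ?S = "{var u * var v |u v. {u, v} \<in> E} :: ('v, 'k) mpoly set"
  interpret R: cring ?R by (rule cring_poly_ring)
  have var2: "var u * var v = (Poly_Mapping.single (mon {#u, v#}) 1 :: ('v, 'k) mpoly)" for u v
    by (simp add: var_def mult_single mon_single[symmetric] mon_add[symmetric] add_mset_commute del: One_nat_def)
  have ep1: "M \<in> up (edge_power E 1) \<longleftrightarrow> (\<exists>u v N. {u, v} \<in> E \<and> M = {#u, v#} + N)" for M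
  proof -
    have "edge_power E 1 = {{#u, v#} |u v. {u, v} \<in> E}" by (auto simp: edge_power.simps(2) One_nat_def)
    then have mem: "g \<in> edge_power E 1 \<longleftrightarrow> (\<exists>u v. {u, v} \<in> E \<and> g = {#u, v#})" for g by auto
    show ?thesis
    proof
      assume "M \<in> up (edge_power E 1)"
      then obtain g where g: "g \<in> edge_power E 1" "g \<subseteq># M" by (auto simp: up_def)
      then obtain N where N: "M = g + N" by (metis subset_mset.le_iff_add)
      obtain u v where "{u, v} \<in> E" "g = {#u, v#}" using g(1) unfolding mem by blast
      then show "\<exists>u v N. {u, v} \<in> E \<and> M = {#u, v#} + N"
        using N by (intro exI[of _ u] exI[of _ v] exI[of _ N]) simp
    next
      assume "\<exists>u v N. {u, v} \<in> E \<and> M = {#u, v#} + N"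
      then obtain u v N where "{u, v} \<in> E" "M = {#u, v#} + N" by blast
      moreover from this(2) have "{#u, v#} \<subseteq># M" by simp
      ultimately show "M \<in> up (edge_power E 1)" using mem unfolding up_def by blast
    qed
  qed
  have gen: "?S \<subseteq> monomial_ideal V (up (edge_power E 1))"
  proof
    fix p :: "('v, 'k) mpoly" assume "p \<in> ?S"
    then obtain u v where p: "p = Poly_Mapping.single (mon {#u, v#}) 1" "{u, v} \<in> E" using var2 by auto
    have "cf p M \<noteq> 0 \<Longrightarrow> M = {#u, v#}" for M
      by (simp add: p(1) cf_def lookup_single when_def split: if_splits)
    moreover have "{#u, v#} \<in> up (edge_power E 1)" using p(2) by (subst ep1) (metis add.right_neutral)
    moreover have "set_mset {#u, v#} \<subseteq> V" using p(2) E by auto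
    ultimately show "p \<in> monomial_ideal V (up (edge_power E 1))" unfolding monomial_ideal_def by blast
  qed
  show "(edge_ideal V E :: ('v, 'k) mpoly set) \<subseteq> monomial_ideal V (up (edge_power E 1))"
    unfolding edge_ideal_def by (rule R.genideal_minimal[OF ideal_monomial_ideal[OF upset_up] gen])
  have Scarr: "?S \<subseteq> carrier ?R" using gen monomial_ideal_subset_carrier by (rule subset_trans)
  interpret J: ideal "edge_ideal V E" ?R
    unfolding edge_ideal_def by (rule R.genideal_ideal[OF Scarr])
  show "monomial_ideal V (up (edge_power E 1)) \<subseteq> (edge_ideal V E :: ('v, 'k) mpoly set)"
  proof (rule monomial_ideal_subset)
    show "0 \<in> (edge_ideal V E :: ('v, 'k) mpoly set)" using J.zero_closed by (simp add: poly_ring_def)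
    show "p + q \<in> edge_ideal V E" if "p \<in> edge_ideal V E" "q \<in> edge_ideal V E" for p q :: "('v, 'k) mpoly"
      using J.a_closed[OF that] by (simp add: poly_ring_def)
    fix M and c :: 'k assume M: "set_mset M \<subseteq> V" "M \<in> up (edge_power E 1)"
    then obtain u v N where N: "{u, v} \<in> E" "M = {#u, v#} + N" using ep1 by blast
    have "var u * var v \<in> (edge_ideal V E :: ('v, 'k) mpoly set)"
      unfolding edge_ideal_def using R.genideal_self[OF Scarr] N(1) by blast
    moreover have "Poly_Mapping.single (mon N) c \<in> carrier ?R"
      using M(1) N(2) by (auto simp: carrier_iff cf_def lookup_single when_def split: if_splits)
    ultimately have "Poly_Mapping.single (mon N) c * (var u * var v) \<in> (edge_ideal V E :: ('v, 'k) mpoly set)"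
      using J.I_l_closed by (simp add: poly_ring_def)
    then show "Poly_Mapping.single (mon M) c \<in> (edge_ideal V E :: ('v, 'k) mpoly set)"
      unfolding var2 by (simp add: mult_single mon_add[symmetric] N(2) add.commute)
  qed
qed

lemma ideal_prod_monomial_ideal:
  "ideal_prod (poly_ring V) (monomial_ideal V A) (monomial_ideal V B :: ('v, 'k::field) mpoly set) =
    monomial_ideal V {u + w |u w. u \<in> A \<and> w \<in> B}"
proof (rule equalityI)
  let ?R = "poly_ring V :: ('v, 'k) mpoly ring" and ?AB = "{u + w |u w. u \<in> A \<and> w \<in> B}"
  show "ideal_prod ?R (monomial_ideal V A) (monomial_ideal V B) \<subseteq> monomial_ideal V ?AB"
  proof
    fix p assume "p \<in> ideal_prod ?R (monomial_ideal V A) (monomial_ideal V B)"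
    then show "p \<in> monomial_ideal V ?AB"
    proof induction
      case (prod i j)
      show ?case unfolding monomial_ideal_def
      proof (rule CollectI, intro allI impI)
        fix M assume "cf (i \<otimes>\<^bsub>?R\<^esub> j) M \<noteq> 0"
        then have "cf (i * j) M \<noteq> 0" by (simp add: poly_ring_def)
        from cf_mult_nonzero[OF this] obtain M1 M2 where
          M: "M = M1 + M2" "cf i M1 \<noteq> 0" "cf j M2 \<noteq> 0" by blast
        then have "set_mset M1 \<subseteq> V \<and> M1 \<in> A" "set_mset M2 \<subseteq> V \<and> M2 \<in> B"
          using prod unfolding monomial_ideal_def by blast+
        then show "set_mset M \<subseteq> V \<and> M \<in> ?AB" unfolding M(1) by auto
      qed
    next
      case (sum p q)
      then show ?case unfolding monomial_ideal_def by (simp add: poly_ring_def) (metis add_0)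
    qed
  qed
  show "monomial_ideal V ?AB \<subseteq> ideal_prod ?R (monomial_ideal V A) (monomial_ideal V B)"
  proof (rule monomial_ideal_subset)
    have "0 \<in> monomial_ideal V A" "0 \<in> monomial_ideal V B" by (simp_all add: monomial_ideal_def)
    from ideal_prod.prod[OF this, of ?R]
    show "0 \<in> ideal_prod ?R (monomial_ideal V A) (monomial_ideal V B)" by (simp add: poly_ring_def)
    show "p + q \<in> ideal_prod ?R (monomial_ideal V A) (monomial_ideal V B)"
      if "p \<in> ideal_prod ?R (monomial_ideal V A) (monomial_ideal V B)"
        "q \<in> ideal_prod ?R (monomial_ideal V A) (monomial_ideal V B)" for p q :: "('v, 'k) mpoly"
      using ideal_prod.sum[OF that] by (simp add: poly_ring_def)
    fix M and c :: 'k assume M: "set_mset M \<subseteq> V" "M \<in> ?AB"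
    then obtain u w where uw: "M = u + w" "u \<in> A" "w \<in> B" by blast
    have "Poly_Mapping.single (mon u) c \<in> monomial_ideal V A"
      "Poly_Mapping.single (mon w) (1 :: 'k) \<in> monomial_ideal V B"
      using M(1) uw by (auto simp: monomial_ideal_def cf_def lookup_single when_def split: if_splits)
    from ideal_prod.prod[OF this, of ?R]
    show "Poly_Mapping.single (mon M) c \<in> ideal_prod ?R (monomial_ideal V A) (monomial_ideal V B)"
      by (simp add: poly_ring_def mult_single mon_add[symmetric] uw(1))
  qed
qed

lemma up_edge_power_Suc:
  "{u + w |u w. u \<in> up (edge_power E s) \<and> w \<in> up (edge_power E 1)} = up (edge_power E (Suc s))"
proof (intro equalityI subsetI)
  fix m assume "m \<in> {u + w |u w. u \<in> up (edge_power E s) \<and> w \<in> up (edge_power E 1)}"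
  then obtain u w g h where m: "m = u + w" "g \<in> edge_power E s" "g \<subseteq># u" "h \<in> edge_power E 1" "h \<subseteq># w"
    by (auto simp: up_def)
  from m(4) obtain a b where h: "h = {#a, b#}" "{a, b} \<in> E" by (auto simp: edge_power.simps(2) One_nat_def)
  have "add_mset a (add_mset b g) \<in> edge_power E (Suc s)" by (rule edge_power_SucI[OF h(2) m(2)])
  moreover have "add_mset a (add_mset b g) \<subseteq># m"
    using subset_mset.add_mono[OF m(3,5)] by (simp add: m(1) h(1))
  ultimately show "m \<in> up (edge_power E (Suc s))" unfolding up_def by blast
next
  fix m assume "m \<in> up (edge_power E (Suc s))"
  then obtain f where "f \<in> edge_power E (Suc s)" "f \<subseteq># m" by (auto simp: up_def)
  then obtain a b g where f: "{a, b} \<in> E" "g \<in> edge_power E s" "add_mset a (add_mset b g) \<subseteq># m"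
    by (auto elim: edge_power_SucE)
  then obtain n where n: "m = add_mset a (add_mset b g) + n" by (metis subset_mset.le_iff_add)
  have "{#a, b#} \<in> edge_power E 1" using edge_power_SucI[OF f(1), of "{#}" 0] by (simp add: One_nat_def)
  then have "{#a, b#} \<in> up (edge_power E 1)" unfolding up_def by blast
  moreover have "g + n \<in> up (edge_power E s)"
    using f(2) mset_subset_eq_add_left[of g n] unfolding up_def by blast
  moreover have "m = (g + n) + {#a, b#}" by (simp add: n)
  ultimately show "m \<in> {u + w |u w. u \<in> up (edge_power E s) \<and> w \<in> up (edge_power E 1)}" by blast
qed

lemma edge_ideal_power_eq:
  assumes E: "\<Union>E \<subseteq> V"
  shows "(edge_ideal V E :: ('v, 'k::field) mpoly set) [^]\<^bsub>ideals_set (poly_ring V)\<^esub> s =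
    monomial_ideal V (up (edge_power E s))"
proof (induction s)
  case 0
  have "up (edge_power E 0) = UNIV" by (auto simp: up_def)
  then have "monomial_ideal V (up (edge_power E 0)) = carrier (poly_ring V :: ('v, 'k) mpoly ring)"
    by (simp add: set_eq_iff monomial_ideal_def carrier_iff)
  then show ?case by (simp add: nat_pow_def ideals_set_def)
next
  case (Suc s)
  have "(edge_ideal V E :: ('v, 'k) mpoly set) [^]\<^bsub>ideals_set (poly_ring V)\<^esub> Suc s =
    ideal_prod (poly_ring V) (edge_ideal V E [^]\<^bsub>ideals_set (poly_ring V)\<^esub> s) (edge_ideal V E)"
    by (simp add: nat_pow_def ideals_set_def)
  also have "\<dots> = monomial_ideal V (up (edge_power E (Suc s)))"
    unfolding Suc.IH unfolding edge_ideal_eq[OF E] ideal_prod_monomial_ideal up_edge_power_Suc ..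
  finally show ?case .
qed

theorem theorem3p9:
  fixes V :: "'v set" and E :: "'v set set" and s :: nat
  assumes "simple_graph V E" and "s \<ge> 1"
  shows "regularity V
           ((edge_ideal V E :: ('v, 'k::field) mpoly set) [^]\<^bsub>ideals_set (poly_ring V)\<^esub> s)
         \<le> ereal (2 * real s + real (ord_match E) - 1)"
proof -
  have fin: "finite V" and EV: "\<Union>E \<subseteq> V" using assms(1) by (auto simp: simple_graph_def)
  obtain idx :: "'v \<Rightarrow> nat" where "inj_on idx V" using finite_imp_inj_to_nat_seg[OF fin] by blast
  then interpret koszul V idx "TYPE('k)" using fin by unfold_locales
  have "regularity V (monomial_ideal V (up (edge_power E s)) :: ('v, 'k) mpoly set)
      \<le> ereal (real (2 * s + ord_match E - 1))"
    by (intro regularity_le upset_up reg_le_edge_power assms)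
  moreover have "real (2 * s + ord_match E - 1) = 2 * real s + real (ord_match E) - 1"
    using assms(2) by simp
  ultimately show ?thesis unfolding edge_ideal_power_eq[OF EV] by simp
qed

end
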